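(* Let $G_n\sim G(n,a/n,b/n)$ be drawn from the planted bisection (stochastic block) model, with average degree $d=(a+b)/2$ and signal-to-noise parameter $\xi=(a-b)/\sqrt{2(a+b)}>0$ held fixed. For $d$ sufficiently large, with high probability as $n\to\infty$, $$\frac1n\mathsf{mcut}(G_n)=\frac d4-\frac{C^*}{4}\sqrt d+o_d(\sqrt d).$$
   Context: The model. $n$ is even, $S\subset\{1,\dots,n\}$ is a fixed subset with $|S|=n/2$, and $a>b>0$. In $G(n,a/n,b/n)$ the vertex set is $\{1,\dots,n\}$ and edges are present independently, $\{i,j\}$ with probability $a/n$ if $i,j$ are both in $S$ or both in $S^c$, and $b/n$ otherwise. $\mathsf{mcut}(G)$ is the minimum bisection: the minimum, over partitions of the vertices into two halves of equal size $n/2$, of the number of edges between the two halves. The parameters $a,b$ are determined by $d,\xi$: $a=d+\xi\sqrt d$, $b=d-\xi\sqrt d$. The constant $C^*=C^*(\xi)$. Let $J=(J_{ij})_{1\le i,j\le n}$ be a standard GOE matrix (symmetric, with independent centered Gaussian entries for $i\le j$, off-diagonal variance $1$ and diagonal variance $2$), and let $\mathbf{1}$ be the all-ones vector. Let $$\tilde F(\beta)=\lim_{n\to\infty}\frac1n\log\sum_{\underline\sigma\in\{\pm1\}^n}\exp\Big(\beta\Big(\frac\xi n\langle\mathbf{1},\underline\sigma\rangle^2+\sum_{i,j=1}^n\frac{J_{ij}}{\sqrt n}\sigma_i\sigma_j\Big)\Big),$$ which exists, and $C^*=\lim_{\beta\to\infty}\tilde F(\beta)/\beta$ (this limit exists).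 Conventions. "With high probability" means with probability tending to $1$ as $n\to\infty$. A sequence of random variables $Z_n$ (depending on $d$) is $o_d(\sqrt d)$ with high probability if there is a deterministic function $g(d)$ with $g(d)/\sqrt d\to0$ as $d\to\infty$ such that $\mathbb{P}[|Z_n|\le g(d)]\to1$ as $n\to\infty$. *)

theory Defs
  imports "HOL-Probability.Probability"
begin

section \<open>The planted bisection model\<close>

text \<open>Vertices are the numbers \<open>1, \<dots>, n\<close>. A simple graph is represented by its set of
  edges, and an edge by the set of its two endpoints.\<close>

definition vertex_pairs :: "nat \<Rightarrow> nat set set" where
  "vertex_pairs n = {e. e \<subseteq> {1..n} \<and> card e = 2}"

text \<open>The law of the edge set of \<open>G(n, p, q)\<close> with planted set \<open>S\<close>: independent edges, with
  probability \<open>p\<close> within \<open>S\<close> or within its complement, and \<open>q\<close> across. The library's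
  \<^const>\<open>bernoulli_pmf\<close> truncates its parameter to the unit interval, which has no effect
  as soon as \<open>p\<close> and \<open>q\<close> are probabilities.\<close>

definition planted_bisection :: "nat \<Rightarrow> nat set \<Rightarrow> real \<Rightarrow> real \<Rightarrow> nat set set pmf" where
  "planted_bisection n S p q =
     map_pmf (\<lambda>\<omega>. {e \<in> vertex_pairs n. \<omega> e})
       (Pi_pmf (vertex_pairs n) False
          (\<lambda>e. bernoulli_pmf (if e \<subseteq> S \<or> e \<inter> S = {} then p else q)))"

definition cut_size :: "nat \<Rightarrow> nat set set \<Rightarrow> nat set \<Rightarrow> nat" where
  "cut_size n E A = card {e \<in> E. e \<inter> A \<noteq> {} \<and> e \<inter> ({1..n} - A) \<noteq> {}}"

definition mcut :: "nat \<Rightarrow> nat set set \<Rightarrow> nat" where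
  "mcut n E = Min (cut_size n E ` {A. A \<subseteq> {1..n} \<and> 2 * card A = n})"

section \<open>The Gaussian model and the constant \<open>C\<^sup>*\<close>\<close>

text \<open>A standard GOE matrix is determined by its independent entries on and above the diagonal;
  the matrix is recovered from these by symmetry. The second parameter of
  \<^const>\<open>normal_density\<close> is the standard deviation.\<close>

definition GOE :: "nat \<Rightarrow> (nat \<times> nat \<Rightarrow> real) measure" where
  "GOE n = PiM {(i, j). 1 \<le> i \<and> i \<le> j \<and> j \<le> n}
     (\<lambda>(i, j). density lborel (normal_density 0 (if i = j then sqrt 2 else 1)))"

definition GOE_entry :: "(nat \<times> nat \<Rightarrow> real) \<Rightarrow> nat \<Rightarrow> nat \<Rightarrow> real" where
  "GOE_entry \<omega> i j = \<omega> (min i j, max i j)"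

definition spins :: "nat \<Rightarrow> (nat \<Rightarrow> real) set" where
  "spins n = {1..n} \<rightarrow>\<^sub>E {-1, 1}"

definition hamiltonian :: "real \<Rightarrow> nat \<Rightarrow> (nat \<Rightarrow> nat \<Rightarrow> real) \<Rightarrow> (nat \<Rightarrow> real) \<Rightarrow> real" where
  "hamiltonian \<xi> n J \<sigma> = \<xi> / real n * (\<Sum>i=1..n. \<sigma> i)\<^sup>2
     + (\<Sum>i=1..n. \<Sum>j=1..n. J i j / sqrt (real n) * \<sigma> i * \<sigma> j)"

definition free_energy_density ::
  "real \<Rightarrow> real \<Rightarrow> nat \<Rightarrow> (nat \<Rightarrow> nat \<Rightarrow> real) \<Rightarrow> real" where
  "free_energy_density \<xi> \<beta> n J =
     1 / real n * ln (\<Sum>\<sigma>\<in>spins n. exp (\<beta> * hamiltonian \<xi> n J \<sigma>))"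

text \<open>The random variables \<open>X n\<close> may live on different probability spaces \<open>M n\<close>.\<close>

definition converges_in_probability ::
  "(nat \<Rightarrow> 'a measure) \<Rightarrow> (nat \<Rightarrow> 'a \<Rightarrow> real) \<Rightarrow> real \<Rightarrow> bool" where
  "converges_in_probability M X c \<longleftrightarrow>
     (\<forall>\<epsilon>>0. (\<lambda>n. measure (M n) {\<omega> \<in> space (M n). \<bar>X n \<omega> - c\<bar> > \<epsilon>}) \<longlonglongrightarrow> 0)"

text \<open>The limit of the random free energy densities is a deterministic number and is taken in
  probability, so that no coupling of the matrices for different \<open>n\<close> has to be chosen.\<close>

definition limit_free_energy :: "real \<Rightarrow> real \<Rightarrow> real" where
  "limit_free_energy \<xi> \<beta> =
     (THE c. converges_in_probability GOE (\<lambda>n \<omega>. free_energy_density \<xi> \<beta> n (GOE_entry \<omega>)) c)"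

definition Cstar :: "real \<Rightarrow> real" where
  "Cstar \<xi> = Lim at_top (\<lambda>\<beta>. limit_free_energy \<xi> \<beta> / \<beta>)"

end

theory Submission
  imports Defs "HOL-Real_Asymp.Real_Asymp"
begin

text \<open>The minimum bisection is minus a ground state energy, and a ground state energy is, up to
  an error of order \<open>n / \<beta>\<close>, a free energy at inverse temperature \<open>\<beta>\<close>. Free energies are smooth functions
  of the edge variables, so the law of these variables can be changed by Lindeberg's method.

  Encode a bisection by signs, multiplied by \<open>-1\<close> on the complement of the planted set, so that
  the planted bisection becomes the constant configuration. The cut is then a linear function of
  the independent edge indicators, with one coefficient \<open>0\<close> or \<open>1\<close> per edge. Replacing the centred
  indicators by Gaussians of variance \<open>d / n\<close> (\<open>lindeberg\<close>, \<open>noise_to_gauss\<close>) changes the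
  free energy at \<open>\<beta> = b / sqrt d\<close> by a controlled amount, and what remains is the Gaussian model
  at inverse temperature \<open>b / 4\<close>, except that the configurations are balanced: they have the
  same magnetization on the two halves (\<open>expected_min_cut\<close>). After division by \<open>\<beta> n\<close> the errors are of order
  \<open>b + b\<^sup>2 + sqrt d / b\<close>, which is negligible against \<open>sqrt d\<close> if \<open>b\<close> tends slowly to infinity with \<open>d\<close>.

  Two facts on the Gaussian model are needed. Its mean free energy per vertex has a limit, and
  the balance constraint does not change the limit. Both follow from one
  inequality of Guerra and Toninelli (\<open>guerra_toninelli\<close>): the free energy of a
  system on \<open>n1 + n2\<close> vertices, with configurations from a product set, is at least the sum of the
  free energies of independent systems on \<open>n1\<close> and \<open>n2\<close> vertices. The ferromagnetic term
  \<open>n m\<^sup>2\<close> is convex in the magnetization \<open>m\<close> and has the wrong sign for this, but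
  it is additive over copies of the same magnetization class. A system of
  \<open>n\<close> vertices has at most \<open>2 n + 1\<close> such classes, and by exponential concentration one
  of them carries the free energy up to \<open>o(n)\<close> (\<open>dominant_magnetization\<close>). Putting \<open>k\<close> copies of
  the dominant class side by side gives almost superadditivity, hence
  the limit (\<open>free_energy_limit\<close>); putting two copies side by side gives balanced configurations
  (\<open>balanced_free_energy_limit\<close>).

  The free energy divided by \<open>\<beta>\<close> decreases in \<open>\<beta>\<close> and is nonnegative, so it converges as
  \<open>\<beta>\<close> tends to infinity. Exponential concentration turns convergence in mean into convergence
  in probability, which identifies the limit with \<open>Cstar\<close> (\<open>Cstar_limit\<close>), and
  it concentrates the minimum bisection around its mean (\<open>mcut_concentration\<close>).

  The interpolation behind the inequality of Guerra and Toninelli is done without Gaussian integration by parts: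
  raising the variance of one coordinate by \<open>t\<close> is the addition of an independent Gaussian of
  variance \<open>t\<close>, so the same third order Taylor bound that proves Lindeberg's theorem also shows that
  the expectation is differentiable in the variances, with half the mean Gibbs variance as derivative
  (\<open>gexp_deriv\<close>, \<open>variance_comparison\<close>).\<close>

section \<open>Images of product measures\<close>

text \<open>All factors of a product measure have to be probability measures before the library
  evaluates it on boxes, so the factors of the target outside its index set are fixed to be point
  masses. Preimages of boxes are boxes, because each coordinate of the source feeds at most one
  coordinate of the target.\<close>

lemma PiM_transport_total:
  fixes T :: "'j \<Rightarrow> 'a \<Rightarrow> real"
  assumes fin: "finite I" and P: "\<And>i. prob_space (M i)"
    and h: "inj_on h J" "h \<in> J \<rightarrow> I"
    and T: "\<And>j. j \<in> J \<Longrightarrow> T j \<in> borel_measurable (M (h j))"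
    and N: "\<And>j. N j = (if j \<in> J then distr (M (h j)) borel (T j) else return borel 0)"
  shows "distr (PiM I M) (PiM J N) (\<lambda>\<omega>. \<lambda>j\<in>J. T j (\<omega> (h j))) = PiM J N"
proof -
  have finJ: "finite J" using inj_on_finite[OF h(1) _ fin] h(2) by auto
  interpret M: product_prob_space M I by (rule product_prob_spaceI) (rule P)
  have PN: "prob_space (N j)" for j
    using N T P by (auto intro!: prob_space.prob_space_distr prob_space_return)
  interpret N: product_prob_space N J by (rule product_prob_spaceI) (rule PN)
  have setsN: "sets (N j) = sets borel" for j by (simp add: N)
  have meas: "(\<lambda>\<omega>. \<lambda>j\<in>J. T j (\<omega> (h j))) \<in> PiM I M \<rightarrow>\<^sub>M PiM J N"
  proof (rule measurable_restrict)
    fix j assume j: "j \<in> J"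
    have "(\<lambda>\<omega>. \<omega> (h j)) \<in> PiM I M \<rightarrow>\<^sub>M M (h j)"
      using h j by (intro measurable_component_singleton) auto
    from measurable_compose[OF this T[OF j]]
    show "(\<lambda>\<omega>. T j (\<omega> (h j))) \<in> PiM I M \<rightarrow>\<^sub>M N j"
      by (simp add: measurable_cong_sets[OF refl setsN])
  qed
  show ?thesis
  proof (rule N.PiM_eqI[OF finJ])
    show "sets (distr (PiM I M) (PiM J N) (\<lambda>\<omega>. \<lambda>j\<in>J. T j (\<omega> (h j)))) = sets (PiM J N)" by simp
    fix A assume A: "\<And>j. j \<in> J \<Longrightarrow> A j \<in> sets (N j)"
    define g where "g = the_inv_into J h"
    have g: "g (h j) = j" if "j \<in> J" for j using h that by (simp add: g_def the_inv_into_f_f)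
    define B where "B i = (if i \<in> h ` J then T (g i) -` A (g i) \<inter> space (M i) else space (M i))" for i
    have B: "B i \<in> sets (M i)" for i
    proof (cases "i \<in> h ` J")
      case True
      then obtain j where j: "j \<in> J" "i = h j" by auto
      show ?thesis using True j g A[of j] T[of j] by (auto simp: B_def setsN intro!: measurable_sets)
    qed (simp add: B_def)
    have "emeasure (distr (PiM I M) (PiM J N) (\<lambda>\<omega>. \<lambda>j\<in>J. T j (\<omega> (h j)))) (PiE J A)
       = emeasure (PiM I M) ((\<lambda>\<omega>. \<lambda>j\<in>J. T j (\<omega> (h j))) -` PiE J A \<inter> space (PiM I M))"
      by (rule emeasure_distr[OF meas]) (intro sets_PiM_I_finite finJ A)
    also have "(\<lambda>\<omega>. \<lambda>j\<in>J. T j (\<omega> (h j))) -` PiE J A \<inter> space (PiM I M) = PiE I B"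
    proof -
      have "\<omega> \<in> PiE I B \<longleftrightarrow> (\<omega> \<in> PiE I (\<lambda>i. space (M i)) \<and> (\<forall>j\<in>J. T j (\<omega> (h j)) \<in> A j))" for \<omega>
      proof
        assume a: "\<omega> \<in> PiE I B"
        have "\<omega> i \<in> space (M i)" if "i \<in> I" for i
          using PiE_mem[OF a that] by (auto simp: B_def split: if_splits)
        moreover have "T j (\<omega> (h j)) \<in> A j" if "j \<in> J" for j
          using PiE_mem[OF a, of "h j"] that h g by (auto simp: B_def split: if_splits)
        ultimately show "\<omega> \<in> PiE I (\<lambda>i. space (M i)) \<and> (\<forall>j\<in>J. T j (\<omega> (h j)) \<in> A j)"
          using a by (auto simp: PiE_def Pi_def)
      next
        assume a: "\<omega> \<in> PiE I (\<lambda>i. space (M i)) \<and> (\<forall>j\<in>J. T j (\<omega> (h j)) \<in> A j)"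
        then have "\<omega> i \<in> B i" if "i \<in> I" for i using that g by (auto simp: B_def PiE_def Pi_def)
        then show "\<omega> \<in> PiE I B" using a by (auto simp: PiE_def Pi_def)
      qed
      note e1 = this
      have e2: "\<omega> \<in> (\<lambda>\<omega>. \<lambda>j\<in>J. T j (\<omega> (h j))) -` PiE J A \<inter> space (PiM I M) \<longleftrightarrow>
        (\<omega> \<in> PiE I (\<lambda>i. space (M i)) \<and> (\<forall>j\<in>J. T j (\<omega> (h j)) \<in> A j))" for \<omega>
        unfolding space_PiM Int_iff vimage_eq PiE_iff[of _ J A] by auto
      show ?thesis by (rule set_eqI) (rule e2[THEN trans, OF e1[symmetric]])
    qed
    also have "emeasure (PiM I M) (PiE I B) = (\<Prod>i\<in>I. emeasure (M i) (B i))"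
      by (rule M.emeasure_PiM[OF fin B])
    also have "\<dots> = (\<Prod>i\<in>h ` J. emeasure (M i) (B i))"
      by (rule prod.mono_neutral_right) (use fin h in \<open>auto simp: B_def prob_space.emeasure_space_1[OF P]\<close>)
    also have "\<dots> = (\<Prod>j\<in>J. emeasure (N j) (A j))"
    proof (subst prod.reindex[OF h(1)], rule prod.cong[OF refl])
      fix j assume j: "j \<in> J"
      show "((\<lambda>i. emeasure (M i) (B i)) \<circ> h) j = emeasure (N j) (A j)"
        using j A[OF j] T[OF j] by (simp add: N B_def g emeasure_distr setsN)
    qed
    finally show "emeasure (distr (PiM I M) (PiM J N) (\<lambda>\<omega>. \<lambda>j\<in>J. T j (\<omega> (h j)))) (PiE J A) = (\<Prod>j\<in>J. emeasure (N j) (A j))" .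
  qed
qed

text \<open>One lemma for all changes of variables: marginals (\<open>h\<close> an inclusion), relabelling of indices
  (\<open>T\<close> the identity) and rescaling of coordinates.\<close>

lemma PiM_transport:
  fixes T :: "'j \<Rightarrow> 'a \<Rightarrow> real"
  assumes "finite I" "\<And>i. prob_space (M i)" "inj_on h J" "h \<in> J \<rightarrow> I"
    and "\<And>j. j \<in> J \<Longrightarrow> T j \<in> borel_measurable (M (h j))"
    and N: "\<And>j. j \<in> J \<Longrightarrow> N j = distr (M (h j)) borel (T j)"
  shows "distr (PiM I M) (PiM J N) (\<lambda>\<omega>. \<lambda>j\<in>J. T j (\<omega> (h j))) = PiM J N"
proof -
  have e: "PiM J N = PiM J (\<lambda>j. if j \<in> J then distr (M (h j)) borel (T j) else return borel 0)"
    by (rule PiM_cong) (simp_all add: N)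
  show ?thesis unfolding e by (rule PiM_transport_total) (use assms in auto)
qed

lemma integral_PiM_transport:
  fixes T :: "'j \<Rightarrow> 'a \<Rightarrow> real" and F :: "('j \<Rightarrow> real) \<Rightarrow> real"
  assumes fin: "finite I" and P: "\<And>i. prob_space (M i)"
    and h: "inj_on h J" "h \<in> J \<rightarrow> I"
    and T: "\<And>j. j \<in> J \<Longrightarrow> T j \<in> borel_measurable (M (h j))"
    and N: "\<And>j. j \<in> J \<Longrightarrow> N j = distr (M (h j)) borel (T j)"
    and F: "F \<in> borel_measurable (PiM J (\<lambda>_. borel))"
  shows "integral\<^sup>L (PiM J N) F = (\<integral>\<omega>. F (\<lambda>j\<in>J. T j (\<omega> (h j))) \<partial>PiM I M)"
    "integrable (PiM J N) F \<longleftrightarrow> integrable (PiM I M) (\<lambda>\<omega>. F (\<lambda>j\<in>J. T j (\<omega> (h j))))"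
proof -
  have setsN: "sets (PiM J N) = sets (PiM J (\<lambda>_. borel :: real measure))"
    by (intro sets_PiM_cong) (simp_all add: N)
  have F': "F \<in> borel_measurable (PiM J N)"
    using F measurable_cong_sets[OF setsN refl, of "borel :: real measure"] by simp
  have meas: "(\<lambda>\<omega>. \<lambda>j\<in>J. T j (\<omega> (h j))) \<in> PiM I M \<rightarrow>\<^sub>M PiM J N"
  proof (rule measurable_restrict)
    fix j assume j: "j \<in> J"
    have "(\<lambda>\<omega>. \<omega> (h j)) \<in> PiM I M \<rightarrow>\<^sub>M M (h j)"
      using h j by (intro measurable_component_singleton) auto
    from measurable_compose[OF this T[OF j]]
    show "(\<lambda>\<omega>. T j (\<omega> (h j))) \<in> PiM I M \<rightarrow>\<^sub>M N j" using j by (simp add: N)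
  qed
  have d: "distr (PiM I M) (PiM J N) (\<lambda>\<omega>. \<lambda>j\<in>J. T j (\<omega> (h j))) = PiM J N"
    by (rule PiM_transport[OF fin P h]) (use T N in auto)
  show "integral\<^sup>L (PiM J N) F = (\<integral>\<omega>. F (\<lambda>j\<in>J. T j (\<omega> (h j))) \<partial>PiM I M)"
    by (subst d[symmetric], rule integral_distr[OF meas F'])
  show "integrable (PiM J N) F \<longleftrightarrow> integrable (PiM I M) (\<lambda>\<omega>. F (\<lambda>j\<in>J. T j (\<omega> (h j))))"
    by (subst d[symmetric], rule integrable_distr_eq[OF meas F'])
qed

text \<open>The bridge from the discrete product in the definition of the random graph to product
  measures on the reals, where discrete and Gaussian coordinates can be mixed.\<close>

lemma Pi_pmf_transport:
  fixes T :: "'j \<Rightarrow> 'a \<Rightarrow> real"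
  assumes finJ: "finite J"
    and N: "\<And>j. N j = distr (measure_pmf (p j)) borel (T j)"
  shows "distr (measure_pmf (Pi_pmf J z p)) (PiM J N) (\<lambda>\<omega>. \<lambda>j\<in>J. T j (\<omega> j)) = PiM J N"
proof -
  have PN: "prob_space (N j)" for j
    using N by (auto intro!: prob_space.prob_space_distr measure_pmf.prob_space_axioms)
  interpret N: product_prob_space N J by (rule product_prob_spaceI) (rule PN)
  have setsN: "sets (N j) = sets borel" for j by (simp add: N)
  have spaceN: "space (N j) = UNIV" for j by (simp add: N)
  have meas: "(\<lambda>\<omega>. \<lambda>j\<in>J. T j (\<omega> j)) \<in> measure_pmf (Pi_pmf J z p) \<rightarrow>\<^sub>M PiM J N"
    by (rule measurable_restrict) (simp add: N)
  show ?thesis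
  proof (rule N.PiM_eqI[OF finJ])
    show "sets (distr (measure_pmf (Pi_pmf J z p)) (PiM J N) (\<lambda>\<omega>. \<lambda>j\<in>J. T j (\<omega> j))) = sets (PiM J N)" by simp
    fix A assume A: "\<And>j. j \<in> J \<Longrightarrow> A j \<in> sets (N j)"
    have "emeasure (distr (measure_pmf (Pi_pmf J z p)) (PiM J N) (\<lambda>\<omega>. \<lambda>j\<in>J. T j (\<omega> j))) (PiE J A)
       = emeasure (measure_pmf (Pi_pmf J z p)) ((\<lambda>\<omega>. \<lambda>j\<in>J. T j (\<omega> j)) -` PiE J A)"
      by (subst emeasure_distr[OF meas]) (auto intro!: sets_PiM_I_finite finJ A)
    also have "(\<lambda>\<omega>. \<lambda>j\<in>J. T j (\<omega> j)) -` PiE J A = Pi J (\<lambda>j. T j -` A j)"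
      by (auto simp: PiE_def Pi_def)
    also have "emeasure (measure_pmf (Pi_pmf J z p)) (Pi J (\<lambda>j. T j -` A j)) = (\<Prod>j\<in>J. emeasure (measure_pmf (p j)) (T j -` A j))"
      using finJ by (simp add: measure_pmf.emeasure_eq_measure measure_Pi_pmf_Pi prod_ennreal)
    also have "\<dots> = (\<Prod>j\<in>J. emeasure (N j) (A j))"
      by (rule prod.cong[OF refl]) (use A setsN in \<open>auto simp: N emeasure_distr\<close>)
    finally show "emeasure (distr (measure_pmf (Pi_pmf J z p)) (PiM J N) (\<lambda>\<omega>. \<lambda>j\<in>J. T j (\<omega> j))) (PiE J A) = (\<Prod>j\<in>J. emeasure (N j) (A j))" .
  qed
qed

section \<open>Centred Gaussian laws and exponential tails\<close>

text \<open>The centred Gaussian law of variance \<open>s\<close>. The degenerate case \<open>s = 0\<close> is the point mass at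
  \<open>0\<close>, which a density could not express; it is needed to switch couplings off.\<close>

definition gauss :: "real \<Rightarrow> real measure" where
  "gauss s = distr (density lborel std_normal_density) borel (\<lambda>x. sqrt s * x)"

text \<open>A common home for the Gaussian and the Bernoulli laws: finite exponential moments make all
  integrals below converge.\<close>

definition light :: "real measure \<Rightarrow> bool" where
  "light \<mu> \<longleftrightarrow> prob_space \<mu> \<and> sets \<mu> = sets borel \<and> (\<forall>c. integrable \<mu> (\<lambda>y. exp (c * y)))"

lemma lightD:
  assumes "light \<mu>"
  shows "prob_space \<mu>" "sets \<mu> = sets borel" "space \<mu> = UNIV" "integrable \<mu> (\<lambda>y. exp (c * y))"
  using assms sets_eq_imp_space_eq[of \<mu> borel] by (auto simp: light_def)

lemma light_moments:
  assumes "light \<mu>"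
  shows "integrable \<mu> (\<lambda>y. y)" "integrable \<mu> (\<lambda>y. \<bar>y\<bar>)" "integrable \<mu> (\<lambda>y. y\<^sup>2)" "integrable \<mu> (\<lambda>y. \<bar>y\<bar> ^ 3)"
proof -
  note [measurable_cong] = lightD(2)[OF assms]
  have e: "integrable \<mu> (\<lambda>y. exp (1*y) + exp ((-1) * y))"
    by (intro Bochner_Integration.integrable_add lightD(4)[OF assms])
  \<comment> \<open>Partial sums of the exponential series bound the first three absolute moments.\<close>
  have b: "1 + \<bar>y\<bar> + \<bar>y\<bar>^2/2 + \<bar>y\<bar>^3/6 \<le> exp y + exp (- y)" for y :: real
  proof -
    have "1 + x + x^2/2 + x^3/6 \<le> exp x" if "x \<ge> 0" for x :: real
    proof -
      have "(\<Sum>n<4. x^n /\<^sub>R fact n) \<le> exp x" unfolding exp_def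
        using that by (intro sum_le_suminf[OF summable_exp_generic]) auto
      then show ?thesis by (simp add: eval_nat_numeral fact_numeral field_simps)
    qed
    from this[of "\<bar>y\<bar>"] have "1 + \<bar>y\<bar> + \<bar>y\<bar>^2/2 + \<bar>y\<bar>^3/6 \<le> exp \<bar>y\<bar>" by simp
    also have "\<dots> \<le> exp y + exp (- y)" by (cases "y \<ge> 0") auto
    finally show ?thesis .
  qed
  have e6: "integrable \<mu> (\<lambda>y. 6 * (exp (1*y) + exp ((-1) * y)))"
    using e by (intro integrable_mult_right)
  have bb: "norm y \<le> norm (6 * (exp (1*y) + exp ((-1) * y)))"
    "norm \<bar>y\<bar> \<le> norm (6 * (exp (1*y) + exp ((-1) * y)))"
    "norm (y\<^sup>2) \<le> norm (6 * (exp (1*y) + exp ((-1) * y)))"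
    "norm (\<bar>y\<bar>^3) \<le> norm (6 * (exp (1*y) + exp ((-1) * y)))" for y :: real
  proof -
    have p: "0 \<le> \<bar>y\<bar>" "0 \<le> \<bar>y\<bar>^2" "0 \<le> \<bar>y\<bar>^3" by auto
    have aux: "a \<le> 6 * E \<and> b \<le> 6 * E \<and> c \<le> 6 * E"
      if "1 + a + b/2 + c/6 \<le> E" "0 \<le> a" "0 \<le> b" "0 \<le> c" for a b c E :: real using that by linarith
    have m: "norm y = \<bar>y\<bar>" "norm \<bar>y\<bar> = \<bar>y\<bar>" "norm (y\<^sup>2) = \<bar>y\<bar>^2" "norm (\<bar>y\<bar>^3) = \<bar>y\<bar>^3"
      by (auto simp: power_abs)
    have n: "norm (6 * (exp (1*y) + exp ((-1) * y))) = 6 * (exp y + exp (-y))" by (simp add: add_pos_pos less_imp_le)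
    show "norm y \<le> norm (6 * (exp (1*y) + exp ((-1) * y)))" unfolding n m using aux[OF b[of y] p] by blast
    show "norm \<bar>y\<bar> \<le> norm (6 * (exp (1*y) + exp ((-1) * y)))" unfolding n m using aux[OF b[of y] p] by blast
    show "norm (y\<^sup>2) \<le> norm (6 * (exp (1*y) + exp ((-1) * y)))" unfolding n m using aux[OF b[of y] p] by blast
    show "norm (\<bar>y\<bar>^3) \<le> norm (6 * (exp (1*y) + exp ((-1) * y)))" unfolding n m using aux[OF b[of y] p] by blast
  qed
  show "integrable \<mu> (\<lambda>y. y)" "integrable \<mu> (\<lambda>y. \<bar>y\<bar>)" "integrable \<mu> (\<lambda>y. y\<^sup>2)" "integrable \<mu> (\<lambda>y. \<bar>y\<bar> ^ 3)"
    by (rule Bochner_Integration.integrable_bound[OF e6]; (simp; fail)?; use bb in auto)+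
qed

lemma prob_space_std_normal: "prob_space (density lborel std_normal_density)"
  using prob_space_normal_density[of 1 0] by simp

text \<open>Completing the square: tilting the standard normal density by \<open>exp (c x)\<close> gives a
  multiple of the normal density with mean \<open>c\<close>.\<close>

lemma std_normal_exp:
  "has_bochner_integral lborel (\<lambda>x. std_normal_density x * exp (c * x)) (exp (c\<^sup>2 / 2))"
proof -
  have *: "std_normal_density x * exp (c * x) = exp (c\<^sup>2/2) * normal_density c 1 x" for x
    by (simp add: normal_density_def exp_add[symmetric] field_simps power2_eq_square)
  have "has_bochner_integral lborel (\<lambda>x. exp (c\<^sup>2/2) * normal_density c 1 x) (exp (c\<^sup>2/2) * 1)"
    by (intro has_bochner_integral_mult_right) (simp add: has_bochner_integral_iff)
  then show ?thesis by (simp add: *)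
qed

lemma gauss_integral:
  fixes f :: "real \<Rightarrow> real"
  assumes [measurable]: "f \<in> borel_measurable borel"
  shows "integral\<^sup>L (gauss s) f = (\<integral>x. std_normal_density x * f (sqrt s * x) \<partial>lborel)"
    "integrable (gauss s) f \<longleftrightarrow> integrable lborel (\<lambda>x. std_normal_density x * f (sqrt s * x))"
  unfolding gauss_def
  by (subst integral_distr, simp, simp, subst integral_density, auto simp: integrable_distr_eq integrable_density)

lemma gauss_mgf:
  assumes "s \<ge> 0"
  shows "integrable (gauss s) (\<lambda>y. exp (c * y))" "(\<integral>y. exp (c * y) \<partial>gauss s) = exp (c\<^sup>2 * s / 2)"
proof -
  have "has_bochner_integral lborel (\<lambda>x. std_normal_density x * exp (c * (sqrt s * x))) (exp (c\<^sup>2 * s / 2))"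
    using std_normal_exp[of "c * sqrt s"] assms by (simp add: power_mult_distrib mult.assoc)
  then show "integrable (gauss s) (\<lambda>y. exp (c * y))" "(\<integral>y. exp (c * y) \<partial>gauss s) = exp (c\<^sup>2 * s / 2)"
    by (simp_all add: gauss_integral has_bochner_integral_iff)
qed

lemma prob_space_gauss: "prob_space (gauss s)"
  unfolding gauss_def by (rule prob_space.prob_space_distr[OF prob_space_std_normal]) simp

lemma sets_gauss[simp, measurable_cong]: "sets (gauss s) = sets borel" by (simp add: gauss_def)
lemma space_gauss[simp]: "space (gauss s) = UNIV" by (simp add: gauss_def)

lemma light_gauss: "s \<ge> 0 \<Longrightarrow> light (gauss s)"
  by (simp add: light_def prob_space_gauss gauss_mgf)

lemma gauss_moments:
  assumes "s \<ge> 0"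
  shows "(\<integral>y. y \<partial>gauss s) = 0" "(\<integral>y. y\<^sup>2 \<partial>gauss s) = s" "(\<integral>y. \<bar>y\<bar> \<partial>gauss s) \<le> sqrt s"
    "(\<integral>y. \<bar>y\<bar>^3 \<partial>gauss s) \<le> 2 * s * sqrt s"
proof -
  have sp: "sqrt (2 / pi) \<le> 1" using pi_ge_two by (auto simp: field_simps)
  have "(\<integral>y. y \<partial>gauss s) = sqrt s * (\<integral>x. std_normal_density x * x ^ (2*0+1) \<partial>lborel)"
    by (simp add: gauss_integral mult.left_commute)
  then show "(\<integral>y. y \<partial>gauss s) = 0" by (simp only: integral_std_normal_moment_odd)
  have "(\<integral>y. y\<^sup>2 \<partial>gauss s) = s * (\<integral>x. std_normal_density x * x ^ (2*1) \<partial>lborel)"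
    using assms by (simp add: gauss_integral power_mult_distrib mult.left_commute del: mult_1_right)
  then show "(\<integral>y. y\<^sup>2 \<partial>gauss s) = s"  by (simp only: integral_std_normal_moment_even) (simp add: fact_numeral)
  have "(\<integral>y. \<bar>y\<bar> \<partial>gauss s) = sqrt s * (\<integral>x. std_normal_density x * \<bar>x\<bar> ^ (2*0+1) \<partial>lborel)"
    using assms by (simp add: gauss_integral mult.left_commute abs_mult)
  also have "\<dots> = sqrt s * sqrt (2/pi)" by (simp only: integral_std_normal_moment_abs_odd) simp
  also have "\<dots> \<le> sqrt s * 1" using sp assms by (intro mult_left_mono) auto
  finally show "(\<integral>y. \<bar>y\<bar> \<partial>gauss s) \<le> sqrt s" by simp
  have s3: "sqrt s ^ 3 = s * sqrt s" using assms by (simp add: power3_eq_cube)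
  have "(\<integral>y. \<bar>y\<bar>^3 \<partial>gauss s) = (\<integral>x. (s * sqrt s) * (std_normal_density x * \<bar>x\<bar> ^ (2*1+1)) \<partial>lborel)"
    using assms by (simp add: gauss_integral ac_simps abs_mult power_mult_distrib s3 flip: numeral_3_eq_3)
  also have "\<dots> = s * sqrt s * (\<integral>x. std_normal_density x * \<bar>x\<bar> ^ (2*1+1) \<partial>lborel)"
    by (rule integral_mult_right_zero)
  also have "\<dots> = s * sqrt s * (2 * sqrt (2/pi))" by (simp only: integral_std_normal_moment_abs_odd) simp
  also have "\<dots> \<le> s * sqrt s * (2 * 1)" using sp assms by (intro mult_left_mono) auto
  finally show "(\<integral>y. \<bar>y\<bar>^3 \<partial>gauss s) \<le> 2 * s * sqrt s" by simp
qed

lemma gauss_density: "s > 0 \<Longrightarrow> gauss s = density lborel (normal_density 0 (sqrt s))"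
proof -
  assume s: "s > 0"
  interpret prob_space "density lborel std_normal_density" by (rule prob_space_std_normal)
  have "distributed (density lborel std_normal_density) lborel (\<lambda>x. x) (normal_density 0 1)"
    by (auto simp: distributed_def distr_id2)
  from normal_density_affine[OF this, of "sqrt s" 0] s
  have "distributed (density lborel std_normal_density) lborel (\<lambda>x. sqrt s * x) (normal_density 0 (sqrt s))" by simp
  then show ?thesis by (auto simp: distributed_def gauss_def cong: distr_cong)
qed

lemma gauss_0: "gauss 0 = return borel 0"
proof -
  interpret prob_space "density lborel std_normal_density" by (rule prob_space_std_normal)
  show ?thesis unfolding gauss_def real_sqrt_zero mult_zero_left by (rule distr_const) simp
qed

text \<open>The convolution formula for Gaussian densities, extended to degenerate variances.\<close>

lemma gauss_add:
  assumes "s \<ge> 0" "t \<ge> 0"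
  shows "gauss (s + t) = distr (gauss s \<Otimes>\<^sub>M gauss t) borel (\<lambda>(x, y). x + y)"
proof -
  have P: "prob_space (gauss u)" for u by (rule prob_space_gauss)
  show ?thesis
  proof (cases "s = 0 \<or> t = 0")
    case True
    have *: "distr (gauss 0 \<Otimes>\<^sub>M gauss u) borel (\<lambda>(x, y). x + y) = gauss u" for u
    proof (rule measure_eqI)
      fix A assume "A \<in> sets (distr (gauss 0 \<Otimes>\<^sub>M gauss u) borel (\<lambda>(x, y). x + y))"
      then have A[measurable]: "A \<in> sets borel" by simp
      interpret G: sigma_finite_measure "gauss u" using P prob_space_imp_sigma_finite by blast
      show "emeasure (distr (gauss 0 \<Otimes>\<^sub>M gauss u) borel (\<lambda>(x, y). x + y)) A = emeasure (gauss u) A"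
      proof -
        have S: "(\<lambda>(x, y). x + y) -` A \<inter> space (gauss 0 \<Otimes>\<^sub>M gauss u) \<in> sets (gauss 0 \<Otimes>\<^sub>M gauss u)"
          by (rule measurable_sets[OF _ A]) measurable
        have m: "(\<lambda>x. emeasure (gauss u) (Pair x -` ((\<lambda>(x, y). x + y) -` A \<inter> space (gauss 0 \<Otimes>\<^sub>M gauss u)))) \<in> borel_measurable borel"
          using G.measurable_emeasure_Pair[OF S] by (simp add: measurable_cong_sets[OF sets_gauss refl])
        have "emeasure (distr (gauss 0 \<Otimes>\<^sub>M gauss u) borel (\<lambda>(x, y). x + y)) A
          = (\<integral>\<^sup>+ x. emeasure (gauss u) (Pair x -` ((\<lambda>(x, y). x + y) -` A \<inter> space (gauss 0 \<Otimes>\<^sub>M gauss u))) \<partial>gauss 0)"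
          by (subst emeasure_distr) (simp_all add: G.emeasure_pair_measure_alt[OF S])
        also have "\<dots> = emeasure (gauss u) (Pair 0 -` ((\<lambda>(x, y). x + y) -` A \<inter> space (gauss 0 \<Otimes>\<^sub>M gauss u)))"
          unfolding gauss_0 using m[unfolded gauss_0] by (subst nn_integral_return) auto
        also have "\<dots> = emeasure (gauss u) A"
          by (rule arg_cong[where f = "emeasure (gauss u)"]) (auto simp: space_pair_measure)
        finally show ?thesis .
      qed
    qed simp
    have comm: "distr (gauss s \<Otimes>\<^sub>M gauss t) borel (\<lambda>(x, y). x + y) = distr (gauss t \<Otimes>\<^sub>M gauss s) borel (\<lambda>(x, y). x + y)"
    proof -
      interpret pair_prob_space "gauss s" "gauss t" by (simp add: pair_prob_space_def pair_sigma_finite_def P prob_space_imp_sigma_finite)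
      show ?thesis by (subst distr_pair_swap) (simp add: distr_distr comp_def case_prod_unfold add.commute)
    qed
    show ?thesis using True * comm by auto
  next
    case False
    then have st: "s > 0" "t > 0" using assms by auto
    have "distr (gauss s \<Otimes>\<^sub>M gauss t) borel (\<lambda>(x, y). x + y) = convolution (gauss s) (gauss t)"
      by (simp add: convolution_def)
    also have "\<dots> = density lborel (\<lambda>x. \<integral>\<^sup>+y. ennreal (normal_density 0 (sqrt s) (x - y)) * ennreal (normal_density 0 (sqrt t) y) \<partial>lborel)"
      using P[of s] P[of t] st by (simp only: gauss_density, subst convolution_density) (auto simp: prob_space.finite_measure)
    also have "\<dots> = density lborel (normal_density 0 (sqrt (s + t)))"
      using conv_normal_density_zero_mean[of "sqrt s" "sqrt t"] st
      by (simp add: ennreal_mult'[symmetric] fun_eq_iff)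
    finally show ?thesis using st by (simp add: gauss_density)
  qed
qed

section \<open>Exponential concentration for coordinatewise Lipschitz functions\<close>

lemma product_prob_space_light: "(\<And>i. light (M i)) \<Longrightarrow> product_prob_space M"
  by (rule product_prob_spaceI) (rule lightD(1))

lemma sets_PiM_light: "(\<And>i. light (M i)) \<Longrightarrow> sets (PiM I M) = sets (PiM I (\<lambda>_. borel))"
  by (intro sets_PiM_cong refl) (rule lightD(2))

lemma measurable_PiM_light:
  fixes F :: "('i \<Rightarrow> real) \<Rightarrow> real"
  assumes "\<And>i. light (M i)" "F \<in> borel_measurable (PiM I (\<lambda>_. borel))"
  shows "F \<in> borel_measurable (PiM I M)"
  using assms(2) measurable_cong_sets[OF sets_PiM_light[of M I, OF assms(1)] refl, of "borel :: real measure"] by simp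

text \<open>The bound holds for all functions on the index type, not only for the extensional ones in the
  space of the product measure, so that coordinates can be updated freely.\<close>

definition coord_lipschitz :: "'i set \<Rightarrow> ('i \<Rightarrow> real) \<Rightarrow> (('i \<Rightarrow> real) \<Rightarrow> real) \<Rightarrow> bool" where
  "coord_lipschitz I L F \<longleftrightarrow> F \<in> borel_measurable (PiM I (\<lambda>_. borel)) \<and>
     (\<forall>x. \<forall>i\<in>I. \<forall>y. \<bar>F (x(i := y)) - F x\<bar> \<le> L i * \<bar>y - x i\<bar>)"

lemma coord_lipschitzD:
  assumes "coord_lipschitz I L F"
  shows "F \<in> borel_measurable (PiM I (\<lambda>_. borel))" "i \<in> I \<Longrightarrow> \<bar>F (x(i := y)) - F x\<bar> \<le> L i * \<bar>y - x i\<bar>"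
  using assms by (auto simp: coord_lipschitz_def)

lemma coord_lipschitz_nonneg:
  assumes "coord_lipschitz I L F" "i \<in> I"
  shows "L i \<ge> 0"
proof -
  have "0 \<le> \<bar>F ((\<lambda>_. 0)(i := 1)) - F (\<lambda>_. 0)\<bar>" by simp
  also have "\<dots> \<le> L i * \<bar>1 - 0\<bar>" using coord_lipschitzD(2)[OF assms, of "\<lambda>_. 0" 1] by simp
  finally show ?thesis by simp
qed

lemma coord_lipschitz_diff:
  assumes F: "coord_lipschitz I L F" and J: "finite J" "J \<subseteq> I"
  shows "\<bar>F (\<lambda>i. if i \<in> J then y i else x i) - F x\<bar> \<le> (\<Sum>i\<in>J. L i * \<bar>y i - x i\<bar>)"
  using J
proof (induction J rule: finite_induct)
  case (insert j J)
  define z where "z = (\<lambda>i. if i \<in> J then y i else x i)"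
  have "(\<lambda>i. if i \<in> insert j J then y i else x i) = z(j := y j)" by (auto simp: z_def)
  moreover have "\<bar>F (z(j := y j)) - F z\<bar> \<le> L j * \<bar>y j - z j\<bar>" using insert F by (intro coord_lipschitzD(2)) auto
  moreover have "z j = x j" using insert by (simp add: z_def)
  ultimately show ?case using insert by (simp add: z_def)
qed simp

lemma integrable_component:
  fixes f :: "real \<Rightarrow> real"
  assumes I: "finite I" "i \<in> I" and M: "\<And>i. light (M i)" and f: "integrable (M i) f"
  shows "integrable (PiM I M) (\<lambda>x. f (x i))" "(\<integral>x. f (x i) \<partial>PiM I M) = integral\<^sup>L (M i) f"
proof -
  interpret product_prob_space M I by (rule product_prob_space_light) (rule M)
  have d: "distr (PiM I M) (M i) (\<lambda>x. x i) = M i" by (rule PiM_component) fact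
  have m: "(\<lambda>x. x i) \<in> PiM I M \<rightarrow>\<^sub>M M i" using I by simp
  show "integrable (PiM I M) (\<lambda>x. f (x i))"
    using f d integrable_distr_eq[OF m, of f] by auto
  show "(\<integral>x. f (x i) \<partial>PiM I M) = integral\<^sup>L (M i) f"
    using f d integral_distr[OF m, of f] by auto
qed

lemma coord_lipschitz_integrable:
  assumes I: "finite I" and M: "\<And>i. light (M i)" and F: "coord_lipschitz I L F"
  shows "integrable (PiM I M) F"
proof -
  interpret product_prob_space M I by (rule product_prob_space_light) (rule M)
  interpret P: prob_space "PiM I M" by (rule prob_space_PiM) (rule lightD(1)[OF M])
  define x0 :: "'a \<Rightarrow> real" where "x0 = (\<lambda>i. if i \<in> I then 0 else undefined)"
  have "integrable (PiM I M) (\<lambda>x. \<bar>F x0\<bar> + (\<Sum>i\<in>I. L i * \<bar>x i\<bar>))"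
    by (intro Bochner_Integration.integrable_add Bochner_Integration.integrable_sum integrable_mult_right
        integrable_component(1)[OF I _ M] light_moments(2)[OF M] P.integrable_const)
  then show ?thesis
  proof (rule Bochner_Integration.integrable_bound)
    show "F \<in> borel_measurable (PiM I M)"
      by (rule measurable_PiM_light[OF M coord_lipschitzD(1)[OF F]])
    show "AE x in PiM I M. norm (F x) \<le> norm (\<bar>F x0\<bar> + (\<Sum>i\<in>I. L i * \<bar>x i\<bar>))"
    proof (rule AE_I2)
      fix x assume "x \<in> space (PiM I M)"
      then have "(\<lambda>i. if i \<in> I then 0 else x i) = x0" by (auto simp: x0_def space_PiM PiE_def extensional_def)
      with coord_lipschitz_diff[OF F I subset_refl, of "\<lambda>_. 0" x]
      have "\<bar>F x0 - F x\<bar> \<le> (\<Sum>i\<in>I. L i * \<bar>x i\<bar>)" by simp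
      then show "norm (F x) \<le> norm (\<bar>F x0\<bar> + (\<Sum>i\<in>I. L i * \<bar>x i\<bar>))" by simp
    qed
  qed
qed

lemma coord_lipschitz_update:
  assumes F: "coord_lipschitz (insert i I) L F" and i: "i \<notin> I"
  shows "coord_lipschitz I L (\<lambda>x. F (x(i := y)))"
  unfolding coord_lipschitz_def
proof (intro conjI allI ballI)
  show "(\<lambda>x. F (x(i := y))) \<in> borel_measurable (PiM I (\<lambda>_. borel))"
    using measurable_compose[OF _ coord_lipschitzD(1)[OF F], of "\<lambda>x. x(i := y)" "PiM I (\<lambda>_. borel)"]
    by (simp add: measurable_fun_upd[where J = I])
  fix x j z assume j: "j \<in> I"
  then have "(x(j := z))(i := y) = (x(i := y))(j := z)" "j \<noteq> i" using i by (auto simp: fun_upd_twist)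
  then show "\<bar>F ((x(j := z))(i := y)) - F (x(i := y))\<bar> \<le> L j * \<bar>z - x j\<bar>"
    using coord_lipschitzD(2)[OF F, of j "x(i := y)" z] j by simp
qed

lemma coord_lipschitz_section:
  assumes F: "coord_lipschitz (insert i I) L F" and M: "light \<mu>" and i: "i \<notin> I"
  shows "(\<lambda>y. F (x(i := y))) \<in> borel_measurable borel" "integrable \<mu> (\<lambda>y. F (x(i := y)))"
proof -
  have lip: "\<bar>F (x(i := y)) - F (x(i := z))\<bar> \<le> L i * \<bar>y - z\<bar>" for y z
    using coord_lipschitzD(2)[OF F, of i "x(i := z)" y] by simp
  have L: "L i \<ge> 0" using coord_lipschitz_nonneg[OF F] by simp
  have "(L i)-lipschitz_on UNIV (\<lambda>y. F (x(i := y)))"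
    using lip L by (intro lipschitz_onI) (auto simp: dist_real_def)
  then have "continuous_on UNIV (\<lambda>y. F (x(i := y)))" by (rule lipschitz_on_continuous_on)
  then show m: "(\<lambda>y. F (x(i := y))) \<in> borel_measurable borel" by (rule borel_measurable_continuous_onI)
  interpret prob_space \<mu> by (rule lightD(1)[OF M])
  have "integrable \<mu> (\<lambda>y. \<bar>F (x(i := 0))\<bar> + L i * \<bar>y\<bar>)"
    by (intro Bochner_Integration.integrable_add integrable_mult_right light_moments(2)[OF M] integrable_const)
  then show "integrable \<mu> (\<lambda>y. F (x(i := y)))"
  proof (rule Bochner_Integration.integrable_bound)
    show "(\<lambda>y. F (x(i := y))) \<in> borel_measurable \<mu>"
      using m by (simp add: measurable_cong_sets[OF lightD(2)[OF M] refl])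
    show "AE y in \<mu>. norm (F (x(i := y))) \<le> norm (\<bar>F (x(i := 0))\<bar> + L i * \<bar>y\<bar>)"
    proof (rule AE_I2)
      fix y
      have "\<bar>F (x(i := y)) - F (x(i := 0))\<bar> \<le> L i * \<bar>y\<bar>" using lip[of y 0] by simp
      then show "norm (F (x(i := y))) \<le> norm (\<bar>F (x(i := 0))\<bar> + L i * \<bar>y\<bar>)" by simp
    qed
  qed
qed

lemma coord_lipschitz_average:
  assumes F: "coord_lipschitz (insert i I) L F" and M: "light \<mu>" and i: "i \<notin> I"
  shows "coord_lipschitz I L (\<lambda>x. \<integral>y. F (x(i := y)) \<partial>\<mu>)"
  unfolding coord_lipschitz_def
proof (intro conjI allI ballI)
  note [measurable_cong] = lightD(2)[OF M]
  note [measurable] = coord_lipschitzD(1)[OF F]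
  interpret prob_space \<mu> by (rule lightD(1)[OF M])
  have [measurable]: "(\<lambda>(x, y). x(i := y)) \<in> PiM I (\<lambda>_. borel) \<Otimes>\<^sub>M borel \<rightarrow>\<^sub>M PiM (insert i I) (\<lambda>_. borel)"
    using measurable_add_dim[of i I "\<lambda>_. borel"] by simp
  have "(\<lambda>x. \<integral>y. F (x(i := y)) \<partial>\<mu>) = (\<lambda>x. \<integral>y. F ((\<lambda>(x, y). x(i := y)) (x, y)) \<partial>\<mu>)" by simp
  also have "\<dots> \<in> borel_measurable (PiM I (\<lambda>_. borel))" by measurable
  finally show "(\<lambda>x. \<integral>y. F (x(i := y)) \<partial>\<mu>) \<in> borel_measurable (PiM I (\<lambda>_. borel))" .
  fix x j z assume j: "j \<in> I"
  have c: "\<bar>F ((x(j := z))(i := y)) - F (x(i := y))\<bar> \<le> L j * \<bar>z - x j\<bar>" for y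
    using coord_lipschitzD(2)[OF coord_lipschitz_update[OF F i] j] .
  have i1: "integrable \<mu> (\<lambda>y. F ((x(j := z))(i := y)))" and i2: "integrable \<mu> (\<lambda>y. F (x(i := y)))"
    by (rule coord_lipschitz_section[OF F M i])+
  have "\<bar>(\<integral>y. F ((x(j := z))(i := y)) \<partial>\<mu>) - (\<integral>y. F (x(i := y)) \<partial>\<mu>)\<bar> = \<bar>\<integral>y. F ((x(j := z))(i := y)) - F (x(i := y)) \<partial>\<mu>\<bar>"
    using i1 i2 by simp
  also have "\<dots> \<le> (\<integral>y. \<bar>F ((x(j := z))(i := y)) - F (x(i := y))\<bar> \<partial>\<mu>)" by (rule integral_abs_bound)
  also have "\<dots> \<le> (\<integral>y. L j * \<bar>z - x j\<bar> \<partial>\<mu>)" using i1 i2 c by (intro integral_mono) auto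
  finally show "\<bar>(\<integral>y. F ((x(j := z))(i := y)) \<partial>\<mu>) - (\<integral>y. F (x(i := y)) \<partial>\<mu>)\<bar> \<le> L j * \<bar>z - x j\<bar>"
    by (simp add: prob_space)
qed

lemma coord_lipschitz_fubini:
  assumes I: "finite I" "i \<notin> I" and M: "\<And>i. light (M i)" and F: "coord_lipschitz (insert i I) L F"
  shows "integral\<^sup>L (PiM (insert i I) M) F = (\<integral>x. (\<integral>y. F (x(i := y)) \<partial>M i) \<partial>PiM I M)"
proof -
  interpret product_prob_space M I by (rule product_prob_space_light) (rule M)
  show ?thesis using I coord_lipschitz_integrable[OF _ M F] by (intro product_integral_insert) auto
qed

text \<open>Let \<open>z\<close> be an independent copy of \<open>y\<close>. By Jensen's inequality the centred exponential
  moment of \<open>f y\<close> is at most that of \<open>f y - f z\<close>. This difference is symmetric, so its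
  exponential moment is the mean of a hyperbolic cosine, which is monotone in the absolute value of
  its argument; there the Lipschitz bound may be inserted.\<close>

lemma exp_moment_symmetrization:
  fixes f :: "real \<Rightarrow> real"
  assumes M: "light \<mu>" and lip: "\<And>y z. \<bar>f y - f z\<bar> \<le> L * \<bar>y - z\<bar>"
    and [measurable]: "f \<in> borel_measurable borel" and f: "integrable \<mu> f"
    and K: "(\<integral>y. exp (t * L * y) \<partial>\<mu>) * (\<integral>y. exp (- (t * L) * y) \<partial>\<mu>) \<le> K"
  shows "(\<integral>\<^sup>+ y. ennreal (exp (t * (f y - integral\<^sup>L \<mu> f))) \<partial>\<mu>) \<le> ennreal K"
proof -
  note [measurable_cong] = lightD(2)[OF M]
  interpret prob_space \<mu> by (rule lightD(1)[OF M])
  interpret S: pair_sigma_finite \<mu> \<mu> by (simp add: pair_sigma_finite_def prob_space_imp_sigma_finite prob_space_axioms)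
  define m where "m = integral\<^sup>L \<mu> f"
  define E where "E c = (\<integral>y. exp (c * y) \<partial>\<mu>)" for c
  have E0: "0 \<le> E c" for c by (simp add: E_def)
  have E: "(\<integral>\<^sup>+ y. ennreal (exp (c * y)) \<partial>\<mu>) = ennreal (E c)" for c
    unfolding E_def by (rule nn_integral_eq_integral[OF lightD(4)[OF M]]) simp
  \<comment> \<open>Jensen, from the tangent line of the exponential at \<open>0\<close>\<close>
  have J: "1 \<le> (\<integral>\<^sup>+ z. ennreal (exp (t * (m - f z))) \<partial>\<mu>)"
  proof -
    have int: "integrable \<mu> (\<lambda>z. 1 + t * (m - f z))" using f by auto
    have "ennreal (\<integral>z. 1 + t * (m - f z) \<partial>\<mu>) \<le> ennreal (\<integral>z. max 0 (1 + t * (m - f z)) \<partial>\<mu>)"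
      using int by (intro ennreal_leI integral_mono) auto
    also have "\<dots> = (\<integral>\<^sup>+ z. ennreal (max 0 (1 + t * (m - f z))) \<partial>\<mu>)"
      using int by (intro nn_integral_eq_integral[symmetric]) auto
    also have "\<dots> \<le> (\<integral>\<^sup>+ z. ennreal (exp (t * (m - f z))) \<partial>\<mu>)"
      by (intro nn_integral_mono ennreal_leI) (auto simp: exp_ge_add_one_self)
    finally show ?thesis using f by (simp add: m_def prob_space)
  qed
  have ptw: "exp (t * (f y - f z)) + exp (t * (f z - f y)) \<le> exp (t * L * y) * exp (- (t * L) * z) + exp (- (t * L) * y) * exp (t * L * z)" for y z
  proof -
    have "cosh (t * (f y - f z)) \<le> cosh (t * L * (y - z))"
    proof -
      have L0: "L \<ge> 0" using lip[of 1 0] by simp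
      have "\<bar>t * (f y - f z)\<bar> \<le> \<bar>t * L * (y - z)\<bar>"
        using mult_left_mono[OF lip[of y z], of "\<bar>t\<bar>"] L0 by (simp add: abs_mult mult.assoc)
      then have "cosh \<bar>t * (f y - f z)\<bar> \<le> cosh \<bar>t * L * (y - z)\<bar>"
        by (subst cosh_real_nonneg_le_iff) auto
      then show ?thesis by simp
    qed
    then show ?thesis by (simp add: cosh_def exp_add[symmetric] algebra_simps)
  qed
  have "(\<integral>\<^sup>+ y. ennreal (exp (t * (f y - m))) \<partial>\<mu>) = (\<integral>\<^sup>+ y. ennreal (exp (t * (f y - m))) * 1 \<partial>\<mu>)" by simp
  also have "\<dots> \<le> (\<integral>\<^sup>+ y. ennreal (exp (t * (f y - m))) * (\<integral>\<^sup>+ z. ennreal (exp (t * (m - f z))) \<partial>\<mu>) \<partial>\<mu>)"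
    by (intro nn_integral_mono mult_left_mono J) auto
  also have "\<dots> = (\<integral>\<^sup>+ y. (\<integral>\<^sup>+ z. ennreal (exp (t * (f y - f z))) \<partial>\<mu>) \<partial>\<mu>)"
    by (subst nn_integral_cmult[symmetric]) (auto simp: ennreal_mult[symmetric] exp_add[symmetric] algebra_simps)
  finally have A: "(\<integral>\<^sup>+ y. ennreal (exp (t * (f y - m))) \<partial>\<mu>) \<le> (\<integral>\<^sup>+ y. (\<integral>\<^sup>+ z. ennreal (exp (t * (f y - f z))) \<partial>\<mu>) \<partial>\<mu>)" (is "?Q \<le> ?R") .
  have R': "?R = (\<integral>\<^sup>+ y. (\<integral>\<^sup>+ z. ennreal (exp (t * (f z - f y))) \<partial>\<mu>) \<partial>\<mu>)"
    by (rule S.Fubini') simp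
  have "2 * ?R = ?R + (\<integral>\<^sup>+ y. (\<integral>\<^sup>+ z. ennreal (exp (t * (f z - f y))) \<partial>\<mu>) \<partial>\<mu>)"
    using R' by (simp add: mult_2)
  also have "\<dots> = (\<integral>\<^sup>+ y. (\<integral>\<^sup>+ z. ennreal (exp (t * (f y - f z)) + exp (t * (f z - f y))) \<partial>\<mu>) \<partial>\<mu>)"
    by (simp add: nn_integral_add[symmetric])
  also have "\<dots> \<le> (\<integral>\<^sup>+ y. (\<integral>\<^sup>+ z. ennreal (exp (t * L * y) * exp (- (t * L) * z) + exp (- (t * L) * y) * exp (t * L * z)) \<partial>\<mu>) \<partial>\<mu>)"
    by (intro nn_integral_mono ennreal_leI ptw)
  also have "\<dots> = 2 * ennreal (E (t * L) * E (- (t * L)))"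
    using E[of "t * L"] E[of "- (t * L)"]
    by (simp add: ennreal_mult nn_integral_add nn_integral_cmult nn_integral_multc E0 mult_2 ac_simps)
  also have "\<dots> \<le> 2 * ennreal K" using K by (intro mult_left_mono ennreal_leI) (auto simp: E_def)
  finally have "?R \<le> ennreal K" by (simp add: ennreal_mult_le_mult_iff)
  with A show ?thesis by (simp add: m_def)
qed

lemma exp_shift: "ennreal (exp (t * (a - m))) = ennreal (exp (t * (b - m))) * ennreal (exp (t * (a - b)))"
  by (subst ennreal_mult[symmetric]) (simp_all add: exp_add[symmetric] algebra_simps)

text \<open>Tensorization: integrate out one coordinate at a time. The average of \<open>F\<close> over
  one coordinate keeps the Lipschitz constants in the others, and the fluctuation around this
  average is a function of one variable.\<close>

theorem exp_moment_product:
  assumes I: "finite I" and M: "\<And>i. light (M i)"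
    and F: "coord_lipschitz I L F"
    and K: "\<And>i. i \<in> I \<Longrightarrow> (\<integral>y. exp (t * L i * y) \<partial>M i) * (\<integral>y. exp (- (t * L i) * y) \<partial>M i) \<le> exp (K i)"
  shows "(\<integral>\<^sup>+ x. ennreal (exp (t * (F x - integral\<^sup>L (PiM I M) F))) \<partial>PiM I M) \<le> ennreal (exp (\<Sum>i\<in>I. K i))"
  using I F K
proof (induction I arbitrary: F rule: finite_induct)
  case empty
  then show ?case by (simp add: PiM_empty nn_integral_count_space_finite lebesgue_integral_count_space_finite)
next
  case (insert i I)
  note F = insert.prems(1)
  interpret product_prob_space M I by (rule product_prob_space_light) (rule M)
  define G where "G x = (\<integral>y. F (x(i := y)) \<partial>M i)" for x
  have G: "coord_lipschitz I L G"
    unfolding G_def using coord_lipschitz_average[OF F M insert.hyps(2)] .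
  define m where "m = integral\<^sup>L (PiM I M) G"
  have m: "integral\<^sup>L (PiM (insert i I) M) F = m"
    unfolding m_def G_def using coord_lipschitz_fubini[OF insert.hyps M F] .
  have meas: "F \<in> borel_measurable (PiM (insert i I) M)" "G \<in> borel_measurable (PiM I M)"
    by (rule measurable_PiM_light[OF M coord_lipschitzD(1)[OF F]], rule measurable_PiM_light[OF M coord_lipschitzD(1)[OF G]])
  note [measurable] = meas
  have "(\<integral>\<^sup>+ x. ennreal (exp (t * (F x - m))) \<partial>PiM (insert i I) M) =
    (\<integral>\<^sup>+ x. (\<integral>\<^sup>+ y. ennreal (exp (t * (F (x(i := y)) - m))) \<partial>M i) \<partial>PiM I M)"
    using insert.hyps by (subst product_nn_integral_insert) auto
  also have "\<dots> \<le> (\<integral>\<^sup>+ x. ennreal (exp (t * (G x - m))) * ennreal (exp (K i)) \<partial>PiM I M)"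
  proof (rule nn_integral_mono)
    fix x
    have meas_i: "(\<lambda>y. F (x(i := y))) \<in> borel_measurable borel"
      and int_i: "integrable (M i) (\<lambda>y. F (x(i := y)))"
      by (rule coord_lipschitz_section[OF F M insert.hyps(2)])+
    have lip: "\<bar>F (x(i := y)) - F (x(i := z))\<bar> \<le> L i * \<bar>y - z\<bar>" for y z
      using coord_lipschitzD(2)[OF F, of i "x(i := z)" y] by (simp only: fun_upd_upd fun_upd_same insertI1)
    have "(\<integral>\<^sup>+ y. ennreal (exp (t * (F (x(i := y)) - m))) \<partial>M i)
       = (\<integral>\<^sup>+ y. ennreal (exp (t * (G x - m))) * ennreal (exp (t * (F (x(i := y)) - G x))) \<partial>M i)"
      by (subst exp_shift[where b = "G x"]) (rule refl)
    also have "\<dots> = ennreal (exp (t * (G x - m))) * (\<integral>\<^sup>+ y. ennreal (exp (t * (F (x(i := y)) - G x))) \<partial>M i)"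
    proof (rule nn_integral_cmult)
      note [measurable_cong] = lightD(2)[OF M[of i]] and [measurable] = meas_i
      show "(\<lambda>y. ennreal (exp (t * (F (x(i := y)) - G x)))) \<in> borel_measurable (M i)" by measurable
    qed
    also have "(\<integral>\<^sup>+ y. ennreal (exp (t * (F (x(i := y)) - G x))) \<partial>M i) \<le> ennreal (exp (K i))"
      unfolding G_def by (rule exp_moment_symmetrization[OF M lip meas_i int_i]) (use insert.prems(2) in auto)
    finally show "(\<integral>\<^sup>+ y. ennreal (exp (t * (F (x(i := y)) - m))) \<partial>M i) \<le> ennreal (exp (t * (G x - m))) * ennreal (exp (K i))"
      by (simp add: mult_left_mono)
  qed
  also have "\<dots> = (\<integral>\<^sup>+ x. ennreal (exp (t * (G x - m))) \<partial>PiM I M) * ennreal (exp (K i))"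
    by (rule nn_integral_multc) simp
  also have "\<dots> \<le> ennreal (exp (\<Sum>i\<in>I. K i)) * ennreal (exp (K i))"
    unfolding m_def by (intro mult_right_mono insert.IH G insert.prems(2)) auto
  also have "\<dots> = ennreal (exp (\<Sum>i\<in>insert i I. K i))"
    using insert.hyps by (simp add: ennreal_mult[symmetric] exp_add[symmetric] add.commute)
  finally show ?case by (simp only: m)
qed

section \<open>Logarithms of partition functions\<close>

text \<open>Mean and covariance under the probability weights proportional to \<open>w\<close>.\<close>

definition wavg :: "'c set \<Rightarrow> ('c \<Rightarrow> real) \<Rightarrow> ('c \<Rightarrow> real) \<Rightarrow> real" where
  "wavg T w f = (\<Sum>c\<in>T. w c * f c) / (\<Sum>c\<in>T. w c)"

definition wcov :: "'c set \<Rightarrow> ('c \<Rightarrow> real) \<Rightarrow> ('c \<Rightarrow> real) \<Rightarrow> ('c \<Rightarrow> real) \<Rightarrow> real" where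
  "wcov T w f g = wavg T w (\<lambda>c. f c * g c) - wavg T w f * wavg T w g"

lemma wavg_bound:
  assumes T: "finite T" "T \<noteq> {}" and w: "\<And>c. w c > 0" and f: "\<And>c. c \<in> T \<Longrightarrow> \<bar>f c\<bar> \<le> B"
  shows "\<bar>wavg T w f\<bar> \<le> B"
proof -
  have p: "(\<Sum>c\<in>T. w c) > 0" using T w by (intro sum_pos) auto
  have "\<bar>\<Sum>c\<in>T. w c * f c\<bar> \<le> (\<Sum>c\<in>T. w c * B)"
    using f w by (intro order_trans[OF sum_abs] sum_mono) (auto simp: abs_mult less_imp_le intro!: mult_left_mono)
  also have "\<dots> = B * (\<Sum>c\<in>T. w c)" by (simp add: sum_distrib_left mult.commute)
  finally show ?thesis using p by (simp add: wavg_def abs_divide pos_divide_le_eq)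
qed

lemma wcov_bound:
  assumes T: "finite T" "T \<noteq> {}" and w: "\<And>c. w c > 0" and f: "\<And>c. c \<in> T \<Longrightarrow> \<bar>f c\<bar> \<le> 1" "\<And>c. c \<in> T \<Longrightarrow> \<bar>g c\<bar> \<le> 1"
  shows "\<bar>wcov T w f g\<bar> \<le> 2"
proof -
  have 1: "\<bar>wavg T w (\<lambda>c. f c * g c)\<bar> \<le> 1"
    using f by (intro wavg_bound T w) (auto simp: abs_mult intro!: mult_le_one)
  have 2: "\<bar>wavg T w f * wavg T w g\<bar> \<le> 1"
    unfolding abs_mult using f by (intro mult_le_one wavg_bound T w) auto
  show ?thesis unfolding wcov_def using 1 2 by linarith
qed

lemma wvar_bounds:
  assumes T: "finite T" "T \<noteq> {}" and w: "\<And>c. w c > 0" and f: "\<And>c. c \<in> T \<Longrightarrow> \<bar>f c\<bar> \<le> 1"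
  shows "\<bar>wcov T w f f\<bar> \<le> 1"
proof -
  have p: "(\<Sum>c\<in>T. w c) > 0" using T w by (intro sum_pos) auto
  define m where "m = wavg T w f"
  have m: "\<bar>m\<bar> \<le> 1" unfolding m_def by (intro wavg_bound T w f)
  have "0 \<le> wavg T w (\<lambda>c. (f c - m)\<^sup>2)" unfolding wavg_def
    using w by (intro divide_nonneg_nonneg sum_nonneg mult_nonneg_nonneg) (auto intro: less_imp_le)
  also have "wavg T w (\<lambda>c. (f c - m)\<^sup>2) = wavg T w (\<lambda>c. f c * f c) - 2 * m * wavg T w f + m\<^sup>2"
  proof -
    have "(\<Sum>c\<in>T. w c * (f c - m)\<^sup>2) = (\<Sum>c\<in>T. w c * (f c * f c)) - 2 * m * (\<Sum>c\<in>T. w c * f c) + m\<^sup>2 * (\<Sum>c\<in>T. w c)"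
      by (simp add: sum_distrib_left sum_subtractf[symmetric] sum.distrib[symmetric] algebra_simps power2_eq_square)
    then show ?thesis using p by (simp add: wavg_def add_divide_distrib diff_divide_distrib)
  qed
  finally have 0: "0 \<le> wcov T w f f" by (simp add: wcov_def m_def power2_eq_square)
  have "\<bar>wavg T w (\<lambda>c. f c * f c)\<bar> \<le> 1"
    by (intro wavg_bound T w, subst abs_mult, intro mult_le_one f abs_ge_zero)
  moreover have "wavg T w f * wavg T w f \<ge> 0" by simp
  ultimately have "wcov T w f f \<le> 1" unfolding wcov_def by linarith
  with 0 show ?thesis by simp
qed

lemma wavg_exp_deriv:
  assumes T: "finite T" "T \<noteq> {}" and w: "\<And>c. w c > 0"
  shows "((\<lambda>s. wavg T (\<lambda>c. w c * exp (s * v c)) f) has_real_derivative wcov T (\<lambda>c. w c * exp (s * v c)) f v) (at s)"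
proof -
  let ?W = "\<lambda>s c. w c * exp (s * v c)"
  have p: "(\<Sum>c\<in>T. ?W s c) > 0" for s using T w by (intro sum_pos) auto
  have "((\<lambda>s. (\<Sum>c\<in>T. ?W s c * f c) / (\<Sum>c\<in>T. ?W s c)) has_real_derivative
     ((\<Sum>c\<in>T. ?W s c * v c * f c) * (\<Sum>c\<in>T. ?W s c) - (\<Sum>c\<in>T. ?W s c * f c) * (\<Sum>c\<in>T. ?W s c * v c)) / ((\<Sum>c\<in>T. ?W s c) * (\<Sum>c\<in>T. ?W s c))) (at s)"
    using p[of s] by (auto intro!: derivative_eq_intros DERIV_divide simp: algebra_simps)
  then show ?thesis unfolding wavg_def wcov_def using p[of s] by (simp add: diff_divide_distrib mult_ac)
qed

lemma ln_sum_exp_deriv: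
  assumes T: "finite T" "T \<noteq> {}" and w: "\<And>c. w c > 0"
  shows "((\<lambda>s. ln (\<Sum>c\<in>T. w c * exp (s * v c))) has_real_derivative wavg T (\<lambda>c. w c * exp (s * v c)) v) (at s)"
proof -
  have p: "(\<Sum>c\<in>T. w c * exp (s * v c)) > 0" for s using T w by (intro sum_pos) auto
  show ?thesis unfolding wavg_def using p[of s]
    by (auto intro!: derivative_eq_intros sum.cong simp: field_simps)
qed

lemma wvar_exp_deriv:
  assumes T: "finite T" "T \<noteq> {}" and w: "\<And>c. w c > 0"
  defines "W \<equiv> \<lambda>s v c. w c * exp (s * v c)"
  shows "((\<lambda>s. wcov T (W s v) f f) has_real_derivative
    wcov T (W s v) (\<lambda>c. f c * f c) v - 2 * wavg T (W s v) f * wcov T (W s v) f v) (at s)"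
proof -
  have d: "((\<lambda>s. wavg T (W s v) f) has_real_derivative wcov T (W s v) f v) (at s)" for f
    unfolding W_def using wavg_exp_deriv[OF T w] .
  show ?thesis unfolding wcov_def[of T _ f f]
    by (rule derivative_eq_intros d refl | simp)+
qed

lemma wvar_deriv_bound:
  assumes T: "finite T" "T \<noteq> {}" and w: "\<And>c. w c > 0"
    and f: "\<And>c. c \<in> T \<Longrightarrow> \<bar>f c\<bar> \<le> 1" "\<And>c. c \<in> T \<Longrightarrow> \<bar>v c\<bar> \<le> 1"
  shows "\<bar>wcov T w (\<lambda>c. f c * f c) v - 2 * wavg T w f * wcov T w f v\<bar> \<le> 6"
proof -
  have 1: "\<bar>wcov T w (\<lambda>c. f c * f c) v\<bar> \<le> 2" by (intro wcov_bound T w f, subst abs_mult, intro mult_le_one f abs_ge_zero)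
  have "\<bar>wavg T w f\<bar> * \<bar>wcov T w f v\<bar> \<le> 1 * 2" by (intro mult_mono wavg_bound wcov_bound T w f) auto
  then have "\<bar>2 * wavg T w f * wcov T w f v\<bar> \<le> 4" by (simp add: abs_mult)
  with 1 show ?thesis by linarith
qed

text \<open>The derivatives of the log-sum of exponentials are the cumulants of \<open>v\<close> under the tilted weights; for
  \<open>\<bar>v\<bar> \<le> 1\<close> the third one is at most \<open>6\<close>, and \<open>6\<close> cancels the factorial.\<close>

lemma ln_sum_exp_taylor:
  assumes T: "finite T" "T \<noteq> {}" and w: "\<And>c. w c > 0" and v: "\<And>c. c \<in> T \<Longrightarrow> \<bar>v c\<bar> \<le> 1"
  shows "\<bar>ln (\<Sum>c\<in>T. w c * exp (s * v c)) - ln (\<Sum>c\<in>T. w c) - s * wavg T w v - s\<^sup>2 / 2 * wcov T w v v\<bar> \<le> \<bar>s\<bar>^3"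
proof -
  define W where "W s c = w c * exp (s * v c)" for s c
  define D3 where "D3 s = wcov T (W s) (\<lambda>c. v c * v c) v - 2 * wavg T (W s) v * wcov T (W s) v v" for s
  define diff where "diff m = (if m = 0 then \<lambda>s. ln (\<Sum>c\<in>T. W s c) else if m = 1 then \<lambda>s. wavg T (W s) v
     else if m = 2 then \<lambda>s. wcov T (W s) v v else D3)" for m :: nat
  have Wp: "W s c > 0" for s c using w by (simp add: W_def)
  have W0: "W 0 = w" by (simp add: W_def fun_eq_iff)
  have d: "DERIV (diff m) t :> diff (Suc m) t" if m: "m < 3" for m t
  proof -
    consider "m = 0" | "m = 1" | "m = 2" using m by linarith
    then show ?thesis
    proof cases
      case 1 then show ?thesis using ln_sum_exp_deriv[where T = T and w = w and v = v and s = t, OF T w] by (simp add: diff_def W_def[abs_def])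
    next
      case 2 then show ?thesis using wavg_exp_deriv[where T = T and w = w and v = v and f = v and s = t, OF T w]
        by (simp add: diff_def W_def[abs_def] eval_nat_numeral)
    next
      case 3 then show ?thesis using wvar_exp_deriv[where T = T and w = w and v = v and f = v and s = t, OF T w]
        by (simp add: diff_def D3_def W_def[abs_def])
    qed
  qed
  obtain t where t: "diff 0 s = (\<Sum>m<3. diff m 0 / fact m * s ^ m) + diff 3 t / fact 3 * s ^ 3"
    using Maclaurin_bi_le[of diff "diff 0" 3 s] d by auto
  have "\<bar>D3 t\<bar> \<le> 6" unfolding D3_def using v by (intro wvar_deriv_bound T Wp) auto
  then have "\<bar>D3 t\<bar> * \<bar>s\<bar>^3 \<le> 6 * \<bar>s\<bar>^3" by (intro mult_right_mono) auto
  moreover have "ln (\<Sum>c\<in>T. W s c) = ln (\<Sum>c\<in>T. w c) + s * wavg T w v + s\<^sup>2/2 * wcov T w v v + D3 t / 6 * s^3"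
    using t by (simp add: diff_def W0 eval_nat_numeral fact_numeral)
  ultimately show ?thesis by (simp add: W_def abs_mult power_abs)
qed

lemma real_lipschitz_of_deriv_bound:
  fixes f :: "real \<Rightarrow> real"
  assumes "\<And>s. (f has_real_derivative f' s) (at s)" "\<And>s. \<bar>f' s\<bar> \<le> B"
  shows "\<bar>f s - f 0\<bar> \<le> B * \<bar>s\<bar>"
  using field_differentiable_bound[of UNIV f f' B s 0] assms by (simp add: has_field_derivative_at_within)

definition gibbs_weight :: "'i set \<Rightarrow> ('c \<Rightarrow> real) \<Rightarrow> ('i \<Rightarrow> 'c \<Rightarrow> real) \<Rightarrow> ('i \<Rightarrow> real) \<Rightarrow> 'c \<Rightarrow> real" where
  "gibbs_weight I u a x c = exp (u c + (\<Sum>i\<in>I. x i * a i c))"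

definition log_partition :: "'i set \<Rightarrow> 'c set \<Rightarrow> ('c \<Rightarrow> real) \<Rightarrow> ('i \<Rightarrow> 'c \<Rightarrow> real) \<Rightarrow> ('i \<Rightarrow> real) \<Rightarrow> real" where
  "log_partition I T u a x = ln (\<Sum>c\<in>T. gibbs_weight I u a x c)"

text \<open>The second derivative of the log-partition function in direction \<open>i\<close>.\<close>

definition gibbs_var :: "'i set \<Rightarrow> 'c set \<Rightarrow> ('c \<Rightarrow> real) \<Rightarrow> ('i \<Rightarrow> 'c \<Rightarrow> real) \<Rightarrow> 'i \<Rightarrow> ('i \<Rightarrow> real) \<Rightarrow> real" where
  "gibbs_var I T u a i x = wcov T (gibbs_weight I u a x) (a i) (a i)"

locale finite_gibbs =
  fixes I :: "'i set" and T :: "'c set" and u :: "'c \<Rightarrow> real" and a :: "'i \<Rightarrow> 'c \<Rightarrow> real"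
  assumes I: "finite I" and T: "finite T" "T \<noteq> {}"
    and a: "\<And>i c. i \<in> I \<Longrightarrow> c \<in> T \<Longrightarrow> \<bar>a i c\<bar> \<le> 1"
begin

abbreviation "W \<equiv> gibbs_weight I u a"
abbreviation "F \<equiv> log_partition I T u a"
abbreviation "D \<equiv> gibbs_var I T u a"

lemma weight_pos: "W x c > 0" by (simp add: gibbs_weight_def)

lemma weight_update:
  assumes "i \<in> I"
  shows "W (x(i := x i + s)) c = W x c * exp (s * a i c)"
proof -
  have "(\<Sum>j\<in>I. (x(i := x i + s)) j * a j c) = (\<Sum>j\<in>I. x j * a j c + (if j = i then s * a i c else 0))"
    by (intro sum.cong) (auto simp: algebra_simps)
  also have "\<dots> = (\<Sum>j\<in>I. x j * a j c) + s * a i c"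
    using assms I by (simp add: sum.distrib)
  finally show ?thesis by (simp add: gibbs_weight_def exp_add add.assoc del: fun_upd_apply)
qed

lemma weight_fun_upd: "i \<in> I \<Longrightarrow> W (x(i := y)) = (\<lambda>c. W x c * exp ((y - x i) * a i c))"
  using weight_update[of i x "y - x i"] by (simp add: fun_eq_iff)

lemma taylor:
  assumes "i \<in> I"
  shows "\<bar>F (x(i := x i + s)) - F x - s * wavg T (W x) (a i) - s\<^sup>2 / 2 * D i x\<bar> \<le> \<bar>s\<bar>^3"
  unfolding log_partition_def gibbs_var_def weight_update[OF assms]
  using ln_sum_exp_taylor[OF T weight_pos, of "a i"] a[OF assms] by simp

lemma measurable_F: "F \<in> borel_measurable (PiM I (\<lambda>_. borel))"
  unfolding log_partition_def gibbs_weight_def by measurable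

lemma measurable_D: "D i \<in> borel_measurable (PiM I (\<lambda>_. borel))"
  unfolding gibbs_var_def gibbs_weight_def wcov_def wavg_def by measurable

lemma lipschitz_F: "coord_lipschitz I (\<lambda>_. 1) F"
  unfolding coord_lipschitz_def
proof (intro conjI allI ballI measurable_F)
  fix x i y assume i: "i \<in> I"
  have "\<bar>ln (\<Sum>c\<in>T. W x c * exp (s * a i c)) - ln (\<Sum>c\<in>T. W x c * exp (0 * a i c))\<bar> \<le> 1 * \<bar>s\<bar>" for s
    by (rule real_lipschitz_of_deriv_bound[OF ln_sum_exp_deriv[OF T weight_pos]])
       (use a[OF i] weight_pos in \<open>intro wavg_bound T; auto\<close>)
  from this[of "y - x i"] show "\<bar>F (x(i := y)) - F x\<bar> \<le> 1 * \<bar>y - x i\<bar>"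
    using weight_update[OF i, of x "y - x i"] by (simp add: log_partition_def)
qed

lemma lipschitz_D:
  assumes j: "j \<in> I"
  shows "coord_lipschitz I (\<lambda>_. 6) (D j)"
  unfolding coord_lipschitz_def
proof (intro conjI allI ballI measurable_D)
  fix x i y assume i: "i \<in> I"
  have "\<bar>wcov T (\<lambda>c. W x c * exp (s * a i c)) (a j) (a j) - wcov T (\<lambda>c. W x c * exp (0 * a i c)) (a j) (a j)\<bar> \<le> 6 * \<bar>s\<bar>" for s
    by (rule real_lipschitz_of_deriv_bound[OF wvar_exp_deriv[OF T weight_pos]])
       (use a[OF i] a[OF j] weight_pos in \<open>intro wvar_deriv_bound T; auto\<close>)
  from this[of "y - x i"] show "\<bar>D j (x(i := y)) - D j x\<bar> \<le> 6 * \<bar>y - x i\<bar>"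
    unfolding gibbs_var_def weight_fun_upd[OF i, of x y] by simp
qed

lemma D_bound: "i \<in> I \<Longrightarrow> \<bar>D i x\<bar> \<le> 1"
  unfolding gibbs_var_def by (intro wvar_bounds T weight_pos a)

end

section \<open>Replacing independent variables and changing Gaussian variances\<close>

text \<open>The shape in which an expansion \<open>f = g + c h\<close> with a uniform error is averaged.\<close>

lemma (in prob_space) integral_diff3_bound:
  fixes f g h :: "'a \<Rightarrow> real"
  assumes int: "integrable M f" "integrable M g" "integrable M h"
    and bound: "\<And>x. \<bar>f x - g x - c * h x\<bar> \<le> \<delta>"
  shows "\<bar>integral\<^sup>L M f - integral\<^sup>L M g - c * integral\<^sup>L M h\<bar> \<le> \<delta>"
proof -
  have i: "integrable M (\<lambda>x. f x - g x - c * h x)" using int by simp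
  have "integral\<^sup>L M f - integral\<^sup>L M g - c * integral\<^sup>L M h = (\<integral>x. f x - g x - c * h x \<partial>M)"
    using int by simp
  also have "\<bar>\<dots>\<bar> \<le> (\<integral>x. \<bar>f x - g x - c * h x\<bar> \<partial>M)" by (rule integral_abs_bound)
  also have "\<dots> \<le> (\<integral>x. \<delta> \<partial>M)"
    by (rule integral_mono[OF integrable_abs[OF i] integrable_const bound])
  finally show ?thesis by (simp add: prob_space)
qed

text \<open>If three product measures differ in one factor only, a bound on the integrals over this factor,
  uniform in the other coordinates, passes to the full integrals.\<close>

lemma site_compare:
  assumes J: "finite J" "i \<notin> J" and light: "\<And>j. light (M j)" "\<And>j. light (N j)" "\<And>j. light (P j)"
    and eq: "\<And>j. j \<in> J \<Longrightarrow> N j = M j" "\<And>j. j \<in> J \<Longrightarrow> P j = M j"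
    and lip: "coord_lipschitz (insert i J) L F" "coord_lipschitz (insert i J) L' G" "coord_lipschitz (insert i J) L'' H"
    and bound: "\<And>x. \<bar>(\<integral>y. F (x(i := y)) \<partial>M i) - (\<integral>y. G (x(i := y)) \<partial>N i) - c * (\<integral>y. H (x(i := y)) \<partial>P i)\<bar> \<le> \<delta>"
  shows "\<bar>integral\<^sup>L (PiM (insert i J) M) F - integral\<^sup>L (PiM (insert i J) N) G - c * integral\<^sup>L (PiM (insert i J) P) H\<bar> \<le> \<delta>"
proof -
  interpret prob_space "PiM J M" by (rule prob_space_PiM) (rule lightD(1)[OF light(1)])
  have e: "PiM J N = PiM J M" "PiM J P = PiM J M" using eq by (auto intro!: PiM_cong)
  let ?f = "\<lambda>x. \<integral>y. F (x(i := y)) \<partial>M i" and ?g = "\<lambda>x. \<integral>y. G (x(i := y)) \<partial>N i" and ?h = "\<lambda>x. \<integral>y. H (x(i := y)) \<partial>P i"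
  have int: "integrable (PiM J M) ?f" "integrable (PiM J M) ?g" "integrable (PiM J M) ?h"
    by (rule coord_lipschitz_integrable[OF J(1) light(1) coord_lipschitz_average[OF lip(1) light(1) J(2)]],
        rule coord_lipschitz_integrable[OF J(1) light(1) coord_lipschitz_average[OF lip(2) light(2) J(2)]],
        rule coord_lipschitz_integrable[OF J(1) light(1) coord_lipschitz_average[OF lip(3) light(3) J(2)]])
  have "integral\<^sup>L (PiM (insert i J) M) F - integral\<^sup>L (PiM (insert i J) N) G - c * integral\<^sup>L (PiM (insert i J) P) H
    = integral\<^sup>L (PiM J M) ?f - integral\<^sup>L (PiM J M) ?g - c * integral\<^sup>L (PiM J M) ?h"
    using coord_lipschitz_fubini[OF J light(1) lip(1)] coord_lipschitz_fubini[OF J light(2) lip(2)] coord_lipschitz_fubini[OF J light(3) lip(3)]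
    by (simp add: e)
  also have "\<bar>\<dots>\<bar> \<le> \<delta>"
    by (rule integral_diff3_bound[OF int bound])
  finally show ?thesis .
qed

lemma light_centered_taylor:
  assumes M: "light \<mu>" and f: "integrable \<mu> f" "(\<integral>y. y \<partial>\<mu>) = 0"
    and taylor: "\<And>y. \<bar>f y - A - y * B - y\<^sup>2 / 2 * C\<bar> \<le> \<bar>y\<bar>^3"
  shows "\<bar>integral\<^sup>L \<mu> f - A - (\<integral>y. y\<^sup>2 \<partial>\<mu>) / 2 * C\<bar> \<le> (\<integral>y. \<bar>y\<bar>^3 \<partial>\<mu>)"
proof -
  interpret prob_space \<mu> by (rule lightD(1)[OF M])
  note m = light_moments[OF M]
  have sq: "integrable \<mu> (\<lambda>y. y\<^sup>2 / 2 * C)" using m(3) by simp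
  have "integral\<^sup>L \<mu> f - A - (\<integral>y. y\<^sup>2 \<partial>\<mu>) / 2 * C = (\<integral>y. f y - A - y * B - y\<^sup>2 / 2 * C \<partial>\<mu>)"
    using f m(1) sq by (simp add: prob_space)
  also have "\<bar>\<dots>\<bar> \<le> (\<integral>y. \<bar>y\<bar>^3 \<partial>\<mu>)"
  proof (rule integral_abs_bound_integral[OF _ m(4) taylor])
    show "integrable \<mu> (\<lambda>y. f y - A - y * B - y\<^sup>2 / 2 * C)"
      by (rule Bochner_Integration.integrable_diff[OF Bochner_Integration.integrable_diff[OF
          Bochner_Integration.integrable_diff[OF f(1) integrable_const] integrable_mult_left[OF m(1)]] sq])
  qed
  finally show ?thesis .
qed

context finite_gibbs
begin

lemma lindeberg_site:
  assumes i: "i \<in> I" and light: "\<And>j. light (M j)" "\<And>j. light (N j)" and eq: "\<And>j. j \<noteq> i \<Longrightarrow> N j = M j"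
    and mean: "(\<integral>y. y \<partial>M i) = 0" "(\<integral>y. y \<partial>N i) = 0"
  shows "\<bar>integral\<^sup>L (PiM I M) F - integral\<^sup>L (PiM I N) F\<bar> \<le>
     \<bar>(\<integral>y. y\<^sup>2 \<partial>M i) - (\<integral>y. y\<^sup>2 \<partial>N i)\<bar> / 2 + (\<integral>y. \<bar>y\<bar>^3 \<partial>M i) + (\<integral>y. \<bar>y\<bar>^3 \<partial>N i)" (is "_ \<le> ?\<delta>")
proof -
  define J where "J = I - {i}"
  have J: "insert i J = I" "finite J" "i \<notin> J" using i I by (auto simp: J_def)
  have lip: "coord_lipschitz (insert i J) (\<lambda>_. 1) F" using lipschitz_F J by simp
  have "\<bar>integral\<^sup>L (PiM (insert i J) M) F - integral\<^sup>L (PiM (insert i J) N) F - 0 * integral\<^sup>L (PiM (insert i J) M) F\<bar> \<le> ?\<delta>"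
  proof (rule site_compare[OF J(2,3) light light(1) _ _ lip lip lip])
    show "N j = M j" if "j \<in> J" for j by (rule eq) (use J(3) that in auto)
    fix x :: "'i \<Rightarrow> real"
    define x' where "x' = x(i := 0)"
    have upd: "x'(i := x' i + y) = x(i := y)" for y by (auto simp: x'_def)
    have ty: "\<bar>F (x(i := y)) - F x' - y * wavg T (W x') (a i) - y\<^sup>2 / 2 * D i x'\<bar> \<le> \<bar>y\<bar>^3" for y
      using taylor[OF i, of x' y] upd by simp
    have "\<bar>(\<integral>y. F (x(i := y)) \<partial>M i) - F x' - (\<integral>y. y\<^sup>2 \<partial>M i) / 2 * D i x'\<bar> \<le> (\<integral>y. \<bar>y\<bar>^3 \<partial>M i)"
      by (rule light_centered_taylor[OF light(1) coord_lipschitz_section(2)[OF lip light(1) J(3)] mean(1) ty])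
    moreover have "\<bar>(\<integral>y. F (x(i := y)) \<partial>N i) - F x' - (\<integral>y. y\<^sup>2 \<partial>N i) / 2 * D i x'\<bar> \<le> (\<integral>y. \<bar>y\<bar>^3 \<partial>N i)"
      by (rule light_centered_taylor[OF light(2) coord_lipschitz_section(2)[OF lip light(2) J(3)] mean(2) ty])
    moreover have "\<bar>(\<integral>y. y\<^sup>2 \<partial>M i) / 2 * D i x' - (\<integral>y. y\<^sup>2 \<partial>N i) / 2 * D i x'\<bar> \<le> \<bar>(\<integral>y. y\<^sup>2 \<partial>M i) - (\<integral>y. y\<^sup>2 \<partial>N i)\<bar> / 2"
    proof -
      have "(\<integral>y. y\<^sup>2 \<partial>M i) / 2 * D i x' - (\<integral>y. y\<^sup>2 \<partial>N i) / 2 * D i x' = ((\<integral>y. y\<^sup>2 \<partial>M i) - (\<integral>y. y\<^sup>2 \<partial>N i)) / 2 * D i x'"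
        by (simp add: field_simps)
      also have "\<bar>\<dots>\<bar> \<le> \<bar>(\<integral>y. y\<^sup>2 \<partial>M i) - (\<integral>y. y\<^sup>2 \<partial>N i)\<bar> / 2 * 1"
        unfolding abs_mult by (intro mult_mono D_bound i) auto
      finally show ?thesis by simp
    qed
    ultimately show "\<bar>(\<integral>y. F (x(i := y)) \<partial>M i) - (\<integral>y. F (x(i := y)) \<partial>N i) - 0 * (\<integral>y. F (x(i := y)) \<partial>M i)\<bar> \<le> ?\<delta>"
      by linarith
  qed simp
  then show ?thesis by (simp add: J)
qed

text \<open>Exchange one factor at a time. The first moments agree, so the linear Taylor
  terms cancel; the quadratic terms differ by the difference of the variances, since the Gibbs variance is at
  most \<open>1\<close>; the remainders are third moments.\<close>

theorem lindeberg:
  assumes light: "\<And>j. light (M j)" "\<And>j. light (N j)"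
    and mean: "\<And>j. j \<in> I \<Longrightarrow> (\<integral>y. y \<partial>M j) = 0" "\<And>j. j \<in> I \<Longrightarrow> (\<integral>y. y \<partial>N j) = 0"
  shows "\<bar>integral\<^sup>L (PiM I M) F - integral\<^sup>L (PiM I N) F\<bar> \<le>
     (\<Sum>i\<in>I. \<bar>(\<integral>y. y\<^sup>2 \<partial>M i) - (\<integral>y. y\<^sup>2 \<partial>N i)\<bar> / 2 + (\<integral>y. \<bar>y\<bar>^3 \<partial>M i) + (\<integral>y. \<bar>y\<bar>^3 \<partial>N i))"
proof -
  define H where "H J j = (if j \<in> J then N j else M j)" for J j
  have lH: "light (H J j)" for J j using light by (simp add: H_def)
  let ?\<delta> = "\<lambda>i. \<bar>(\<integral>y. y\<^sup>2 \<partial>M i) - (\<integral>y. y\<^sup>2 \<partial>N i)\<bar> / 2 + (\<integral>y. \<bar>y\<bar>^3 \<partial>M i) + (\<integral>y. \<bar>y\<bar>^3 \<partial>N i)"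
  have "\<bar>integral\<^sup>L (PiM I M) F - integral\<^sup>L (PiM I (H J)) F\<bar> \<le> sum ?\<delta> J" if "finite J" "J \<subseteq> I" for J
    using that
  proof (induction J rule: finite_induct)
    case empty
    have "H {} = M" by (simp add: H_def fun_eq_iff)
    then show ?case by simp
  next
    case (insert i J)
    have "\<bar>integral\<^sup>L (PiM I (H J)) F - integral\<^sup>L (PiM I (H (insert i J))) F\<bar> \<le>
      \<bar>(\<integral>y. y\<^sup>2 \<partial>H J i) - (\<integral>y. y\<^sup>2 \<partial>H (insert i J) i)\<bar> / 2 + (\<integral>y. \<bar>y\<bar>^3 \<partial>H J i) + (\<integral>y. \<bar>y\<bar>^3 \<partial>H (insert i J) i)"
      using insert mean by (intro lindeberg_site lH) (auto simp: H_def)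
    also have "\<dots> = ?\<delta> i" using insert by (simp add: H_def)
    finally show ?case using insert by simp
  qed
  from this[OF I subset_refl]
  have "\<bar>integral\<^sup>L (PiM I M) F - integral\<^sup>L (PiM I (H I)) F\<bar> \<le> sum ?\<delta> I" .
  also have "PiM I (H I) = PiM I N" by (rule PiM_cong) (auto simp: H_def)
  finally show ?thesis .
qed

end

lemma integral_gauss_add:
  fixes f :: "real \<Rightarrow> real"
  assumes s: "s \<ge> 0" "t \<ge> 0" and f: "f \<in> borel_measurable borel" "integrable (gauss (s + t)) f"
  shows "(\<integral>y. (\<integral>z. f (y + z) \<partial>gauss t) \<partial>gauss s) = integral\<^sup>L (gauss (s + t)) f"
    "integrable (gauss s) (\<lambda>y. \<integral>z. f (y + z) \<partial>gauss t)"
proof -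
  interpret pair_sigma_finite "gauss s" "gauss t"
    by (simp add: pair_sigma_finite_def prob_space_imp_sigma_finite prob_space_gauss)
  note [measurable] = f(1)
  have m: "(\<lambda>(x, y). x + y) \<in> gauss s \<Otimes>\<^sub>M gauss t \<rightarrow>\<^sub>M (borel :: real measure)" by measurable
  have int: "integrable (gauss s \<Otimes>\<^sub>M gauss t) (\<lambda>p. f ((\<lambda>(x, y). x + y) p))"
    using f(2) unfolding gauss_add[OF s] by (subst (asm) integrable_distr_eq[OF m f(1)])
  have "integral\<^sup>L (gauss (s + t)) f = integral\<^sup>L (gauss s \<Otimes>\<^sub>M gauss t) (\<lambda>p. f ((\<lambda>(x, y). x + y) p))"
    unfolding gauss_add[OF s] by (rule integral_distr[OF m f(1)])
  also have "\<dots> = (\<integral>y. (\<integral>z. f (y + z) \<partial>gauss t) \<partial>gauss s)"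
    using integral_fst'[OF int] by simp
  finally show "(\<integral>y. (\<integral>z. f (y + z) \<partial>gauss t) \<partial>gauss s) = integral\<^sup>L (gauss (s + t)) f" by simp
  show "integrable (gauss s) (\<lambda>y. \<integral>z. f (y + z) \<partial>gauss t)"
    using integrable_fst'[OF int] by simp
qed

text \<open>Raising the variance from \<open>s\<close> to \<open>s + t\<close> is adding an independent Gaussian of
  variance \<open>t\<close> to the coordinate.\<close>

lemma gauss_increment:
  assumes F: "coord_lipschitz (insert i J) L F" and G: "coord_lipschitz (insert i J) L' G" and i: "i \<notin> J"
    and s: "s \<ge> 0" "t \<ge> 0"
    and bound: "\<And>x. \<bar>(\<integral>z. F (x(i := x i + z)) \<partial>gauss t) - F x - c * G x\<bar> \<le> \<delta>"
  shows "\<bar>(\<integral>y. F (x(i := y)) \<partial>gauss (s + t)) - (\<integral>y. F (x(i := y)) \<partial>gauss s) - c * (\<integral>y. G (x(i := y)) \<partial>gauss s)\<bar> \<le> \<delta>"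
proof -
  interpret prob_space "gauss s" by (rule prob_space_gauss)
  have lt: "light (gauss (s + t))" "light (gauss s)" using s by (auto intro: light_gauss)
  note F1 = coord_lipschitz_section[OF F lt(1) i] and F2 = coord_lipschitz_section[OF F lt(2) i]
    and G2 = coord_lipschitz_section[OF G lt(2) i]
  note A = integral_gauss_add[OF s F1(1) F1(2)]
  have "\<bar>(\<integral>z. F (x(i := y + z)) \<partial>gauss t) - F (x(i := y)) - c * G (x(i := y))\<bar> \<le> \<delta>" for y
    using bound[of "x(i := y)"] by (simp only: fun_upd_upd fun_upd_same)
  from integral_diff3_bound[OF A(2) F2(2) G2(2) this] show ?thesis
    unfolding A(1) .
qed

text \<open>Expectation under independent centred Gaussian coordinates, as a function of their
  variances.\<close>

definition gexp :: "'i set \<Rightarrow> ('i \<Rightarrow> real) \<Rightarrow> (('i \<Rightarrow> real) \<Rightarrow> real) \<Rightarrow> real" where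
  "gexp I s F = integral\<^sup>L (PiM I (\<lambda>i. gauss (s i))) F"

lemma gexp_cong: "(\<And>i. i \<in> I \<Longrightarrow> s i = s' i) \<Longrightarrow> gexp I s F = gexp I s' F"
  unfolding gexp_def by (intro arg_cong[where f = "\<lambda>M. integral\<^sup>L M F"] PiM_cong) auto

lemma gexp_increment:
  assumes I: "finite I" "i \<in> I" and F: "coord_lipschitz I L F" and G: "coord_lipschitz I L' G"
    and s: "\<And>j. s j \<ge> 0" "t \<ge> 0"
    and bound: "\<And>x. \<bar>(\<integral>z. F (x(i := x i + z)) \<partial>gauss t) - F x - c * G x\<bar> \<le> \<delta>"
  shows "\<bar>gexp I (s(i := s i + t)) F - gexp I s F - c * gexp I s G\<bar> \<le> \<delta>"
proof -
  define J where "J = I - {i}"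
  have J: "insert i J = I" "finite J" "i \<notin> J" using I by (auto simp: J_def)
  have lip: "coord_lipschitz (insert i J) L F" "coord_lipschitz (insert i J) L' G" using F G J by auto
  have "\<bar>gexp (insert i J) (s(i := s i + t)) F - gexp (insert i J) s F - c * gexp (insert i J) s G\<bar> \<le> \<delta>"
    unfolding gexp_def
  proof (rule site_compare[OF J(2,3) _ _ _ _ _ lip(1) lip(1) lip(2)])
    fix x
    show "\<bar>(\<integral>y. F (x(i := y)) \<partial>gauss ((s(i := s i + t)) i)) - (\<integral>y. F (x(i := y)) \<partial>gauss (s i)) - c * (\<integral>y. G (x(i := y)) \<partial>gauss (s i))\<bar> \<le> \<delta>"
      unfolding fun_upd_same by (rule gauss_increment[OF lip J(3) s(1) s(2) bound])
  qed (use s J in \<open>auto intro!: light_gauss\<close>)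
  then show ?thesis by (simp add: J)
qed

lemma integrable_coord_shift:
  assumes i: "i \<in> I" and F: "coord_lipschitz I L F" and lt: "light \<mu>"
  shows "integrable \<mu> (\<lambda>z. F (x(i := x i + z)))"
proof (rule Bochner_Integration.integrable_bound[of _ "\<lambda>z. \<bar>F x\<bar> + L i * \<bar>z\<bar>"])
  interpret prob_space \<mu> by (rule lightD(1)[OF lt])
  note [measurable_cong] = lightD(2)[OF lt]
  show "integrable \<mu> (\<lambda>z. \<bar>F x\<bar> + L i * \<bar>z\<bar>)" using light_moments(2)[OF lt] by simp
  have "insert i (I - {i}) = I" using i by auto
  then have m: "(\<lambda>y. F (x(i := y))) \<in> borel_measurable borel"
    using coord_lipschitz_section(1)[of i "I - {i}" L F, OF _ lt] F by auto
  show "(\<lambda>z. F (x(i := x i + z))) \<in> borel_measurable \<mu>"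
    by (rule measurable_compose[OF _ m]) measurable
  show "AE z in \<mu>. norm (F (x(i := x i + z))) \<le> norm (\<bar>F x\<bar> + L i * \<bar>z\<bar>)"
  proof (rule AE_I2)
    fix z show "norm (F (x(i := x i + z))) \<le> norm (\<bar>F x\<bar> + L i * \<bar>z\<bar>)"
      using coord_lipschitzD(2)[OF F i, of x "x i + z"] by simp
  qed
qed

lemma gexp_lipschitz_step:
  assumes I: "finite I" "i \<in> I" and G: "coord_lipschitz I (\<lambda>_. B) G"
    and s: "\<And>j. s j \<ge> 0" "r \<ge> 0"
  shows "\<bar>gexp I (s(i := r)) G - gexp I s G\<bar> \<le> B * sqrt \<bar>r - s i\<bar>"
proof -
  have up: "\<bar>gexp I (s(i := s i + t)) G - gexp I s G\<bar> \<le> B * sqrt t" if s: "\<And>j. s j \<ge> 0" "t \<ge> 0" for s t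
  proof -
    have "\<bar>gexp I (s(i := s i + t)) G - gexp I s G - 0 * gexp I s G\<bar> \<le> B * sqrt t"
    proof (rule gexp_increment[OF I G G s])
      fix x
      have lt: "light (gauss t)" using s by (auto intro: light_gauss)
      interpret prob_space "gauss t" by (rule prob_space_gauss)
      have lip: "\<bar>G (x(i := x i + z)) - G x\<bar> \<le> B * \<bar>z\<bar>" for z
        using coord_lipschitzD(2)[OF G I(2), of x "x i + z"] by simp
      note int = integrable_coord_shift[OF I(2) G lt, of x]
      have "(\<integral>z. G x \<partial>gauss t) = G x" using prob_space by simp
      then have "\<bar>(\<integral>z. G (x(i := x i + z)) \<partial>gauss t) - G x\<bar> = \<bar>\<integral>z. G (x(i := x i + z)) - G x \<partial>gauss t\<bar>"
        by (simp only: Bochner_Integration.integral_diff[OF int integrable_const])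
      also have "\<dots> \<le> (\<integral>z. \<bar>G (x(i := x i + z)) - G x\<bar> \<partial>gauss t)" by (rule integral_abs_bound)
      also have "\<dots> \<le> (\<integral>z. B * \<bar>z\<bar> \<partial>gauss t)"
      proof (rule integral_mono[OF _ _ lip])
        show "integrable (gauss t) (\<lambda>z. \<bar>G (x(i := x i + z)) - G x\<bar>)"
          by (rule integrable_abs[OF Bochner_Integration.integrable_diff[OF int integrable_const]])
        show "integrable (gauss t) (\<lambda>z. B * \<bar>z\<bar>)"
          using light_moments(2)[OF lt] by (rule integrable_mult_right)
      qed
      also have "\<dots> \<le> B * sqrt t" using gauss_moments(3)[OF s(2)] coord_lipschitz_nonneg[OF G I(2)] by (simp add: mult_left_mono)
      finally show "\<bar>(\<integral>z. G (x(i := x i + z)) \<partial>gauss t) - G x - 0 * G x\<bar> \<le> B * sqrt t" by simp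
    qed
    then show ?thesis by simp
  qed
  show ?thesis
  proof (cases "s i \<le> r")
    case True
    then show ?thesis using up[of s "r - s i", OF s(1)] by simp
  next
    case False
    have "(s(i := r))(i := s i) = s" by auto
    then show ?thesis using up[of "s(i := r)" "s i - r"] s False by (simp add: abs_minus_commute)
  qed
qed

lemma gexp_lipschitz:
  assumes I: "finite I" and G: "coord_lipschitz I (\<lambda>_. B) G"
    and s: "\<And>j. s j \<ge> 0" "\<And>j. s' j \<ge> 0" "\<And>j. \<bar>s' j - s j\<bar> \<le> \<eta>" and J: "finite J" "J \<subseteq> I"
  shows "\<bar>gexp I (\<lambda>j. if j \<in> J then s' j else s j) G - gexp I s G\<bar> \<le> card J * (B * sqrt \<eta>)"
  using J
proof (induction J rule: finite_induct)
  case (insert i J)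
  define sJ where "sJ = (\<lambda>j. if j \<in> J then s' j else s j)"
  have B: "B \<ge> 0" using insert coord_lipschitz_nonneg[OF G, of i] by simp
  have "(\<lambda>j. if j \<in> insert i J then s' j else s j) = sJ(i := s' i)" by (auto simp: sJ_def)
  moreover have "\<bar>gexp I (sJ(i := s' i)) G - gexp I sJ G\<bar> \<le> B * sqrt \<bar>s' i - sJ i\<bar>"
    using insert s by (intro gexp_lipschitz_step[OF I _ G]) (auto simp: sJ_def)
  moreover have "B * sqrt \<bar>s' i - sJ i\<bar> \<le> B * sqrt \<eta>"
    using insert s(3)[of i] B by (intro mult_left_mono) (auto simp: sJ_def)
  ultimately show ?case using insert by (simp add: sJ_def algebra_simps)
qed simp

context finite_gibbs
begin

lemma gexp_deriv_up:
  assumes i: "i \<in> I" and s: "\<And>j. s j \<ge> 0" "t \<ge> 0"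
  shows "\<bar>gexp I (s(i := s i + t)) F - gexp I s F - t / 2 * gexp I s (D i)\<bar> \<le> 2 * t * sqrt t"
proof (rule gexp_increment[OF I i lipschitz_F lipschitz_D[OF i] s])
  fix x
  have lt: "light (gauss t)" using s by (auto intro: light_gauss)
  interpret prob_space "gauss t" by (rule prob_space_gauss)
  note int = integrable_coord_shift[OF i lipschitz_F lt, of x]
  have "\<bar>(\<integral>z. F (x(i := x i + z)) \<partial>gauss t) - F x - (\<integral>y. y\<^sup>2 \<partial>gauss t) / 2 * D i x\<bar> \<le> (\<integral>y. \<bar>y\<bar>^3 \<partial>gauss t)"
    by (rule light_centered_taylor[OF lt int gauss_moments(1)[OF s(2)] taylor[OF i]])
  then show "\<bar>(\<integral>z. F (x(i := x i + z)) \<partial>gauss t) - F x - t / 2 * D i x\<bar> \<le> 2 * t * sqrt t"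
    using gauss_moments[OF s(2)] by simp
qed

text \<open>For a decrease of the variance the expansion starts from the smaller variance; moving the
  Gibbs variance back to the larger one costs its Lipschitz constant \<open>6\<close> times
  the square root of the increment.\<close>

lemma gexp_deriv_step:
  assumes i: "i \<in> I" and s: "\<And>j. s j \<ge> 0" "r \<ge> 0"
  shows "\<bar>gexp I (s(i := r)) F - gexp I s F - (r - s i) / 2 * gexp I s (D i)\<bar> \<le> 5 * \<bar>r - s i\<bar> * sqrt \<bar>r - s i\<bar>"
proof (cases "s i \<le> r")
  case True
  have 0: "0 \<le> (r - s i) * sqrt (r - s i)" using True by simp
  have abs: "\<bar>r - s i\<bar> = r - s i" using True by simp
  have "\<bar>gexp I (s(i := s i + (r - s i))) F - gexp I s F - (r - s i) / 2 * gexp I s (D i)\<bar> \<le> 2 * (r - s i) * sqrt (r - s i)"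
    using True by (intro gexp_deriv_up i s(1)) simp
  moreover have "s i + (r - s i) = r" by simp
  ultimately have "\<bar>gexp I (s(i := r)) F - gexp I s F - (r - s i) / 2 * gexp I s (D i)\<bar> \<le> 2 * ((r - s i) * sqrt (r - s i))"
    by (simp only: mult.assoc)
  also have "\<dots> \<le> 5 * ((r - s i) * sqrt (r - s i))" using 0 by linarith
  finally show ?thesis unfolding abs mult.assoc .
next
  case False
  define t where "t = s i - r"
  define s' where "s' = s(i := r)"
  have t: "t \<ge> 0" "s' i + t = s i" "r - s i = - t" using False by (auto simp: t_def s'_def)
  have s'0: "s' j \<ge> 0" for j using s by (simp add: s'_def)
  have e: "s'(i := s' i + t) = s" using t by (auto simp: s'_def)
  have 1: "\<bar>gexp I s F - gexp I s' F - t / 2 * gexp I s' (D i)\<bar> \<le> 2 * t * sqrt t"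
    using gexp_deriv_up[of i s' t, OF i s'0 t(1)] e by simp
  have 2: "\<bar>gexp I s' (D i) - gexp I s (D i)\<bar> \<le> 6 * sqrt t"
    using gexp_lipschitz_step[of I i 6 "D i" s r, OF I i lipschitz_D[OF i] s] t by (simp add: s'_def)
  have "\<bar>t / 2 * gexp I s' (D i) - t / 2 * gexp I s (D i)\<bar> = t / 2 * \<bar>gexp I s' (D i) - gexp I s (D i)\<bar>"
    using t(1) by (subst right_diff_distrib[symmetric]) (simp add: abs_mult)
  also have "\<dots> \<le> t / 2 * (6 * sqrt t)" using 2 t by (intro mult_left_mono) auto
  finally have "\<bar>t / 2 * gexp I s' (D i) - t / 2 * gexp I s (D i)\<bar> \<le> 3 * t * sqrt t" by simp
  with 1 have "\<bar>gexp I s' F - gexp I s F + t / 2 * gexp I s (D i)\<bar> \<le> 5 * t * sqrt t" by (simp add: mult.assoc)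
  then show ?thesis using t unfolding t(3) s'_def[symmetric] by simp
qed

text \<open>Changing the coordinates in \<open>J\<close> one after the other, every Gibbs variance is moved
  back to the common starting point. The total error is of order \<open>\<eta>\<close> to the power \<open>3 / 2\<close>, smaller
  than the increment.\<close>

lemma gexp_deriv:
  assumes s: "\<And>j. s j \<ge> 0" "\<And>j. s' j \<ge> 0" "\<And>j. \<bar>s' j - s j\<bar> \<le> \<eta>" and J: "finite J" "J \<subseteq> I"
  shows "\<bar>gexp I (\<lambda>j. if j \<in> J then s' j else s j) F - gexp I s F - (\<Sum>i\<in>J. (s' i - s i) / 2 * gexp I s (D i))\<bar>
     \<le> card J * ((5 + 3 * card I) * (\<eta> * sqrt \<eta>))"
  using J
proof (induction J rule: finite_induct)
  case (insert i J)
  define sJ where "sJ = (\<lambda>j. if j \<in> J then s' j else s j)"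
  have i: "i \<in> I" using insert by simp
  have e: "(\<lambda>j. if j \<in> insert i J then s' j else s j) = sJ(i := s' i)" by (auto simp: sJ_def)
  have sJ: "sJ i = s i" "sJ j \<ge> 0" for j using insert s by (auto simp: sJ_def)
  have \<eta>: "\<eta> \<ge> 0" using s(3)[of i] by linarith
  have d: "\<bar>s' i - s i\<bar> \<le> \<eta>" by (rule s)
  have dd: "\<bar>s' i - s i\<bar> * sqrt \<bar>s' i - s i\<bar> \<le> \<eta> * sqrt \<eta>" using d \<eta> by (intro mult_mono) auto
  have 1: "\<bar>gexp I (sJ(i := s' i)) F - gexp I sJ F - (s' i - s i) / 2 * gexp I sJ (D i)\<bar> \<le> 5 * (\<eta> * sqrt \<eta>)"
    using gexp_deriv_step[OF i, of sJ "s' i"] sJ s(2) dd by (simp add: mult.assoc)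
  have 2: "\<bar>gexp I sJ (D i) - gexp I s (D i)\<bar> \<le> card I * (6 * sqrt \<eta>)"
  proof -
    have "\<bar>gexp I sJ (D i) - gexp I s (D i)\<bar> \<le> card J * (6 * sqrt \<eta>)"
      unfolding sJ_def using insert by (intro gexp_lipschitz[OF I lipschitz_D[OF i] s]) auto
    also have "\<dots> \<le> card I * (6 * sqrt \<eta>)"
      using insert I \<eta> by (intro mult_right_mono of_nat_mono card_mono) auto
    finally show ?thesis .
  qed
  have "\<bar>(s' i - s i) / 2 * gexp I sJ (D i) - (s' i - s i) / 2 * gexp I s (D i)\<bar> = \<bar>s' i - s i\<bar> / 2 * \<bar>gexp I sJ (D i) - gexp I s (D i)\<bar>"
    by (subst right_diff_distrib[symmetric]) (simp add: abs_mult)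
  also have "\<dots> \<le> \<eta> / 2 * (card I * (6 * sqrt \<eta>))" using 2 d \<eta> by (intro mult_mono) auto
  finally have 3: "\<bar>(s' i - s i) / 2 * gexp I sJ (D i) - (s' i - s i) / 2 * gexp I s (D i)\<bar> \<le> 3 * card I * (\<eta> * sqrt \<eta>)" by (simp add: mult_ac)
  have IH: "\<bar>gexp I sJ F - gexp I s F - (\<Sum>i\<in>J. (s' i - s i) / 2 * gexp I s (D i))\<bar>
     \<le> card J * ((5 + 3 * card I) * (\<eta> * sqrt \<eta>))" using insert by (simp add: sJ_def)
  have "card (insert i J) * ((5 + 3 * card I) * (\<eta> * sqrt \<eta>)) = card J * ((5 + 3 * card I) * (\<eta> * sqrt \<eta>)) + 5 * (\<eta> * sqrt \<eta>) + 3 * card I * (\<eta> * sqrt \<eta>)"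
    using insert by (simp add: algebra_simps)
  moreover have "(\<Sum>j\<in>insert i J. (s' j - s j) / 2 * gexp I s (D j)) = (s' i - s i) / 2 * gexp I s (D i) + (\<Sum>j\<in>J. (s' j - s j) / 2 * gexp I s (D j))"
    using insert by simp
  ultimately show ?case unfolding e using 1 3 IH by linarith
qed simp

text \<open>Along the segment from \<open>s0\<close> to \<open>s1\<close> the derivative is half the mean of the sum in
  the hypothesis, hence nonnegative. Cutting the segment into \<open>n\<close> steps, the errors of order
  \<open>n\<close> to the power \<open>- 3 / 2\<close> sum up to something that vanishes.\<close>

theorem variance_comparison:
  assumes s: "\<And>j. s0 j \<ge> 0" "\<And>j. s1 j \<ge> 0"
    and pos: "\<And>x. (\<Sum>i\<in>I. (s1 i - s0 i) * D i x) \<ge> 0"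
  shows "gexp I s0 F \<le> gexp I s1 F"
proof -
  define st where "st t j = (if j \<in> I then s0 j + t * (s1 j - s0 j) else 0)" for t :: real and j
  define R where "R = (\<Sum>j\<in>I. \<bar>s1 j - s0 j\<bar>)"
  have R: "R \<ge> 0" "j \<in> I \<Longrightarrow> \<bar>s1 j - s0 j\<bar> \<le> R" for j
    using I by (auto simp: R_def intro!: sum_nonneg member_le_sum[of j I "\<lambda>j. \<bar>s1 j - s0 j\<bar>"])
  have st0: "st t j \<ge> 0" if "0 \<le> t" "t \<le> 1" for t j
  proof -
    have "st t j = (if j \<in> I then (1 - t) * s0 j + t * s1 j else 0)" by (simp add: st_def algebra_simps)
    then show ?thesis using that s by simp
  qed
  define K where "K = card I * ((5 + 3 * card I) * (R * sqrt R))"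
  have step: "gexp I (st (t + h)) F - gexp I (st t) F \<ge> - (K * (h * sqrt h))" if th: "0 \<le> t" "0 \<le> h" "t + h \<le> 1" for t h
  proof -
    have Q: "(\<Sum>i\<in>I. (st (t + h) i - st t i) / 2 * gexp I (st t) (D i)) \<ge> 0"
    proof -
      have lt: "light (gauss (st t i))" for i using st0[of t i] th by (intro light_gauss) auto
      have int: "integrable (PiM I (\<lambda>i. gauss (st t i))) (D i)" if "i \<in> I" for i
        by (rule coord_lipschitz_integrable[OF I lt lipschitz_D[OF that]])
      have "(\<Sum>i\<in>I. (st (t + h) i - st t i) / 2 * gexp I (st t) (D i)) = (\<Sum>i\<in>I. h / 2 * (s1 i - s0 i) * gexp I (st t) (D i))"
        by (intro sum.cong) (auto simp: st_def algebra_simps)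
      also have "\<dots> = h / 2 * (\<integral>x. (\<Sum>i\<in>I. (s1 i - s0 i) * D i x) \<partial>PiM I (\<lambda>i. gauss (st t i)))"
        unfolding gexp_def using int by (subst Bochner_Integration.integral_sum) (auto simp: sum_distrib_left mult.assoc)
      also have "\<dots> \<ge> 0" using pos th by (intro mult_nonneg_nonneg integral_nonneg) auto
      finally show ?thesis .
    qed
    have A: "\<bar>gexp I (\<lambda>j. if j \<in> I then st (t + h) j else st t j) F - gexp I (st t) F - (\<Sum>i\<in>I. (st (t + h) i - st t i) / 2 * gexp I (st t) (D i))\<bar>
       \<le> card I * ((5 + 3 * card I) * ((h * R) * sqrt (h * R)))"
    proof (rule gexp_deriv[OF _ _ _ I subset_refl])
      show "\<bar>st (t + h) j - st t j\<bar> \<le> h * R" for j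
      proof (cases "j \<in> I")
        case True
        have "st (t + h) j - st t j = h * (s1 j - s0 j)" using True by (simp add: st_def algebra_simps)
        then show ?thesis using R(2)[OF True] th by (simp add: abs_mult mult_left_mono)
      qed (use R th in \<open>simp add: st_def\<close>)
    qed (use st0 th in auto)
    have E1: "(\<lambda>j. if j \<in> I then st (t + h) j else st t j) = st (t + h)" by (auto simp: st_def)
    have E2: "card I * ((5 + 3 * card I) * ((h * R) * sqrt (h * R))) = K * (h * sqrt h)"
      by (simp add: K_def real_sqrt_mult)
    show ?thesis using A[unfolded E1 E2] Q by linarith
  qed
  have N: "gexp I (st 1) F - gexp I (st 0) F \<ge> - K / sqrt (Suc N)" for N
  proof -
    define n where "n = Suc N"
    have n: "n > 0" by (simp add: n_def)
    have "(\<Sum>k<n. gexp I (st (Suc k / n)) F - gexp I (st (k / n)) F) = gexp I (st (n / n)) F - gexp I (st (0 / n)) F"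
      using sum_lessThan_telescope[of "\<lambda>k. gexp I (st (k / n)) F" n] by simp
    moreover have "(\<Sum>k<n. gexp I (st (Suc k / n)) F - gexp I (st (k / n)) F) \<ge> (\<Sum>k<n. - (K * (1 / n * sqrt (1 / n))))"
    proof (rule sum_mono)
      fix k assume k: "k \<in> {..<n}"
      have "real k / n + 1 / n = Suc k / n" by (simp add: add_divide_distrib)
      moreover have "Suc k / real n \<le> 1" using k by simp
      ultimately show "- (K * (1 / n * sqrt (1 / n))) \<le> gexp I (st (Suc k / n)) F - gexp I (st (k / n)) F"
        using step[of "k / n" "1 / n"] by simp
    qed
    moreover have "(\<Sum>k<n. - (K * (1 / n * sqrt (1 / n)))) = - K / sqrt n"
      using n by (simp add: real_sqrt_divide)
    ultimately show ?thesis using n by (simp add: n_def)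
  qed
  have "(\<lambda>N. - K / sqrt (real (Suc N))) \<longlonglongrightarrow> 0" by real_asymp
  then have "0 \<le> gexp I (st 1) F - gexp I (st 0) F"
    using N by (intro LIMSEQ_le_const2) auto
  moreover have "gexp I (st 1) F = gexp I s1 F" "gexp I (st 0) F = gexp I s0 F"
    by (auto intro!: gexp_cong simp: st_def)
  ultimately show ?thesis by simp
qed

end

section \<open>Spin configurations and pairs of vertices\<close>

text \<open>Edges of the complete graph. Quadratic forms in the spins are sums over this set, which,
  unlike ordered pairs, can be relabelled by any injection of the vertices.\<close>

definition pairs :: "'v set \<Rightarrow> 'v set set" where
  "pairs V = {e. e \<subseteq> V \<and> card e = 2}"

lemma finite_pairs: "finite V \<Longrightarrow> finite (pairs V)" by (auto simp: pairs_def)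

lemma pairs_insert:
  assumes "v \<notin> V"
  shows "pairs (insert v V) = pairs V \<union> (\<lambda>i. {v, i}) ` V"
proof -
  have "e \<in> (\<lambda>i. {v, i}) ` V" if e: "e \<subseteq> insert v V" "card e = 2" "\<not> e \<subseteq> V" for e
  proof -
    obtain x y where xy: "e = {x, y}" "x \<noteq> y" using e by (auto simp: card_2_iff)
    have "v \<in> e" using e by auto
    then show ?thesis using xy e by auto
  qed
  note split = this
  show ?thesis
  proof (intro equalityI subsetI)
    fix e assume "e \<in> pairs (insert v V)"
    then show "e \<in> pairs V \<union> (\<lambda>i. {v, i}) ` V" using split[of e] by (auto simp: pairs_def)
  next
    fix e assume "e \<in> pairs V \<union> (\<lambda>i. {v, i}) ` V"
    then show "e \<in> pairs (insert v V)"
    proof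
      assume "e \<in> (\<lambda>i. {v, i}) ` V"
      then obtain i where i: "i \<in> V" "e = {v, i}" by blast
      then have "v \<noteq> i" using assms by auto
      with i show ?thesis by (simp add: pairs_def)
    qed (auto simp: pairs_def)
  qed
qed

lemma sum_pairs_insert:
  assumes "finite V" "v \<notin> V"
  shows "(\<Sum>e\<in>pairs (insert v V). f e) = (\<Sum>e\<in>pairs V. f e) + (\<Sum>i\<in>V. f {v, i})"
proof -
  have "inj_on (\<lambda>i. {v, i}) V" using assms by (auto simp: inj_on_def doubleton_eq_iff)
  moreover have "pairs V \<inter> (\<lambda>i. {v, i}) ` V = {}" using assms by (auto simp: pairs_def)
  ultimately show ?thesis
    using assms by (simp add: pairs_insert sum.union_disjoint finite_pairs sum.reindex comp_def)
qed

lemma sum_pairs_prod: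
  fixes r :: "'v \<Rightarrow> real"
  assumes "finite V"
  shows "(\<Sum>e\<in>pairs V. \<Prod>i\<in>e. r i) = ((\<Sum>i\<in>V. r i)\<^sup>2 - (\<Sum>i\<in>V. (r i)\<^sup>2)) / 2"
  using assms
proof (induction V rule: finite_induct)
  case empty
  have "pairs ({} :: 'v set) = {}" by (auto simp: pairs_def)
  then show ?case by simp
next
  case (insert v V)
  have "(\<Sum>i\<in>V. \<Prod>j\<in>{v, i}. r j) = r v * (\<Sum>i\<in>V. r i)"
    unfolding sum_distrib_left
  proof (rule sum.cong)
    fix i assume "i \<in> V"
    then have "v \<noteq> i" using insert.hyps by auto
    then show "(\<Prod>j\<in>{v, i}. r j) = r v * r i" by simp
  qed simp
  then show ?case using insert
    by (simp add: sum_pairs_insert power2_eq_square field_simps)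
qed

lemma card_pairs: "finite V \<Longrightarrow> real (card (pairs V)) = (real (card V) * (real (card V) - 1)) / 2"
  using sum_pairs_prod[of V "\<lambda>_. 1"] by (simp add: power2_eq_square algebra_simps)

lemma sum_pairs_one_minus:
  fixes r :: "'v \<Rightarrow> real"
  assumes "finite V" "\<And>i. i \<in> V \<Longrightarrow> r i \<in> {-1, 1}"
  shows "(\<Sum>e\<in>pairs V. 1 - (\<Prod>i\<in>e. r i)) = ((card V)\<^sup>2 - (\<Sum>i\<in>V. r i)\<^sup>2) / 2"
proof -
  have "(\<Sum>i\<in>V. (r i)\<^sup>2) = (\<Sum>i\<in>V. 1)" using assms(2) by (intro sum.cong refl) fastforce
  then show ?thesis using assms(1)
    by (simp add: sum_subtractf sum_pairs_prod card_pairs power2_eq_square field_simps)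
qed

text \<open>Configurations are lists, so that placing two systems side by side is concatenation.\<close>

definition spin_lists :: "nat \<Rightarrow> real list set" where
  "spin_lists n = {l. length l = n \<and> set l \<subseteq> {-1, 1}}"

definition spin_prod :: "nat set \<Rightarrow> real list \<Rightarrow> real" where
  "spin_prod e l = (\<Prod>i\<in>e. l ! i)"

lemma finite_spin_lists: "finite (spin_lists n)"
  using finite_lists_length_eq[of "{-1, 1 :: real}" n] by (simp add: spin_lists_def conj_commute)

lemma card_spin_lists: "card (spin_lists n) = 2 ^ n"
  using card_lists_length_eq[of "{-1, 1 :: real}" n] by (simp add: spin_lists_def conj_commute numeral_2_eq_2)

lemma spin_listsD: "l \<in> spin_lists n \<Longrightarrow> length l = n" "l \<in> spin_lists n \<Longrightarrow> i < n \<Longrightarrow> l ! i \<in> {-1, 1}"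
  unfolding spin_lists_def by (blast, metis (mono_tags, lifting) mem_Collect_eq nth_mem subsetD)

lemma prod_sign: "(\<And>i. i \<in> e \<Longrightarrow> (f i :: real) \<in> {-1, 1}) \<Longrightarrow> (\<Prod>i\<in>e. f i) \<in> {-1, 1}"
proof (induction e rule: infinite_finite_induct)
  case (insert x e)
  then have "prod f e \<in> {-1, 1}" "f x \<in> {-1, 1}" by blast+
  then show ?case using insert.hyps by auto
qed simp_all

lemma spin_prod_sign: "l \<in> spin_lists n \<Longrightarrow> e \<in> pairs {..<n} \<Longrightarrow> spin_prod e l \<in> {-1, 1}"
  unfolding spin_prod_def by (rule prod_sign, rule spin_listsD(2)) (auto simp: pairs_def)

abbreviation log_Z :: "nat \<Rightarrow> real list set \<Rightarrow> (real list \<Rightarrow> real) \<Rightarrow> (nat set \<Rightarrow> real) \<Rightarrow> real" where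
  "log_Z n T u \<equiv> log_partition (pairs {..<n}) T u spin_prod"

lemma finite_gibbs_spin:
  assumes "T \<subseteq> spin_lists n" "T \<noteq> {}"
  shows "finite_gibbs (pairs {..<n}) T spin_prod"
proof
  show "finite (pairs {..<n})" by (simp add: finite_pairs)
  show "finite T" using assms finite_spin_lists finite_subset by blast
  show "T \<noteq> {}" by fact
  show "\<bar>spin_prod e l\<bar> \<le> 1" if "e \<in> pairs {..<n}" "l \<in> T" for e l
  proof -
    have "l \<in> spin_lists n" using that assms by blast
    from spin_prod_sign[OF this that(1)] show ?thesis by auto
  qed
qed

section \<open>Superadditivity of the spin glass free energy\<close>

lemma log_partition_cong: "(\<And>i. i \<in> I \<Longrightarrow> x i = y i) \<Longrightarrow> log_partition I T u a x = log_partition I T u a y"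
  unfolding log_partition_def gibbs_weight_def by (metis (mono_tags, lifting) sum.cong)

text \<open>For signs, the Gibbs variance of \<open>a i\<close> is the mean of \<open>1 - a i c * a i c'\<close> over two
  independent replicas \<open>c\<close>, \<open>c'\<close> drawn from the Gibbs weights. A linear combination of Gibbs variances is therefore
  nonnegative as soon as it is so for each pair of replicas.\<close>

lemma (in finite_gibbs) replica_positivity:
  assumes sq: "\<And>i c. i \<in> I \<Longrightarrow> c \<in> T \<Longrightarrow> (a i c)\<^sup>2 = 1"
    and pos: "\<And>c c'. c \<in> T \<Longrightarrow> c' \<in> T \<Longrightarrow> (\<Sum>i\<in>I. \<delta> i * (1 - a i c * a i c')) \<ge> 0"
  shows "(\<Sum>i\<in>I. \<delta> i * D i x) \<ge> 0"
proof -
  define Z where "Z = (\<Sum>c\<in>T. W x c)"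
  have Z: "Z > 0" unfolding Z_def using T by (intro sum_pos weight_pos) auto
  have D: "Z\<^sup>2 * D i x = (\<Sum>c\<in>T. \<Sum>c'\<in>T. W x c * W x c' * (1 - a i c * a i c'))" if i: "i \<in> I" for i
  proof -
    have "(\<Sum>c\<in>T. W x c * (a i c * a i c)) = Z" unfolding Z_def
      using sq[OF i] by (intro sum.cong) (auto simp: power2_eq_square)
    then have "D i x = 1 - ((\<Sum>c\<in>T. W x c * a i c) / Z)\<^sup>2"
      using Z by (simp add: gibbs_var_def wcov_def wavg_def Z_def[symmetric] power2_eq_square)
    then have "Z\<^sup>2 * D i x = Z * Z - (\<Sum>c\<in>T. W x c * a i c) * (\<Sum>c\<in>T. W x c * a i c)"
      using Z by (simp add: power_divide right_diff_distrib power2_eq_square)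
    also have "\<dots> = (\<Sum>c\<in>T. \<Sum>c'\<in>T. W x c * W x c' - (W x c * a i c) * (W x c' * a i c'))"
      by (simp add: Z_def sum_product sum_subtractf)
    also have "\<dots> = (\<Sum>c\<in>T. \<Sum>c'\<in>T. W x c * W x c' * (1 - a i c * a i c'))"
      by (intro sum.cong refl) (simp add: algebra_simps)
    finally show ?thesis .
  qed
  have "Z\<^sup>2 * (\<Sum>i\<in>I. \<delta> i * D i x) = (\<Sum>i\<in>I. \<delta> i * (Z\<^sup>2 * D i x))"
    by (simp add: sum_distrib_left mult_ac)
  also have "\<dots> = (\<Sum>i\<in>I. \<Sum>c\<in>T. \<Sum>c'\<in>T. W x c * W x c' * (\<delta> i * (1 - a i c * a i c')))"
    using D by (intro sum.cong) (simp_all add: sum_distrib_left mult_ac)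
  also have "\<dots> = (\<Sum>c\<in>T. \<Sum>i\<in>I. \<Sum>c'\<in>T. W x c * W x c' * (\<delta> i * (1 - a i c * a i c')))"
    by (rule sum.swap)
  also have "\<dots> = (\<Sum>c\<in>T. \<Sum>c'\<in>T. \<Sum>i\<in>I. W x c * W x c' * (\<delta> i * (1 - a i c * a i c')))"
    by (intro sum.cong refl sum.swap)
  also have "\<dots> = (\<Sum>c\<in>T. \<Sum>c'\<in>T. W x c * W x c' * (\<Sum>i\<in>I. \<delta> i * (1 - a i c * a i c')))"
    by (simp add: sum_distrib_left)
  also have "\<dots> \<ge> 0"
    by (intro sum_nonneg mult_nonneg_nonneg pos) (auto simp: gibbs_weight_def)
  finally show ?thesis using Z by (simp add: zero_le_mult_iff)
qed

definition joins :: "'b list set \<Rightarrow> 'b list set \<Rightarrow> 'b list set" where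
  "joins T1 T2 = (\<lambda>(l, m). l @ m) ` (T1 \<times> T2)"

lemma joins_spin_lists: "T1 \<subseteq> spin_lists n1 \<Longrightarrow> T2 \<subseteq> spin_lists n2 \<Longrightarrow> joins T1 T2 \<subseteq> spin_lists (n1 + n2)"
  by (fastforce simp: joins_def spin_lists_def)

text \<open>The mean log-partition function of a Sherrington-Kirkpatrick model on \<open>n\<close> vertices with
  configurations \<open>T\<close> and weights \<open>exp (u l)\<close>. The inverse temperature is part of the coupling
  variance \<open>\<kappa> / n\<close>.\<close>

definition sk :: "real \<Rightarrow> nat \<Rightarrow> real list set \<Rightarrow> (real list \<Rightarrow> real) \<Rightarrow> real" where
  "sk \<kappa> n T u = gexp (pairs {..<n}) (\<lambda>_. \<kappa> / n) (log_Z n T u)"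

lemma overlap_convexity:
  fixes R1 R2 :: real and n1 n2 :: nat
  assumes "n1 > 0" "n2 > 0"
  shows "(R1 + R2)\<^sup>2 / (n1 + n2) \<le> R1\<^sup>2 / n1 + R2\<^sup>2 / n2"
proof -
  have "(real n1 * n2) * (R1 + R2)\<^sup>2 \<le> (n1 + n2) * (n2 * R1\<^sup>2 + n1 * R2\<^sup>2)"
    using zero_le_power2[of "n2 * R1 - n1 * R2"] by (simp add: power2_eq_square algebra_simps)
  then have "(R1 + R2)\<^sup>2 / (n1 + n2) \<le> (n2 * R1\<^sup>2 + n1 * R2\<^sup>2) / (real n1 * n2)"
    using assms by (subst frac_le_eq[THEN iffD2]) (auto simp: divide_le_0_iff field_simps)
  also have "\<dots> = R1\<^sup>2 / n1 + R2\<^sup>2 / n2" using assms by (simp add: field_simps)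
  finally show ?thesis .
qed

lemma pairs_mono: "A \<subseteq> B \<Longrightarrow> pairs A \<subseteq> pairs B" by (auto simp: pairs_def)

lemma pairs_disjoint: "A \<inter> B = {} \<Longrightarrow> pairs A \<inter> pairs B = {}"
  by (auto simp: pairs_def) (metis Int_absorb1 card.empty inf.orderE inf_bot_right inf_left_commute zero_neq_numeral)

lemma pairs_shift: "pairs {n1..<n1 + n2} = image ((+) n1) ` pairs {..<n2 :: nat}"
proof -
  have "{n1..<n1 + n2} = (+) n1 ` {..<n2}" by (simp add: atLeast0LessThan[symmetric] add.commute)
  then show ?thesis unfolding pairs_def
    by (auto simp: subset_image_iff card_image image_iff)
qed

lemma spin_prod_append_left:
  "e \<subseteq> {..<length l} \<Longrightarrow> spin_prod e (l @ m) = spin_prod e l"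
  unfolding spin_prod_def by (intro prod.cong) (auto simp: nth_append)

lemma spin_prod_append_right: "spin_prod ((+) (length l) ` e) (l @ m) = spin_prod e m"
  unfolding spin_prod_def by (subst prod.reindex) (auto simp: nth_append)

text \<open>Without couplings between the two blocks the partition function factorizes.\<close>

lemma log_Z_joins:
  assumes T: "T1 \<subseteq> spin_lists n1" "T2 \<subseteq> spin_lists n2" "T1 \<noteq> {}" "T2 \<noteq> {}"
    and u: "\<And>l m. l \<in> T1 \<Longrightarrow> m \<in> T2 \<Longrightarrow> u (l @ m) = u1 l + u2 m"
    and x: "\<And>e. e \<in> pairs {..<n1 + n2} - pairs {..<n1} - pairs {n1..<n1 + n2} \<Longrightarrow> x e = 0"
  shows "log_Z (n1 + n2) (joins T1 T2) u x = log_Z n1 T1 u1 x + log_Z n2 T2 u2 (\<lambda>e. x ((+) n1 ` e))"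
proof -
  interpret A: finite_gibbs "pairs {..<n1}" T1 u1 spin_prod by (rule finite_gibbs_spin) fact+
  interpret B: finite_gibbs "pairs {..<n2}" T2 u2 spin_prod by (rule finite_gibbs_spin) fact+
  have len: "l \<in> T1 \<Longrightarrow> length l = n1" for l using T spin_listsD by blast
  have inj: "inj_on (\<lambda>(l, m). l @ m) (T1 \<times> T2)" by (auto simp: inj_on_def len)
  have w: "gibbs_weight (pairs {..<n1 + n2}) u spin_prod x (l @ m)
     = gibbs_weight (pairs {..<n1}) u1 spin_prod x l * gibbs_weight (pairs {..<n2}) u2 spin_prod (\<lambda>e. x ((+) n1 ` e)) m"
    if lm: "l \<in> T1" "m \<in> T2" for l m
  proof -
    let ?P1 = "pairs {..<n1}" and ?P2 = "pairs {n1..<n1 + n2}"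
    have "(\<Sum>e\<in>pairs {..<n1 + n2}. x e * spin_prod e (l @ m)) = (\<Sum>e\<in>?P1 \<union> ?P2. x e * spin_prod e (l @ m))"
    proof (rule sum.mono_neutral_right)
      show "?P1 \<union> ?P2 \<subseteq> pairs {..<n1 + n2}" by (intro Un_least pairs_mono) auto
    qed (use x in \<open>auto simp: finite_pairs\<close>)
    also have "\<dots> = (\<Sum>e\<in>?P1. x e * spin_prod e (l @ m)) + (\<Sum>e\<in>?P2. x e * spin_prod e (l @ m))"
      by (intro sum.union_disjoint pairs_disjoint finite_pairs) auto
    also have "(\<Sum>e\<in>?P1. x e * spin_prod e (l @ m)) = (\<Sum>e\<in>?P1. x e * spin_prod e l)"
      by (intro sum.cong refl, subst spin_prod_append_left) (auto simp: pairs_def len[OF lm(1)])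
    also have "(\<Sum>e\<in>?P2. x e * spin_prod e (l @ m)) = (\<Sum>e\<in>pairs {..<n2}. x ((+) n1 ` e) * spin_prod e m)"
    proof -
      have "inj_on (image ((+) n1)) (pairs {..<n2})" by (rule inj_on_image) simp
      moreover have "spin_prod ((+) n1 ` e) (l @ m) = spin_prod e m" for e
        using spin_prod_append_right[of l e m] len[OF lm(1)] by simp
      ultimately show ?thesis unfolding pairs_shift by (simp add: sum.reindex)
    qed
    finally show ?thesis using u[OF lm] by (simp add: gibbs_weight_def exp_add[symmetric])
  qed
  have "(\<Sum>c\<in>joins T1 T2. gibbs_weight (pairs {..<n1 + n2}) u spin_prod x c)
    = (\<Sum>(l, m)\<in>T1 \<times> T2. gibbs_weight (pairs {..<n1}) u1 spin_prod x l * gibbs_weight (pairs {..<n2}) u2 spin_prod (\<lambda>e. x ((+) n1 ` e)) m)"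
    unfolding joins_def using w by (subst sum.reindex[OF inj]) (auto intro!: sum.cong)
  also have "\<dots> = (\<Sum>l\<in>T1. gibbs_weight (pairs {..<n1}) u1 spin_prod x l) * (\<Sum>m\<in>T2. gibbs_weight (pairs {..<n2}) u2 spin_prod (\<lambda>e. x ((+) n1 ` e)) m)"
    by (simp add: sum_product sum.cartesian_product)
  finally show ?thesis unfolding log_partition_def
    using A.T B.T by (simp add: ln_mult_pos sum_pos A.weight_pos B.weight_pos)
qed

text \<open>Compare the full system with two decoupled blocks. For two replicas with overlaps \<open>R1\<close>, \<open>R2\<close> in the
  blocks, the sum over all pairs of \<open>1 - r i * r j\<close> only depends on the overlap, and the
  condition for the variance comparison becomes
  \<open>(R1 + R2)\<^sup>2 / (n1 + n2) \<le> R1\<^sup>2 / n1 + R2\<^sup>2 / n2\<close>, the convexity of the square.\<close>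

theorem guerra_toninelli:
  assumes \<kappa>: "\<kappa> \<ge> 0" and n: "n1 > 0" "n2 > 0"
    and T: "T1 \<subseteq> spin_lists n1" "T2 \<subseteq> spin_lists n2" "T1 \<noteq> {}" "T2 \<noteq> {}"
    and u: "\<And>l m. l \<in> T1 \<Longrightarrow> m \<in> T2 \<Longrightarrow> u (l @ m) = u1 l + u2 m"
  shows "sk \<kappa> n1 T1 u1 + sk \<kappa> n2 T2 u2 \<le> sk \<kappa> (n1 + n2) (joins T1 T2) u"
proof -
  let ?n = "n1 + n2" and ?P1 = "pairs {..<n1}" and ?P2 = "pairs {n1..<n1 + n2}"
  let ?P = "pairs {..<n1 + n2}"
  have J: "joins T1 T2 \<subseteq> spin_lists ?n" "joins T1 T2 \<noteq> {}"
    using T joins_spin_lists by (auto simp: joins_def)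
  interpret G: finite_gibbs ?P "joins T1 T2" u spin_prod by (rule finite_gibbs_spin) fact+
  interpret A: finite_gibbs ?P1 T1 u1 spin_prod by (rule finite_gibbs_spin) fact+
  interpret B: finite_gibbs "pairs {..<n2}" T2 u2 spin_prod by (rule finite_gibbs_spin) fact+
  define s0 where "s0 e = (if e \<in> ?P1 then \<kappa> / n1 else if e \<in> ?P2 then \<kappa> / n2 else 0)" for e
  have P12: "?P1 \<inter> ?P2 = {}" by (rule pairs_disjoint) auto
  have sub: "?P1 \<subseteq> ?P" "?P2 \<subseteq> ?P" by (intro pairs_mono; auto)+
  have s0: "s0 e \<ge> 0" for e using \<kappa> by (simp add: s0_def)
  have sum_s0: "(\<Sum>e\<in>?P. s0 e * f e) = \<kappa> / n1 * (\<Sum>e\<in>?P1. f e) + \<kappa> / n2 * (\<Sum>e\<in>?P2. f e)" for f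
  proof -
    have "(\<Sum>e\<in>?P. s0 e * f e) = (\<Sum>e\<in>?P1 \<union> ?P2. s0 e * f e)"
      using sub by (intro sum.mono_neutral_right) (auto simp: finite_pairs s0_def)
    also have "\<dots> = (\<Sum>e\<in>?P1. s0 e * f e) + (\<Sum>e\<in>?P2. s0 e * f e)"
      using P12 by (intro sum.union_disjoint) (auto simp: finite_pairs)
    also have "(\<Sum>e\<in>?P1. s0 e * f e) = \<kappa> / n1 * (\<Sum>e\<in>?P1. f e)"
      by (simp add: sum_distrib_left s0_def)
    also have "(\<Sum>e\<in>?P2. s0 e * f e) = \<kappa> / n2 * (\<Sum>e\<in>?P2. f e)"
      unfolding sum_distrib_left using P12 by (intro sum.cong) (auto simp: s0_def)
    finally show ?thesis .
  qed
  \<comment> \<open>Decoupling the two blocks lowers the expectation.\<close>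
  have "gexp ?P s0 (log_Z ?n (joins T1 T2) u) \<le> gexp ?P (\<lambda>_. \<kappa> / ?n) (log_Z ?n (joins T1 T2) u)"
  proof (rule G.variance_comparison[OF s0])
    show "0 \<le> \<kappa> / ?n" using \<kappa> by simp
    fix x
    show "0 \<le> (\<Sum>e\<in>?P. (\<kappa> / ?n - s0 e) * gibbs_var ?P (joins T1 T2) u spin_prod e x)"
    proof (rule G.replica_positivity)
      fix e c assume "e \<in> ?P" "c \<in> joins T1 T2"
      then have "spin_prod e c \<in> {-1, 1}" using J spin_prod_sign by blast
      then show "(spin_prod e c)\<^sup>2 = 1" by auto
    next
      fix c c' assume c: "c \<in> joins T1 T2" "c' \<in> joins T1 T2"
      define r where "r i = c ! i * c' ! i" for i
      have r: "r i \<in> {-1, 1}" if "i < ?n" for i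
      proof -
        have "c ! i \<in> {-1, 1}" "c' ! i \<in> {-1, 1}" using c J that spin_listsD(2) by blast+
        then show ?thesis by (auto simp: r_def)
      qed
      have pr: "1 - spin_prod e c * spin_prod e c' = 1 - (\<Prod>i\<in>e. r i)" for e
        by (simp add: spin_prod_def r_def prod.distrib)
      have lin: "(\<Sum>e\<in>?P. (k - s0 e) * f e) = k * (\<Sum>e\<in>?P. f e) - (\<Sum>e\<in>?P. s0 e * f e)" for k and f :: "nat set \<Rightarrow> real"
        by (simp add: left_diff_distrib sum_subtractf sum_distrib_left)
      define R1 where "R1 = (\<Sum>i<n1. r i)"
      define R2 where "R2 = (\<Sum>i\<in>{n1..<?n}. r i)"
      have R: "(\<Sum>i<?n. r i) = R1 + R2"
      proof -
        have "{..<?n} = {..<n1} \<union> {n1..<?n}" by auto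
        then show ?thesis unfolding R1_def R2_def by (simp add: sum.union_disjoint ivl_disj_int)
      qed
      have S: "(\<Sum>e\<in>?P. 1 - (\<Prod>i\<in>e. r i)) = ((real ?n)\<^sup>2 - (R1 + R2)\<^sup>2) / 2"
        using sum_pairs_one_minus[of "{..<?n}" r] r R by simp
      have S1: "(\<Sum>e\<in>?P1. 1 - (\<Prod>i\<in>e. r i)) = ((real n1)\<^sup>2 - R1\<^sup>2) / 2"
        using sum_pairs_one_minus[of "{..<n1}" r] r by (simp add: R1_def)
      have S2: "(\<Sum>e\<in>?P2. 1 - (\<Prod>i\<in>e. r i)) = ((real n2)\<^sup>2 - R2\<^sup>2) / 2"
        using sum_pairs_one_minus[of "{n1..<?n}" r] r by (simp add: R2_def)
      have "(\<Sum>e\<in>?P. (\<kappa> / ?n - s0 e) * (1 - (\<Prod>i\<in>e. r i)))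
        = \<kappa> / ?n * (\<Sum>e\<in>?P. 1 - (\<Prod>i\<in>e. r i)) - (\<Sum>e\<in>?P. s0 e * (1 - (\<Prod>i\<in>e. r i)))"
        by (rule lin)
      also have "\<dots> = \<kappa> / 2 * (R1\<^sup>2 / n1 + R2\<^sup>2 / n2 - (R1 + R2)\<^sup>2 / ?n)"
      proof -
        have d: "\<kappa> / real m * (((real m)\<^sup>2 - t) / 2) = \<kappa> / 2 * (real m - t / m)" if "m > 0" for m :: nat and t
          using that by (simp add: field_simps power2_eq_square)
        have nn: "?n > 0" using n by simp
        show ?thesis unfolding sum_s0 S S1 S2 d[OF n(1)] d[OF n(2)] d[OF nn] by (simp add: algebra_simps)
      qed
      also have "\<dots> \<ge> 0" using overlap_convexity[OF n, of R1 R2] \<kappa> by simp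
      finally show "0 \<le> (\<Sum>e\<in>?P. (\<kappa> / ?n - s0 e) * (1 - spin_prod e c * spin_prod e c'))"
        unfolding pr .
    qed
  qed
  moreover have "gexp ?P s0 (log_Z ?n (joins T1 T2) u) = sk \<kappa> n1 T1 u1 + sk \<kappa> n2 T2 u2"
  proof -
    let ?M = "PiM ?P (\<lambda>e. gauss (s0 e))"
    \<comment> \<open>Variance \<open>0\<close> switches the couplings between the blocks off.\<close>
    have zero: "AE x in ?M. x e = 0" if "e \<in> ?P - ?P1 - ?P2" for e
    proof -
      have "s0 e = 0" using that by (simp add: s0_def)
      then have "AE y in gauss (s0 e). y = 0" by (simp only: gauss_0) (subst AE_return, auto)
      then show ?thesis using that
        by (intro AE_PiM_component[where P = "\<lambda>y. y = 0" and i = e]) (auto simp: prob_space_gauss)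
    qed
    have "AE x in ?M. \<forall>e\<in>?P - ?P1 - ?P2. x e = 0"
      by (rule AE_finite_allI) (use zero in \<open>auto simp: finite_pairs\<close>)
    then have ae: "AE x in ?M. log_Z ?n (joins T1 T2) u x = log_Z n1 T1 u1 x + log_Z n2 T2 u2 (\<lambda>e. x ((+) n1 ` e))"
      by eventually_elim (rule log_Z_joins[OF T], rule u, auto)
    have tr1: "integral\<^sup>L (PiM ?P1 (\<lambda>_. gauss (\<kappa> / n1))) (log_Z n1 T1 u1) = (\<integral>x. log_Z n1 T1 u1 (\<lambda>e\<in>?P1. x e) \<partial>?M)"
      "integrable (PiM ?P1 (\<lambda>_. gauss (\<kappa> / n1))) (log_Z n1 T1 u1) \<longleftrightarrow> integrable ?M (\<lambda>x. log_Z n1 T1 u1 (\<lambda>e\<in>?P1. x e))"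
      by (rule integral_PiM_transport[where h = "\<lambda>e. e" and T = "\<lambda>_ y. y"];
          use sub A.measurable_F in \<open>auto simp: finite_pairs prob_space_gauss s0_def distr_id2\<close>)+
    have inj: "inj_on (image ((+) n1)) (pairs {..<n2})" by (rule inj_on_image) simp
    have P2: "(+) n1 ` e \<in> ?P2" if "e \<in> pairs {..<n2}" for e using that by (auto simp: pairs_shift)
    have s0_2: "s0 ((+) n1 ` e) = \<kappa> / n2" if "e \<in> pairs {..<n2}" for e
      using P2[OF that] P12 by (auto simp: s0_def)
    have tr2: "integral\<^sup>L (PiM (pairs {..<n2}) (\<lambda>_. gauss (\<kappa> / n2))) (log_Z n2 T2 u2) = (\<integral>x. log_Z n2 T2 u2 (\<lambda>e\<in>pairs {..<n2}. x ((+) n1 ` e)) \<partial>?M)"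
      "integrable (PiM (pairs {..<n2}) (\<lambda>_. gauss (\<kappa> / n2))) (log_Z n2 T2 u2) \<longleftrightarrow> integrable ?M (\<lambda>x. log_Z n2 T2 u2 (\<lambda>e\<in>pairs {..<n2}. x ((+) n1 ` e)))"
      by (rule integral_PiM_transport[where h = "image ((+) n1)" and T = "\<lambda>_ y. y", OF _ _ inj];
          use sub P2 s0_2 B.measurable_F in \<open>auto simp: finite_pairs prob_space_gauss distr_id2\<close>)+
    have c1: "log_Z n1 T1 u1 (\<lambda>e\<in>?P1. x e) = log_Z n1 T1 u1 x" for x
      by (rule log_partition_cong) simp
    have c2: "log_Z n2 T2 u2 (\<lambda>e\<in>pairs {..<n2}. x ((+) n1 ` e)) = log_Z n2 T2 u2 (\<lambda>e. x ((+) n1 ` e))" for x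
      by (rule log_partition_cong) simp
    have lt: "light (gauss (\<kappa> / n))" for n :: nat using \<kappa> by (intro light_gauss) auto
    have int1: "integrable ?M (log_Z n1 T1 u1)"
      using tr1(2) coord_lipschitz_integrable[OF A.I lt A.lipschitz_F] by (simp add: c1)
    have int2: "integrable ?M (\<lambda>x. log_Z n2 T2 u2 (\<lambda>e. x ((+) n1 ` e)))"
      using tr2(2) coord_lipschitz_integrable[OF B.I lt B.lipschitz_F] by (simp add: c2)
    have intF: "integrable ?M (log_Z ?n (joins T1 T2) u)"
      by (rule coord_lipschitz_integrable[OF G.I _ G.lipschitz_F]) (use s0 in \<open>auto intro: light_gauss\<close>)
    have "gexp ?P s0 (log_Z ?n (joins T1 T2) u) = (\<integral>x. log_Z n1 T1 u1 x + log_Z n2 T2 u2 (\<lambda>e. x ((+) n1 ` e)) \<partial>?M)"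
      unfolding gexp_def using ae intF int1 int2 by (intro integral_cong_AE) auto
    also have "\<dots> = sk \<kappa> n1 T1 u1 + sk \<kappa> n2 T2 u2"
      using int1 int2 tr1(1) tr2(1) by (simp add: sk_def gexp_def c1 c2)
    finally show ?thesis .
  qed
  ultimately show ?thesis by (simp add: sk_def)
qed

section \<open>Classes of fixed magnetization\<close>

lemma gauss_scale: "c \<ge> 0 \<Longrightarrow> distr (gauss s) borel (\<lambda>y. c * y) = gauss (c\<^sup>2 * s)"
proof -
  assume c: "c \<ge> 0"
  have "(\<lambda>x. c * (sqrt s * x)) = (\<lambda>x. sqrt (c\<^sup>2 * s) * x)" using c by (simp add: fun_eq_iff real_sqrt_mult)
  then show ?thesis unfolding gauss_def by (subst distr_distr) (simp_all only: comp_def, auto)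
qed

text \<open>The two Gaussian moment generating functions in \<open>exp_moment_product\<close> multiply to
  \<open>exp (t\<^sup>2 s)\<close>.\<close>

lemma exp_moment_gauss:
  assumes I: "finite I" and F: "coord_lipschitz I (\<lambda>_. 1) F" and s: "\<And>i. s i \<ge> 0"
  shows "(\<integral>\<^sup>+ x. ennreal (exp (t * (F x - gexp I s F))) \<partial>PiM I (\<lambda>i. gauss (s i))) \<le> ennreal (exp (t\<^sup>2 * (\<Sum>i\<in>I. s i)))"
proof -
  have "(\<integral>\<^sup>+ x. ennreal (exp (t * (F x - gexp I s F))) \<partial>PiM I (\<lambda>i. gauss (s i))) \<le> ennreal (exp (\<Sum>i\<in>I. t\<^sup>2 * s i))"
    unfolding gexp_def
  proof (rule exp_moment_product[OF I light_gauss[OF s] F])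
    fix i
    show "(\<integral>y. exp (t * 1 * y) \<partial>gauss (s i)) * (\<integral>y. exp (- (t * 1) * y) \<partial>gauss (s i)) \<le> exp (t\<^sup>2 * s i)"
      using gauss_mgf(2)[OF s[of i], of t] gauss_mgf(2)[OF s[of i], of "-t"]
      by (simp add: exp_add[symmetric])
  qed
  then show ?thesis by (simp add: sum_distrib_left)
qed

lemma sk_integrable:
  assumes "\<kappa> \<ge> 0" "T \<subseteq> spin_lists n" "T \<noteq> {}"
  shows "integrable (PiM (pairs {..<n}) (\<lambda>_. gauss (\<kappa> / n))) (log_Z n T u)"
proof -
  interpret finite_gibbs "pairs {..<n}" T u spin_prod using finite_gibbs_spin assms by blast
  have lt: "light (gauss (\<kappa> / n))" using assms by (intro light_gauss) auto
  show ?thesis by (rule coord_lipschitz_integrable[OF I lt lipschitz_F])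
qed

lemma log_Z_mono:
  assumes T: "T \<subseteq> T'" "T' \<subseteq> spin_lists n" "T \<noteq> {}" and u: "\<And>l. l \<in> T \<Longrightarrow> u l \<le> u' l + c"
  shows "log_Z n T u x \<le> log_Z n T' u' x + c"
proof -
  have T': "T' \<noteq> {}" "T \<subseteq> spin_lists n" using T by auto
  interpret A: finite_gibbs "pairs {..<n}" T u spin_prod using finite_gibbs_spin T T' by blast
  interpret B: finite_gibbs "pairs {..<n}" T' u' spin_prod using finite_gibbs_spin T T' by blast
  have pos: "(\<Sum>l\<in>T. A.W x l) > 0" "(\<Sum>l\<in>T'. B.W x l) > 0"
    using A.T B.T A.weight_pos B.weight_pos by (auto intro!: sum_pos)
  have "(\<Sum>l\<in>T. A.W x l) \<le> (\<Sum>l\<in>T. exp c * B.W x l)"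
    using u by (intro sum_mono) (auto simp: gibbs_weight_def exp_add[symmetric] algebra_simps)
  also have "\<dots> \<le> (\<Sum>l\<in>T'. exp c * B.W x l)"
    using T B.T B.weight_pos by (intro sum_mono2) (auto intro: less_imp_le)
  also have "\<dots> = exp c * (\<Sum>l\<in>T'. B.W x l)" by (simp add: sum_distrib_left)
  finally have "ln (\<Sum>l\<in>T. A.W x l) \<le> ln (exp c * (\<Sum>l\<in>T'. B.W x l))"
    using pos by (subst ln_le_cancel_iff) auto
  also have "\<dots> = c + ln (\<Sum>l\<in>T'. B.W x l)" using pos by (simp add: ln_mult_pos)
  finally show ?thesis by (simp add: log_partition_def)
qed

lemma sk_mono:
  assumes \<kappa>: "\<kappa> \<ge> 0" and T: "T \<subseteq> T'" "T' \<subseteq> spin_lists n" "T \<noteq> {}" and u: "\<And>l. l \<in> T \<Longrightarrow> u l \<le> u' l + c"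
  shows "sk \<kappa> n T u \<le> sk \<kappa> n T' u' + c"
proof -
  let ?M = "PiM (pairs {..<n}) (\<lambda>_. gauss (\<kappa> / n))"
  interpret prob_space ?M by (intro prob_space_PiM prob_space_gauss)
  have int: "integrable ?M (log_Z n T u)" "integrable ?M (log_Z n T' u')"
    using T by (auto intro!: sk_integrable \<kappa>)
  have "sk \<kappa> n T u \<le> (\<integral>x. log_Z n T' u' x + c \<partial>?M)"
    unfolding sk_def gexp_def using int by (intro integral_mono log_Z_mono[OF T u]) auto
  also have "\<dots> = sk \<kappa> n T' u' + c" using int by (simp add: sk_def gexp_def prob_space)
  finally show ?thesis .
qed

text \<open>The couplings are centred, so a single configuration only contributes its weight.\<close>

lemma sk_singleton:
  assumes "\<kappa> \<ge> 0"
  shows "sk \<kappa> n {l} u = u l"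
proof -
  let ?M = "PiM (pairs {..<n}) (\<lambda>_. gauss (\<kappa> / n))"
  interpret prob_space ?M by (intro prob_space_PiM prob_space_gauss)
  have lt: "light (gauss (\<kappa> / n))" using assms by (intro light_gauss) auto
  have z: "(\<integral>y. y \<partial>gauss (\<kappa> / n)) = 0" using assms by (intro gauss_moments) auto
  have c: "integrable ?M (\<lambda>x. x e)" "(\<integral>x. x e \<partial>?M) = 0" if "e \<in> pairs {..<n}" for e
    using integrable_component[OF _ that lt light_moments(1)[OF lt]] z by (auto simp: finite_pairs)
  have "sk \<kappa> n {l} u = (\<integral>x. u l + (\<Sum>e\<in>pairs {..<n}. x e * spin_prod e l) \<partial>?M)"
    unfolding sk_def gexp_def by (intro Bochner_Integration.integral_cong) (simp_all add: log_partition_def gibbs_weight_def)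
  also have "\<dots> = u l" using c by (simp add: prob_space)
  finally show ?thesis .
qed

lemma sum_UN_le:
  fixes f :: "'a \<Rightarrow> real"
  assumes "finite J" "\<And>j. j \<in> J \<Longrightarrow> finite (A j)" "\<And>x. 0 \<le> f x"
  shows "sum f (\<Union>j\<in>J. A j) \<le> (\<Sum>j\<in>J. sum f (A j))"
  using assms
proof (induction J rule: finite_induct)
  case (insert i J)
  have "sum f (A i \<union> (\<Union>j\<in>J. A j)) + sum f (A i \<inter> (\<Union>j\<in>J. A j)) = sum f (A i) + sum f (\<Union>j\<in>J. A j)"
    using insert by (intro sum.union_inter) auto
  moreover have "0 \<le> sum f (A i \<inter> (\<Union>j\<in>J. A j))" using insert by (intro sum_nonneg) auto
  moreover have "sum f (\<Union>j\<in>J. A j) \<le> (\<Sum>j\<in>J. sum f (A j))" using insert by auto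
  ultimately show ?case using insert by simp
qed simp

text \<open>The partition function is at most the number of classes times the largest of their
  partition functions. Each of their logarithms exceeds its mean by more than expected only with
  small exponential moment, so the largest excess is controlled by the sum \<open>S\<close> of these
  exponentials.\<close>

lemma sk_partition_bound:
  assumes \<kappa>: "\<kappa> \<ge> 0" and J: "finite J" "J \<noteq> {}"
    and Tj: "\<And>j. j \<in> J \<Longrightarrow> Tj j \<noteq> {}" "\<And>j. j \<in> J \<Longrightarrow> Tj j \<subseteq> spin_lists n" and T: "T = (\<Union>j\<in>J. Tj j)"
    and B: "\<And>j. j \<in> J \<Longrightarrow> sk \<kappa> n (Tj j) u \<le> B"
    and t: "t > 0"
  shows "sk \<kappa> n T u \<le> B + (1 + 1 / t) * ln (card J) + t * \<kappa> * n / 2"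
proof -
  let ?P = "pairs {..<n}"
  let ?M = "PiM ?P (\<lambda>_. gauss (\<kappa> / n))"
  interpret prob_space ?M by (intro prob_space_PiM prob_space_gauss)
  have TT: "T \<noteq> {}" "T \<subseteq> spin_lists n" using J Tj T by auto
  interpret G: finite_gibbs ?P T u spin_prod by (rule finite_gibbs_spin) (use TT in auto)
  have lt: "light (gauss (\<kappa> / n))" using \<kappa> by (intro light_gauss) auto
  define K where "K = real (card J)"
  have K: "K \<ge> 1" using J by (simp add: K_def Suc_le_eq card_gt_0_iff)
  define Fj where "Fj j = log_Z n (Tj j) u" for j
  define m where "m j = sk \<kappa> n (Tj j) u" for j
  define S where "S x = (\<Sum>j\<in>J. exp (t * (Fj j x - m j)))" for x
  define V where "V = exp (t\<^sup>2 * (\<kappa> * n / 2))"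
  \<comment> \<open>A bound for the mean of the sum \<open>S\<close>; expanding the logarithm around it replaces Jensen's inequality.\<close>
  define A where "A = K * V"
  have A: "A > 0" using K by (simp add: A_def V_def)
  have moment: "integrable ?M (\<lambda>x. exp (t * (Fj j x - m j)))" "(\<integral>x. exp (t * (Fj j x - m j)) \<partial>?M) \<le> V" if j: "j \<in> J" for j
  proof -
    interpret finite_gibbs ?P "Tj j" u spin_prod by (rule finite_gibbs_spin) (use Tj j in auto)
    have meas: "(\<lambda>x. exp (t * (Fj j x - m j))) \<in> borel_measurable ?M"
      unfolding Fj_def using measurable_PiM_light[OF lt measurable_F] by measurable
    have "(\<Sum>e\<in>?P. \<kappa> / n) \<le> \<kappa> * n / 2"
    proof (cases "n = 0")
      case False
      have "(\<Sum>e\<in>?P. \<kappa> / n) = \<kappa> * (real n - 1) / 2" using False by (simp add: card_pairs)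
      also have "\<dots> \<le> \<kappa> * n / 2" using \<kappa> by (intro divide_right_mono mult_left_mono) auto
      finally show ?thesis .
    qed (simp add: pairs_def)
    then have le: "exp (t\<^sup>2 * (\<Sum>e\<in>?P. \<kappa> / n)) \<le> V" unfolding V_def exp_le_cancel_iff by (rule mult_left_mono) simp
    have "(\<integral>\<^sup>+ x. ennreal (exp (t * (Fj j x - m j))) \<partial>?M) \<le> ennreal (exp (t\<^sup>2 * (\<Sum>e\<in>?P. \<kappa> / n)))"
      unfolding Fj_def m_def sk_def using \<kappa> by (intro exp_moment_gauss lipschitz_F I) auto
    also have "\<dots> \<le> ennreal V" using le by (rule ennreal_leI)
    finally have nn: "(\<integral>\<^sup>+ x. ennreal (exp (t * (Fj j x - m j))) \<partial>?M) \<le> ennreal V" .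
    show int: "integrable ?M (\<lambda>x. exp (t * (Fj j x - m j)))"
      by (rule integrableI_bounded[OF meas]) (use nn in \<open>simp add: order_le_less_trans[OF nn]\<close>)
    show "(\<integral>x. exp (t * (Fj j x - m j)) \<partial>?M) \<le> V"
      using nn nn_integral_eq_integral[OF int] by (simp add: V_def)
  qed
  \<comment> \<open>The tangent of the logarithm at \<open>A\<close> makes the bound linear in \<open>S\<close>.\<close>
  have pt: "log_Z n T u x \<le> ln K + B + 1 / t * (S x / A - 1 + ln A)" for x
  proof -
    have S0: "S x > 0" unfolding S_def using J by (intro sum_pos) auto
    have pj: "(\<Sum>l\<in>Tj j. gibbs_weight ?P u spin_prod x l) > 0" if "j \<in> J" for j
    proof -
      interpret finite_gibbs ?P "Tj j" u spin_prod by (rule finite_gibbs_spin) (use Tj that in auto)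
      show ?thesis using T by (intro sum_pos weight_pos) auto
    qed
    have FS: "Fj j x \<le> B + 1 / t * ln (S x)" if j: "j \<in> J" for j
    proof -
      have "exp (t * (Fj j x - m j)) \<le> S x" unfolding S_def using J j by (intro member_le_sum) auto
      then have "t * (Fj j x - m j) \<le> ln (S x)" using S0 by (simp add: ln_ge_iff)
      then have "Fj j x - m j \<le> 1 / t * ln (S x)" using t by (simp add: field_simps)
      then show ?thesis using B[OF j] by (simp add: m_def)
    qed
    have finTj: "finite (Tj j)" if "j \<in> J" for j using Tj that finite_spin_lists finite_subset by blast
    have "(\<Sum>l\<in>T. gibbs_weight ?P u spin_prod x l) \<le> (\<Sum>j\<in>J. \<Sum>l\<in>Tj j. gibbs_weight ?P u spin_prod x l)"
      unfolding T using J finTj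
      by (intro sum_UN_le) (auto simp: gibbs_weight_def)
    also have "\<dots> = (\<Sum>j\<in>J. exp (Fj j x))"
      unfolding Fj_def log_partition_def using pj by (intro sum.cong) auto
    also have "\<dots> \<le> (\<Sum>j\<in>J. exp (B + 1 / t * ln (S x)))"
      using FS by (intro sum_mono) auto
    also have "\<dots> = K * exp (B + 1 / t * ln (S x))" by (simp add: K_def)
    finally have "log_Z n T u x \<le> ln (K * exp (B + 1 / t * ln (S x)))"
      unfolding log_partition_def using G.T K by (subst ln_le_cancel_iff) (auto intro!: sum_pos G.weight_pos)
    also have "\<dots> = ln K + (B + 1 / t * ln (S x))" using K by (simp add: ln_mult_pos)
    also have "ln (S x) = ln (S x / A) + ln A" using S0 A by (simp add: ln_div)
    also have "ln (S x / A) \<le> S x / A - 1" using S0 A by (intro ln_le_minus_one) simp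
    finally show ?thesis using t by (simp add: divide_right_mono)
  qed
  have intS: "integrable ?M S" unfolding S_def using moment(1) by (intro Bochner_Integration.integrable_sum)
  have ES: "(\<integral>x. S x \<partial>?M) \<le> A"
  proof -
    have "(\<integral>x. S x \<partial>?M) = (\<Sum>j\<in>J. \<integral>x. exp (t * (Fj j x - m j)) \<partial>?M)"
      unfolding S_def using moment(1) by (rule Bochner_Integration.integral_sum)
    also have "\<dots> \<le> (\<Sum>j\<in>J. V)" using moment(2) by (intro sum_mono)
    finally show ?thesis by (simp add: A_def K_def)
  qed
  have "sk \<kappa> n T u \<le> (\<integral>x. ln K + B + 1 / t * (S x / A - 1 + ln A) \<partial>?M)"
    unfolding sk_def gexp_def using intS sk_integrable[OF \<kappa> TT(2,1)] pt by (intro integral_mono) auto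
  also have "\<dots> = ln K + B + 1 / t * ((\<integral>x. S x \<partial>?M) / A - 1 + ln A)"
    using intS by (simp add: prob_space)
  also have "\<dots> \<le> ln K + B + 1 / t * ln A"
    using ES A t by (simp add: divide_right_mono field_simps)
  also have "ln A = ln K + t\<^sup>2 * (\<kappa> * n / 2)"
    using K by (simp add: A_def V_def ln_mult_pos)
  also have "ln K + B + 1 / t * (ln K + t\<^sup>2 * (\<kappa> * n / 2)) = B + (1 + 1 / t) * ln K + t * \<kappa> * n / 2"
    using t by (simp add: field_simps power2_eq_square)
  finally show ?thesis by (simp add: K_def)
qed

lemma sum_list_spin: "l \<in> spin_lists n \<Longrightarrow> sum_list l \<in> real_of_int ` {- int n..int n}"
proof (induction l arbitrary: n)
  case Nil
  then show ?case by (auto simp: spin_lists_def)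
next
  case (Cons x l)
  then obtain k where k: "n = Suc k" "l \<in> spin_lists k" "x \<in> {-1, 1}" by (auto simp: spin_lists_def)
  from Cons.IH[OF k(2)] obtain z where z: "z \<in> {- int k..int k}" "sum_list l = real_of_int z" by auto
  have "sum_list (x # l) = real_of_int (if x = 1 then z + 1 else z - 1)" using k z by auto
  moreover have "(if x = 1 then z + 1 else z - 1) \<in> {- int n..int n}" using k z by auto
  ultimately show ?case by blast
qed

lemma abs_sum_list_spin: "l \<in> spin_lists n \<Longrightarrow> \<bar>sum_list l\<bar> \<le> n"
  using sum_list_spin[of l n] by auto

text \<open>The ferromagnetic energy, multiplied by \<open>\<beta>\<close>.\<close>

definition ferro :: "real \<Rightarrow> real \<Rightarrow> nat \<Rightarrow> real list \<Rightarrow> real" where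
  "ferro \<xi> \<beta> n l = \<beta> * \<xi> / n * (sum_list l)\<^sup>2"

text \<open>Coupling variance \<open>4 \<beta>\<^sup>2 / n\<close>, as the Gaussian matrix counts each pair twice with
  entries of variance \<open>1 / n\<close>.\<close>

definition mean_log_Z :: "real \<Rightarrow> real \<Rightarrow> nat \<Rightarrow> real" where
  "mean_log_Z \<xi> \<beta> n = sk (4 * \<beta>\<^sup>2) n (spin_lists n) (ferro \<xi> \<beta> n)"

definition mag_class :: "nat \<Rightarrow> real \<Rightarrow> real list set" where
  "mag_class n M = {l \<in> spin_lists n. sum_list l = M}"

text \<open>The bound of \<open>sk_partition_bound\<close> for \<open>2 n + 1\<close> classes, at \<open>t = 1 / sqrt n\<close>.\<close>

definition mag_error :: "real \<Rightarrow> nat \<Rightarrow> real" where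
  "mag_error \<kappa> n = (1 + sqrt n) * ln (2 * real n + 1) + \<kappa> / 2 * sqrt n"

lemma spin_lists_nonempty: "spin_lists n \<noteq> {}"
  using card_spin_lists[of n] by auto

text \<open>Best class of \<open>sk_partition_bound\<close> for the partition by the magnetization, which takes
  at most \<open>2 n + 1\<close> values.\<close>

lemma dominant_magnetization:
  assumes \<kappa>: "\<kappa> \<ge> 0" and n: "n > 0"
  obtains M where "mag_class n M \<noteq> {}" "sk \<kappa> n (spin_lists n) u \<le> sk \<kappa> n (mag_class n M) u + mag_error \<kappa> n"
proof -
  let ?J = "sum_list ` spin_lists n"
  have J: "finite ?J" "?J \<noteq> {}" using finite_spin_lists spin_lists_nonempty by auto
  have cJ: "card ?J \<le> 2 * n + 1"
  proof -
    have "card ?J \<le> card (real_of_int ` {- int n..int n})" using sum_list_spin by (intro card_mono) auto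
    also have "\<dots> \<le> card {- int n..int n}" by (rule card_image_le) simp
    finally show ?thesis by simp
  qed
  define B where "B = Max ((\<lambda>M. sk \<kappa> n (mag_class n M) u) ` ?J)"
  have "B \<in> (\<lambda>M. sk \<kappa> n (mag_class n M) u) ` ?J" unfolding B_def using J by (intro Max_in) auto
  then obtain M where M: "M \<in> ?J" "B = sk \<kappa> n (mag_class n M) u" by auto
  have "sk \<kappa> n (spin_lists n) u \<le> B + (1 + 1 / (1 / sqrt n)) * ln (card ?J) + 1 / sqrt n * \<kappa> * n / 2"
  proof (rule sk_partition_bound[OF \<kappa> J])
    show "spin_lists n = (\<Union>M\<in>?J. mag_class n M)" by (auto simp: mag_class_def)
    show "sk \<kappa> n (mag_class n M) u \<le> B" if "M \<in> ?J" for M unfolding B_def using J that by (intro Max_ge) auto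
  qed (use n in \<open>auto simp: mag_class_def\<close>)
  also have "\<dots> \<le> B + mag_error \<kappa> n"
  proof -
    have "ln (real (card ?J)) \<le> ln (2 * real n + 1)"
      using cJ J by (subst ln_le_cancel_iff) (auto simp: card_gt_0_iff)
    moreover have "1 / sqrt n * \<kappa> * n / 2 = \<kappa> / 2 * sqrt n" using n by (simp add: field_simps)
    ultimately show ?thesis by (simp add: mag_error_def mult_left_mono)
  qed
  finally have "sk \<kappa> n (spin_lists n) u \<le> B + mag_error \<kappa> n" .
  with M that show ?thesis by (auto simp: mag_class_def)
qed

text \<open>On copies of one magnetization class the ferromagnetic energy is constant and
  proportional to the number of copies, so it does not interfere with superadditivity.\<close>

lemma mag_class_power:
  assumes \<kappa>: "\<kappa> \<ge> 0" and n: "n > 0" and M: "mag_class n M \<noteq> {}" and k: "k > 0"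
  shows "real k * sk \<kappa> n (mag_class n M) (ferro \<xi> \<beta> n) \<le> sk \<kappa> (k * n) (mag_class (k * n) (k * M)) (ferro \<xi> \<beta> (k * n))
     \<and> mag_class (k * n) (k * M) \<noteq> {}"
  using k
proof (induction k rule: nat_induct_non_zero)
  case (Suc k)
  let ?A = "mag_class n M" and ?B = "mag_class (k * n) (k * M)"
  have sub: "?A \<subseteq> spin_lists n" "?B \<subseteq> spin_lists (k * n)" by (auto simp: mag_class_def)
  have ferro_const: "ferro \<xi> \<beta> (j * n) l = j * (\<beta> * \<xi> * M\<^sup>2 / n)" if "sum_list l = j * M" "j > 0" for l and j :: nat
    using that n by (simp add: ferro_def power_mult_distrib power2_eq_square field_simps)
  have "sk \<kappa> n ?A (ferro \<xi> \<beta> n) + sk \<kappa> (k * n) ?B (ferro \<xi> \<beta> (k * n)) \<le> sk \<kappa> (n + k * n) (joins ?A ?B) (ferro \<xi> \<beta> (Suc k * n))"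
  proof (rule guerra_toninelli[OF \<kappa> n _ sub M])
    fix l m assume lm: "l \<in> ?A" "m \<in> ?B"
    have "ferro \<xi> \<beta> (Suc k * n) (l @ m) = real (Suc k) * (\<beta> * \<xi> * M\<^sup>2 / n)"
      by (rule ferro_const) (use lm in \<open>auto simp: mag_class_def algebra_simps\<close>)
    moreover have "ferro \<xi> \<beta> (1 * n) l = real 1 * (\<beta> * \<xi> * M\<^sup>2 / n)"
      by (rule ferro_const) (use lm in \<open>auto simp: mag_class_def\<close>)
    moreover have "ferro \<xi> \<beta> (k * n) m = real k * (\<beta> * \<xi> * M\<^sup>2 / n)"
      by (rule ferro_const) (use lm Suc.hyps in \<open>auto simp: mag_class_def\<close>)
    ultimately show "ferro \<xi> \<beta> (Suc k * n) (l @ m) = ferro \<xi> \<beta> n l + ferro \<xi> \<beta> (k * n) m"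
      by (simp add: algebra_simps add_divide_distrib)
  qed (use n Suc in auto)
  also have "\<dots> \<le> sk \<kappa> (Suc k * n) (mag_class (Suc k * n) (Suc k * M)) (ferro \<xi> \<beta> (Suc k * n)) + 0"
    unfolding mult_Suc
  proof (rule sk_mono[OF \<kappa>])
    show "joins ?A ?B \<subseteq> mag_class (n + k * n) (real (Suc k) * M)"
      using joins_spin_lists[OF sub] by (auto simp: mag_class_def joins_def algebra_simps)
    show "joins ?A ?B \<noteq> {}" using M Suc.IH by (auto simp: joins_def)
  qed (auto simp: mag_class_def)
  finally have 1: "sk \<kappa> n ?A (ferro \<xi> \<beta> n) + sk \<kappa> (k * n) ?B (ferro \<xi> \<beta> (k * n)) \<le> sk \<kappa> (Suc k * n) (mag_class (Suc k * n) (Suc k * M)) (ferro \<xi> \<beta> (Suc k * n))"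
    by simp
  have "joins ?A ?B \<subseteq> mag_class (n + k * n) (real (Suc k) * M)"
      using joins_spin_lists[OF sub] by (auto simp: mag_class_def joins_def algebra_simps)
  moreover have "joins ?A ?B \<noteq> {}" using M Suc.IH by (auto simp: joins_def)
  ultimately have "mag_class (Suc k * n) (Suc k * M) \<noteq> {}" by auto
  with 1 Suc.IH show ?case by (simp add: algebra_simps)
qed (use M in simp)

lemma mean_log_Z_mult:
  assumes n: "n > 0" and k: "k > 0"
  shows "real k * (mean_log_Z \<xi> \<beta> n - mag_error (4 * \<beta>\<^sup>2) n) \<le> mean_log_Z \<xi> \<beta> (k * n)"
proof -
  obtain M where M: "mag_class n M \<noteq> {}"
    "sk (4 * \<beta>\<^sup>2) n (spin_lists n) (ferro \<xi> \<beta> n) \<le> sk (4 * \<beta>\<^sup>2) n (mag_class n M) (ferro \<xi> \<beta> n) + mag_error (4 * \<beta>\<^sup>2) n"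
    by (rule dominant_magnetization[of "4 * \<beta>\<^sup>2" n "ferro \<xi> \<beta> n"]) (use n in auto)
  have "real k * (mean_log_Z \<xi> \<beta> n - mag_error (4 * \<beta>\<^sup>2) n) \<le> real k * sk (4 * \<beta>\<^sup>2) n (mag_class n M) (ferro \<xi> \<beta> n)"
    using M by (intro mult_left_mono) (auto simp: mean_log_Z_def)
  also have "\<dots> \<le> sk (4 * \<beta>\<^sup>2) (k * n) (mag_class (k * n) (k * M)) (ferro \<xi> \<beta> (k * n))"
    using mag_class_power[OF _ n M(1) k] by simp
  also have "\<dots> \<le> sk (4 * \<beta>\<^sup>2) (k * n) (spin_lists (k * n)) (ferro \<xi> \<beta> (k * n)) + 0"
    using mag_class_power[OF _ n M(1) k, of "4 * \<beta>\<^sup>2"] by (intro sk_mono) (auto simp: mag_class_def)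
  finally show ?thesis by (simp add: mean_log_Z_def)
qed

text \<open>Add one vertex with spin \<open>1\<close>, coupled to nothing. The ferromagnetic energy per
  \<open>\<beta> \<xi>\<close> changes by at most \<open>3\<close>.\<close>

lemma mean_log_Z_Suc:
  assumes n: "n > 0" and \<beta>: "\<beta> \<ge> 0" "\<xi> \<ge> 0"
  shows "mean_log_Z \<xi> \<beta> n \<le> mean_log_Z \<xi> \<beta> (Suc n) + 3 * \<beta> * \<xi>"
proof -
  let ?\<kappa> = "4 * \<beta>\<^sup>2" and ?T = "joins (spin_lists n) {[1 :: real]}"
  have s1: "{[1 :: real]} \<subseteq> spin_lists 1" by (auto simp: spin_lists_def)
  have "sk ?\<kappa> n (spin_lists n) (ferro \<xi> \<beta> n) + sk ?\<kappa> 1 {[1]} (\<lambda>_. 0) \<le> sk ?\<kappa> (n + 1) ?T (\<lambda>l. ferro \<xi> \<beta> n (butlast l))"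
    by (rule guerra_toninelli) (use n s1 spin_lists_nonempty in auto)
  moreover have "sk ?\<kappa> 1 {[1]} (\<lambda>_. 0) = 0" by (rule sk_singleton) simp
  moreover have "sk ?\<kappa> (n + 1) ?T (\<lambda>l. ferro \<xi> \<beta> n (butlast l)) \<le> sk ?\<kappa> (n + 1) (spin_lists (n + 1)) (ferro \<xi> \<beta> (n + 1)) + 3 * \<beta> * \<xi>"
  proof (rule sk_mono)
    show "?T \<subseteq> spin_lists (n + 1)" using joins_spin_lists[OF order_refl s1] by simp
    show "?T \<noteq> {}" using spin_lists_nonempty by (auto simp: joins_def)
    fix l assume "l \<in> ?T"
    then obtain l' where l': "l' \<in> spin_lists n" "l = l' @ [1]" by (auto simp: joins_def)
    define M where "M = sum_list l'"
    have M: "\<bar>M\<bar> \<le> n" unfolding M_def by (rule abs_sum_list_spin) fact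
    have "M\<^sup>2 / n - (M + 1)\<^sup>2 / (n + 1) = (M\<^sup>2 - 2 * M * n - n) / (real n * (n + 1))"
      using n by (simp add: field_simps power2_eq_square)
    also have "\<dots> \<le> 3"
    proof -
      have "M\<^sup>2 \<le> (real n)\<^sup>2" using M abs_le_square_iff[of M "real n"] by simp
      moreover have "- (2 * M * n) \<le> 2 * n * real n"
        using mult_right_mono[of "- M" "real n" "real n"] M by simp
      ultimately have "M\<^sup>2 - 2 * M * n - n \<le> 3 * (real n * (n + 1))"
        by (simp add: power2_eq_square algebra_simps)
      then show ?thesis using n by (simp add: pos_divide_le_eq)
    qed
    finally have "\<beta> * \<xi> * (M\<^sup>2 / n) \<le> \<beta> * \<xi> * ((M + 1)\<^sup>2 / (n + 1) + 3)"
      using \<beta> by (intro mult_left_mono) auto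
    then show "ferro \<xi> \<beta> n (butlast l) \<le> ferro \<xi> \<beta> (n + 1) l + 3 * \<beta> * \<xi>"
      using l' by (simp add: ferro_def M_def algebra_simps)
  qed auto
  ultimately show ?thesis by (simp add: mean_log_Z_def)
qed

text \<open>Below: a single configuration. Above: \<open>sk_partition_bound\<close> for the partition into
  singletons, at \<open>t = 1\<close>.\<close>

lemma mean_log_Z_bounds:
  assumes n: "n > 0" and \<beta>: "\<beta> \<ge> 0" "\<xi> \<ge> 0"
  shows "0 \<le> mean_log_Z \<xi> \<beta> n" "mean_log_Z \<xi> \<beta> n \<le> (\<beta> * \<xi> + 2 * ln 2 + 2 * \<beta>\<^sup>2) * n"
proof -
  obtain l where l: "l \<in> spin_lists n" using spin_lists_nonempty by blast
  have "0 \<le> sk (4 * \<beta>\<^sup>2) n {l} (ferro \<xi> \<beta> n)" using \<beta> by (simp add: sk_singleton ferro_def)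
  also have "\<dots> \<le> sk (4 * \<beta>\<^sup>2) n (spin_lists n) (ferro \<xi> \<beta> n) + 0" using l by (intro sk_mono) auto
  finally show "0 \<le> mean_log_Z \<xi> \<beta> n" by (simp add: mean_log_Z_def)
  have "sk (4 * \<beta>\<^sup>2) n (spin_lists n) (ferro \<xi> \<beta> n) \<le> \<beta> * \<xi> * n + (1 + 1 / 1) * ln (card (spin_lists n)) + 1 * (4 * \<beta>\<^sup>2) * n / 2"
  proof (rule sk_partition_bound)
    show "spin_lists n = (\<Union>l\<in>spin_lists n. {l})" by auto
    fix l assume l: "l \<in> spin_lists n"
    have "(sum_list l)\<^sup>2 \<le> (real n)\<^sup>2" using abs_sum_list_spin[OF l] abs_le_square_iff[of "sum_list l" "real n"] by simp
    then have "\<beta> * \<xi> / n * (sum_list l)\<^sup>2 \<le> \<beta> * \<xi> / n * (real n)\<^sup>2" using \<beta> by (intro mult_left_mono) auto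
    then show "sk (4 * \<beta>\<^sup>2) n {l} (ferro \<xi> \<beta> n) \<le> \<beta> * \<xi> * n"
      using n by (simp add: sk_singleton ferro_def power2_eq_square)
  qed (use finite_spin_lists spin_lists_nonempty in auto)
  then show "mean_log_Z \<xi> \<beta> n \<le> (\<beta> * \<xi> + 2 * ln 2 + 2 * \<beta>\<^sup>2) * n"
    by (simp add: mean_log_Z_def card_spin_lists ln_realpow algebra_simps)
qed

section \<open>The limiting free energy\<close>

text \<open>A version of Fekete's lemma. The limit is the supremum \<open>L\<close> of
  \<open>b n = (f n - c n) / n\<close>: from above because \<open>f n / n - b n\<close> tends to \<open>0\<close>, and
  from below because a large \<open>n\<close> is a multiple of any given \<open>N\<close> up to a bounded remainder, which is filled
  by single steps.\<close>

lemma almost_superadditive_limit: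
  fixes f c :: "nat \<Rightarrow> real" and B C :: real
  assumes mult: "\<And>n k. n > 0 \<Longrightarrow> k > 0 \<Longrightarrow> real k * (f n - c n) \<le> f (k * n)"
    and step: "\<And>n. n > 0 \<Longrightarrow> f n \<le> f (Suc n) + C"
    and bound: "\<And>n. n > 0 \<Longrightarrow> f n \<le> B * n"
    and c: "(\<lambda>n. c n / n) \<longlonglongrightarrow> 0"
  shows "convergent (\<lambda>n. f n / n)"
proof -
  have steps: "f n - r * C \<le> f (n + r)" if "n > 0" for n r
  proof (induction r)
    case (Suc r)
    then show ?case using step[of "n + r"] that by (simp add: algebra_simps)
  qed simp
  define b where "b n = (f n - c n) / n" for n
  \<comment> \<open>The case \<open>k = 1\<close> of the hypothesis gives \<open>c n \<ge> 0\<close>.\<close>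
  have bB: "b n \<le> B + \<bar>C\<bar>" if n: "n > 0" for n
    using mult[OF n, of 1] bound[OF n] n by (simp add: b_def pos_divide_le_eq algebra_simps) (smt (verit) mult_nonneg_nonneg of_nat_0_le_iff)
  define L where "L = (SUP n\<in>{0<..}. b n)"
  have bdd: "bdd_above (b ` {0<..})" using bB by (intro bdd_aboveI[of _ "B + \<bar>C\<bar>"]) auto
  have bL: "b n \<le> L" if "n > 0" for n unfolding L_def using that bdd by (intro cSUP_upper) auto
  have "(\<lambda>n. f n / n) \<longlonglongrightarrow> L"
  proof (rule order_tendstoI)
    fix y assume y: "L < y"
    have "eventually (\<lambda>n. c n / n < y - L) sequentially" using c y by (intro order_tendstoD(2)) auto
    then show "eventually (\<lambda>n. f n / n < y) sequentially" using eventually_gt_at_top[of 0]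
    proof eventually_elim
      case (elim n)
      have "f n / n = b n + c n / n" using elim by (simp add: b_def diff_divide_distrib)
      then show ?case using bL[of n] elim by simp
    qed
  next
    fix y assume y: "y < L"
    then obtain N where N: "N > 0" "y < b N" unfolding L_def using less_cSUP_iff[OF _ bdd, of y] by auto
    define E where "E = N * \<bar>b N\<bar> + N * \<bar>C\<bar>"
    have lower: "b N - E / n \<le> f n / n" if n: "n \<ge> N" for n
    proof -
      define k where "k = n div N"
      define r where "r = n mod N"
      have kr: "n = k * N + r" "r < N" "k > 0" using N n by (auto simp: k_def r_def div_greater_zero_iff)
      have aux: "real r * z \<le> N * \<bar>z\<bar>" for z :: real
        by (rule order_trans[of _ "real r * \<bar>z\<bar>"]) (use kr in \<open>auto intro: mult_left_mono mult_right_mono\<close>)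
      have "real k * (N * b N) - r * C \<le> f n"
        using mult[OF N(1) kr(3)] steps[of "k * N" r] kr N by (simp add: b_def)
      moreover have "real n * b N - N * \<bar>b N\<bar> \<le> real k * (N * b N)"
      proof -
        show ?thesis using aux[of "b N"] kr(1) by (simp add: algebra_simps)
      qed
      moreover have "r * C \<le> N * \<bar>C\<bar>" by (rule aux)
      ultimately have "real n * b N - E \<le> f n" by (simp add: E_def)
      moreover have "b N - E / n = (real n * b N - E) / n" using n N by (simp add: field_simps)
      ultimately show ?thesis using n N by (simp add: divide_right_mono)
    qed
    have "(\<lambda>n. b N - E / n) \<longlonglongrightarrow> b N" by real_asymp
    then have "eventually (\<lambda>n. y < b N - E / n) sequentially" using N by (intro order_tendstoD(1)) auto
    then show "eventually (\<lambda>n. y < f n / n) sequentially" using eventually_ge_at_top[of N]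
      by eventually_elim (use lower in force)
  qed
  then show ?thesis by (auto simp: convergent_def)
qed

lemma mag_error_small: "(\<lambda>n. mag_error \<kappa> n / n) \<longlonglongrightarrow> 0"
  unfolding mag_error_def by real_asymp

definition free_energy_limit :: "real \<Rightarrow> real \<Rightarrow> real" where
  "free_energy_limit \<xi> \<beta> = lim (\<lambda>n. mean_log_Z \<xi> \<beta> n / n)"

lemma free_energy_limit:
  assumes "\<beta> \<ge> 0" "\<xi> \<ge> 0"
  shows "(\<lambda>n. mean_log_Z \<xi> \<beta> n / n) \<longlonglongrightarrow> free_energy_limit \<xi> \<beta>"
proof -
  have "convergent (\<lambda>n. mean_log_Z \<xi> \<beta> n / n)"
    using mean_log_Z_mult mean_log_Z_Suc[OF _ assms] mean_log_Z_bounds[OF _ assms]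
    by (intro almost_superadditive_limit[OF _ _ _ mag_error_small]) auto
  then show ?thesis by (simp add: free_energy_limit_def convergent_LIMSEQ_iff)
qed

definition balanced_spins :: "nat \<Rightarrow> real list set" where
  "balanced_spins N = {l \<in> spin_lists (N + N). sum_list (take N l) = sum_list (drop N l)}"

text \<open>Two copies of the dominant magnetization class, side by side, are balanced.\<close>

lemma balanced_mean_log_Z:
  assumes N: "N > 0"
  shows "balanced_spins N \<noteq> {}"
    "sk (4 * \<beta>\<^sup>2) (N + N) (balanced_spins N) (ferro \<xi> \<beta> (N + N)) \<le> mean_log_Z \<xi> \<beta> (N + N)"
    "2 * (mean_log_Z \<xi> \<beta> N - mag_error (4 * \<beta>\<^sup>2) N) \<le> sk (4 * \<beta>\<^sup>2) (N + N) (balanced_spins N) (ferro \<xi> \<beta> (N + N))"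
proof -
  let ?\<kappa> = "4 * \<beta>\<^sup>2"
  obtain M where M: "mag_class N M \<noteq> {}"
    "sk ?\<kappa> N (spin_lists N) (ferro \<xi> \<beta> N) \<le> sk ?\<kappa> N (mag_class N M) (ferro \<xi> \<beta> N) + mag_error ?\<kappa> N"
    by (rule dominant_magnetization[of ?\<kappa> N "ferro \<xi> \<beta> N"]) (use N in auto)
  let ?T = "joins (mag_class N M) (mag_class N M)"
  have sub: "mag_class N M \<subseteq> spin_lists N" by (auto simp: mag_class_def)
  have T: "?T \<subseteq> balanced_spins N"
    using joins_spin_lists[OF sub sub] by (auto simp: joins_def balanced_spins_def mag_class_def dest: spin_listsD(1))
  have ne: "?T \<noteq> {}" using M by (auto simp: joins_def)
  then show "balanced_spins N \<noteq> {}" using T by auto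
  then show "sk ?\<kappa> (N + N) (balanced_spins N) (ferro \<xi> \<beta> (N + N)) \<le> mean_log_Z \<xi> \<beta> (N + N)"
    unfolding mean_log_Z_def using sk_mono[of ?\<kappa> "balanced_spins N" "spin_lists (N + N)" "N + N" "ferro \<xi> \<beta> (N + N)" "ferro \<xi> \<beta> (N + N)" 0]
    by (auto simp: balanced_spins_def)
  have "sk ?\<kappa> N (mag_class N M) (ferro \<xi> \<beta> N) + sk ?\<kappa> N (mag_class N M) (ferro \<xi> \<beta> N) \<le> sk ?\<kappa> (N + N) ?T (ferro \<xi> \<beta> (N + N))"
  proof (rule guerra_toninelli[OF _ N N sub sub M(1) M(1)])
    fix l m assume "l \<in> mag_class N M" "m \<in> mag_class N M"
    then have "sum_list l = M" "sum_list m = M" by (auto simp: mag_class_def)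
    then show "ferro \<xi> \<beta> (N + N) (l @ m) = ferro \<xi> \<beta> N l + ferro \<xi> \<beta> N m"
      using N by (simp add: ferro_def power2_eq_square field_simps)
  qed simp
  also have "\<dots> \<le> sk ?\<kappa> (N + N) (balanced_spins N) (ferro \<xi> \<beta> (N + N)) + 0"
    using T ne by (intro sk_mono) (auto simp: balanced_spins_def)
  finally show "2 * (mean_log_Z \<xi> \<beta> N - mag_error ?\<kappa> N) \<le> sk ?\<kappa> (N + N) (balanced_spins N) (ferro \<xi> \<beta> (N + N))"
    using M(2) by (simp add: mean_log_Z_def)
qed

theorem balanced_free_energy_limit:
  assumes "\<beta> \<ge> 0" "\<xi> \<ge> 0"
  shows "(\<lambda>N. sk (4 * \<beta>\<^sup>2) (N + N) (balanced_spins N) (ferro \<xi> \<beta> (N + N)) / (2 * real N)) \<longlonglongrightarrow> free_energy_limit \<xi> \<beta>"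
proof (rule tendsto_sandwich)
  note L = free_energy_limit[OF assms]
  have "(\<lambda>N. mean_log_Z \<xi> \<beta> N / N - mag_error (4 * \<beta>\<^sup>2) N / N) \<longlonglongrightarrow> free_energy_limit \<xi> \<beta> - 0"
    by (intro tendsto_diff L mag_error_small)
  then show "(\<lambda>N. mean_log_Z \<xi> \<beta> N / N - mag_error (4 * \<beta>\<^sup>2) N / N) \<longlonglongrightarrow> free_energy_limit \<xi> \<beta>" by simp
  have "filterlim (\<lambda>N::nat. N + N) at_top sequentially" by real_asymp
  from filterlim_compose[OF L this]
  show "(\<lambda>N. mean_log_Z \<xi> \<beta> (N + N) / real (N + N)) \<longlonglongrightarrow> free_energy_limit \<xi> \<beta>" by simp
  show "\<forall>\<^sub>F N in sequentially. mean_log_Z \<xi> \<beta> N / N - mag_error (4 * \<beta>\<^sup>2) N / N \<le> sk (4 * \<beta>\<^sup>2) (N + N) (balanced_spins N) (ferro \<xi> \<beta> (N + N)) / (2 * real N)"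
    using eventually_gt_at_top[of 0]
  proof eventually_elim
    case (elim N)
    have "2 * (mean_log_Z \<xi> \<beta> N - mag_error (4 * \<beta>\<^sup>2) N) / (2 * real N)
      \<le> sk (4 * \<beta>\<^sup>2) (N + N) (balanced_spins N) (ferro \<xi> \<beta> (N + N)) / (2 * real N)"
      by (rule divide_right_mono[OF balanced_mean_log_Z(3)[OF elim]]) simp
    then show ?case by (simp add: diff_divide_distrib)
  qed
  show "\<forall>\<^sub>F N in sequentially. sk (4 * \<beta>\<^sup>2) (N + N) (balanced_spins N) (ferro \<xi> \<beta> (N + N)) / (2 * real N) \<le> mean_log_Z \<xi> \<beta> (N + N) / real (N + N)"
    using eventually_gt_at_top[of 0]
  proof eventually_elim
    case (elim N)
    have "sk (4 * \<beta>\<^sup>2) (N + N) (balanced_spins N) (ferro \<xi> \<beta> (N + N)) / (2 * real N) \<le> mean_log_Z \<xi> \<beta> (N + N) / (2 * real N)"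
      by (rule divide_right_mono[OF balanced_mean_log_Z(2)[OF elim]]) simp
    then show ?case by simp
  qed
qed

text \<open>After normalization by the total mass, all terms are at most \<open>1\<close>, and such numbers
  do not increase when raised to a power \<open>p \<ge> 1\<close>.\<close>

lemma ln_sum_exp_scale:
  fixes h :: "'c \<Rightarrow> real"
  assumes T: "finite T" "T \<noteq> {}" and p: "p \<ge> 1"
  shows "ln (\<Sum>c\<in>T. exp (p * h c)) \<le> p * ln (\<Sum>c\<in>T. exp (h c))"
proof -
  define S where "S = (\<Sum>c\<in>T. exp (h c))"
  have S: "S > 0" unfolding S_def using T by (intro sum_pos) auto
  have "(\<Sum>c\<in>T. exp (p * (h c - ln S))) \<le> (\<Sum>c\<in>T. exp (h c - ln S))"
  proof (intro sum_mono)
    fix c assume c: "c \<in> T"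
    have "exp (h c) \<le> S" unfolding S_def using T c by (intro member_le_sum) auto
    then have "h c - ln S \<le> 0" using S by (simp add: ln_ge_iff)
    then have "p * (h c - ln S) \<le> 1 * (h c - ln S)" using p by (intro mult_right_mono_neg)
    then show "exp (p * (h c - ln S)) \<le> exp (h c - ln S)" by simp
  qed
  also have "\<dots> = 1" using S by (simp add: exp_diff sum_divide_distrib[symmetric] S_def[symmetric])
  finally have "(\<Sum>c\<in>T. exp (p * (h c - ln S))) \<le> 1" .
  moreover have "(\<Sum>c\<in>T. exp (p * h c)) = exp (p * ln S) * (\<Sum>c\<in>T. exp (p * (h c - ln S)))"
    by (simp add: sum_distrib_left exp_add[symmetric] algebra_simps)
  ultimately have "(\<Sum>c\<in>T. exp (p * h c)) \<le> exp (p * ln S)" by simp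
  moreover have "(\<Sum>c\<in>T. exp (p * h c)) > 0" using T by (intro sum_pos) auto
  ultimately have "ln (\<Sum>c\<in>T. exp (p * h c)) \<le> ln (exp (p * ln S))" by (subst ln_le_cancel_iff) auto
  then show ?thesis by (simp add: S_def)
qed

text \<open>Written with standard couplings, the temperature multiplies the whole energy, so
  the scaling inequality applies pointwise.\<close>

lemma mean_log_Z_scale:
  assumes n: "n > 0" and \<beta>: "0 < \<beta>" "\<beta> \<le> \<beta>'"
  shows "mean_log_Z \<xi> \<beta>' n / \<beta>' \<le> mean_log_Z \<xi> \<beta> n / \<beta>"
proof -
  let ?P = "pairs {..<n}"
  let ?M = "PiM ?P (\<lambda>_. gauss 1)"
  define h where "h x l = \<xi> / n * (sum_list l)\<^sup>2 + 2 / sqrt n * (\<Sum>e\<in>?P. x e * spin_prod e l)" for x l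
  define Z where "Z b x = ln (\<Sum>l\<in>spin_lists n. exp (b * h x l))" for b x
  have tr: "mean_log_Z \<xi> b n = integral\<^sup>L ?M (Z b)" "integrable ?M (Z b)" if b: "b > 0" for b
  proof -
    interpret finite_gibbs ?P "spin_lists n" "ferro \<xi> b n" spin_prod
      by (rule finite_gibbs_spin) (use spin_lists_nonempty in auto)
    have g: "gauss (4 * b\<^sup>2 / n) = distr (gauss 1) borel (\<lambda>y. 2 * b / sqrt n * y)"
      using gauss_scale[of "2 * b / sqrt n" 1] b by (simp add: power_divide power_mult_distrib)
    have Zb: "log_Z n (spin_lists n) (ferro \<xi> b n) (\<lambda>e\<in>?P. 2 * b / sqrt n * x e) = Z b x" for x
      unfolding log_partition_def Z_def gibbs_weight_def
      by (simp add: h_def ferro_def algebra_simps sum_distrib_left)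
    note tr = integral_PiM_transport[of ?P "\<lambda>_. gauss 1" "\<lambda>e. e" ?P "\<lambda>_ y. 2 * b / sqrt n * y" "\<lambda>_. gauss (4 * b\<^sup>2 / n)",
        OF _ prob_space_gauss _ _ _ g measurable_F, unfolded Zb]
    show "mean_log_Z \<xi> b n = integral\<^sup>L ?M (Z b)"
      unfolding mean_log_Z_def sk_def gexp_def by (subst tr(1)) (auto simp: finite_pairs)
    have lt: "light (gauss (4 * b\<^sup>2 / n))" by (intro light_gauss) auto
    show "integrable ?M (Z b)"
      by (subst tr(2)[symmetric]) (auto simp: finite_pairs intro: coord_lipschitz_integrable[OF I lt lipschitz_F])
  qed
  have "Z \<beta>' x \<le> \<beta>' / \<beta> * Z \<beta> x" for x
    using ln_sum_exp_scale[of "spin_lists n" "\<beta>' / \<beta>" "\<lambda>l. \<beta> * h x l"] \<beta>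
    by (simp add: Z_def finite_spin_lists spin_lists_nonempty)
  then have "mean_log_Z \<xi> \<beta>' n \<le> (\<integral>x. \<beta>' / \<beta> * Z \<beta> x \<partial>?M)"
    using tr \<beta> by (simp only:, intro integral_mono) auto
  also have "\<dots> = \<beta>' / \<beta> * mean_log_Z \<xi> \<beta> n" using tr(1)[of \<beta>] \<beta> by simp
  finally show ?thesis using \<beta> by (simp add: field_simps)
qed

theorem free_energy_ground_state:
  assumes \<xi>: "\<xi> \<ge> 0"
  obtains C where "((\<lambda>\<beta>. free_energy_limit \<xi> \<beta> / \<beta>) \<longlongrightarrow> C) at_top"
proof -
  define p where "p \<beta> = free_energy_limit \<xi> \<beta> / \<beta>" for \<beta>
  have lim: "(\<lambda>n. mean_log_Z \<xi> \<beta> n / n) \<longlonglongrightarrow> free_energy_limit \<xi> \<beta>" if "\<beta> > 0" for \<beta>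
    using free_energy_limit[of \<beta> \<xi>] that \<xi> by simp
  have nonneg: "p \<beta> \<ge> 0" if b: "\<beta> > 0" for \<beta>
  proof -
    have "free_energy_limit \<xi> \<beta> \<ge> 0"
      by (rule LIMSEQ_le_const[OF lim[OF b]]) (use mean_log_Z_bounds(1)[of _ \<beta> \<xi>] b \<xi> in \<open>auto intro!: exI[of _ 1]\<close>)
    then show ?thesis using b by (simp add: p_def)
  qed
  have anti: "p \<beta>' \<le> p \<beta>" if b: "0 < \<beta>" "\<beta> \<le> \<beta>'" for \<beta> \<beta>'
    unfolding p_def
  proof (rule LIMSEQ_le)
    show "(\<lambda>n. mean_log_Z \<xi> \<beta>' n / n / \<beta>') \<longlonglongrightarrow> free_energy_limit \<xi> \<beta>' / \<beta>'"
      "(\<lambda>n. mean_log_Z \<xi> \<beta> n / n / \<beta>) \<longlonglongrightarrow> free_energy_limit \<xi> \<beta> / \<beta>"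
      using b by (intro tendsto_divide lim tendsto_const; simp)+
    show "\<exists>N. \<forall>n\<ge>N. mean_log_Z \<xi> \<beta>' n / n / \<beta>' \<le> mean_log_Z \<xi> \<beta> n / n / \<beta>"
    proof (intro exI allI impI)
      fix n :: nat assume "n \<ge> 1"
      then have "mean_log_Z \<xi> \<beta>' n / \<beta>' / n \<le> mean_log_Z \<xi> \<beta> n / \<beta> / n"
        using mean_log_Z_scale[OF _ b, of n \<xi>] by (intro divide_right_mono) auto
      then show "mean_log_Z \<xi> \<beta>' n / n / \<beta>' \<le> mean_log_Z \<xi> \<beta> n / n / \<beta>" by (simp add: mult.commute)
    qed
  qed
  define C where "C = (INF \<beta>\<in>{0<..}. p \<beta>)"
  have bdd: "bdd_below (p ` {0<..})" using nonneg by (intro bdd_belowI[of _ 0]) auto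
  have "(p \<longlongrightarrow> C) at_top"
  proof (rule order_tendstoI)
    fix y assume "y < C"
    show "eventually (\<lambda>\<beta>. y < p \<beta>) at_top" using eventually_gt_at_top[of 0]
    proof eventually_elim
      case (elim \<beta>)
      have "C \<le> p \<beta>" unfolding C_def using elim bdd by (intro cINF_lower) auto
      then show ?case using \<open>y < C\<close> by simp
    qed
  next
    fix y assume "C < y"
    then obtain \<beta>0 where "\<beta>0 > 0" "p \<beta>0 < y" unfolding C_def using cINF_less_iff[OF _ bdd, of y] by auto
    then show "eventually (\<lambda>\<beta>. p \<beta> < y) at_top"
      using anti[of \<beta>0] by (intro eventually_mono[OF eventually_ge_at_top[of \<beta>0]]) (auto intro: order_le_less_trans)
  qed
  then show ?thesis using that unfolding p_def by blast
qed

section \<open>The Gaussian orthogonal ensemble\<close>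

text \<open>Markov's inequality for both exponential moments.\<close>

lemma (in prob_space) chernoff_two_sided:
  fixes F :: "'a \<Rightarrow> real"
  assumes F[measurable]: "F \<in> borel_measurable M" and t: "t > 0"
    and mgf: "(\<integral>\<^sup>+ x. ennreal (exp (t * (F x - m))) \<partial>M) \<le> ennreal (exp V)"
      "(\<integral>\<^sup>+ x. ennreal (exp (- t * (F x - m))) \<partial>M) \<le> ennreal (exp V)"
  shows "prob {x \<in> space M. \<bar>F x - m\<bar> \<ge> \<delta>} \<le> 2 * exp (V - t * \<delta>)"
proof -
  have up: "prob {x \<in> space M. G x \<ge> \<delta>} \<le> exp (V - t * \<delta>)"
    if [measurable]: "G \<in> borel_measurable M" and G: "(\<integral>\<^sup>+ x. ennreal (exp (t * G x)) \<partial>M) \<le> ennreal (exp V)" for G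
  proof -
    have "emeasure M {x \<in> space M. G x \<ge> \<delta>} \<le> ennreal (exp (- t * \<delta>)) * (\<integral>\<^sup>+ x. ennreal (exp (t * G x)) * indicator (space M) x \<partial>M)"
      by (rule Chernoff_ineq_nn_integral_ge[OF t]) auto
    also have "(\<integral>\<^sup>+ x. ennreal (exp (t * G x)) * indicator (space M) x \<partial>M) = (\<integral>\<^sup>+ x. ennreal (exp (t * G x)) \<partial>M)"
      by (intro nn_integral_cong) simp
    also have "ennreal (exp (- t * \<delta>)) * \<dots> \<le> ennreal (exp (- t * \<delta>)) * ennreal (exp V)"
      using G by (intro mult_left_mono) auto
    also have "\<dots> = ennreal (exp (V - t * \<delta>))" by (simp add: ennreal_mult[symmetric] exp_add[symmetric])
    finally show ?thesis by (simp add: emeasure_eq_measure)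
  qed
  have "{x \<in> space M. \<bar>F x - m\<bar> \<ge> \<delta>} \<subseteq> {x \<in> space M. F x - m \<ge> \<delta>} \<union> {x \<in> space M. - (F x - m) \<ge> \<delta>}" by auto
  then have "prob {x \<in> space M. \<bar>F x - m\<bar> \<ge> \<delta>} \<le> prob ({x \<in> space M. F x - m \<ge> \<delta>} \<union> {x \<in> space M. - (F x - m) \<ge> \<delta>})"
    by (intro finite_measure_mono) auto
  also have "\<dots> \<le> prob {x \<in> space M. F x - m \<ge> \<delta>} + prob {x \<in> space M. - (F x - m) \<ge> \<delta>}"
    by (intro measure_Un_le) auto
  also have "\<dots> \<le> exp (V - t * \<delta>) + exp (V - t * \<delta>)"
  proof (intro add_mono up)
    show "(\<integral>\<^sup>+ x. ennreal (exp (t * (F x - m))) \<partial>M) \<le> ennreal (exp V)" by (rule mgf)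
    show "(\<integral>\<^sup>+ x. ennreal (exp (t * - (F x - m))) \<partial>M) \<le> ennreal (exp V)"
      using mgf(2) unfolding minus_mult_commute .
  qed auto
  finally show ?thesis by simp
qed

lemma nat_pair_MinMax: "a < b \<Longrightarrow> Min {a, b} = a" "a < b \<Longrightarrow> Max {a, b :: nat} = b" by auto

lemma pairs_natE:
  assumes "e \<in> pairs {..<n :: nat}"
  obtains a b where "a < b" "b < n" "e = {a, b}"
proof -
  obtain x y where xy: "e = {x, y}" "x \<noteq> y" "x < n" "y < n"
    using assms by (auto simp: pairs_def card_2_iff)
  show ?thesis
  proof (cases "x < y")
    case True
    show ?thesis by (rule that[OF True xy(4) xy(1)])
  next
    case False
    then have "y < x" "e = {y, x}" using xy by auto
    then show ?thesis using that xy(3) by blast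
  qed
qed

definition upper_index :: "nat \<Rightarrow> (nat \<times> nat) set" where
  "upper_index n = {(i, j). 1 \<le> i \<and> i \<le> j \<and> j \<le> n}"

lemma finite_upper_index: "finite (upper_index n)"
  by (rule finite_subset[of _ "{1..n} \<times> {1..n}"]) (auto simp: upper_index_def)

lemma card_upper_index: "card (upper_index n) \<le> n * n"
proof -
  have "card (upper_index n) \<le> card ({1..n} \<times> {1..n})"
    by (rule card_mono) (auto simp: upper_index_def)
  then show ?thesis by simp
qed

text \<open>The position above the diagonal that belongs to an edge of \<open>{..<n}\<close>; rows and columns of
  the matrix are counted from \<open>1\<close>.\<close>

definition edge_entry :: "nat set \<Rightarrow> nat \<times> nat" where
  "edge_entry e = (Suc (Min e), Suc (Max e))"

lemma edge_entry_bij: "bij_betw edge_entry (pairs {..<n}) {(i, j). 1 \<le> i \<and> i < j \<and> j \<le> n}"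
proof (rule bij_betwI[where g = "\<lambda>(i, j). {i - 1, j - 1}"])
  show "edge_entry \<in> pairs {..<n} \<rightarrow> {(i, j). 1 \<le> i \<and> i < j \<and> j \<le> n}"
    by (auto elim!: pairs_natE simp: edge_entry_def nat_pair_MinMax)
  show "(\<lambda>(i, j). {i - 1, j - 1}) \<in> {(i, j). 1 \<le> i \<and> i < j \<and> j \<le> n} \<rightarrow> pairs {..<n}"
  proof (intro funcsetI, clarify)
    fix a b assume "1 \<le> a" "a < b" "b \<le> n"
    then have "a - 1 \<noteq> b - 1" "a - 1 < n" "b - 1 < n" by auto
    then show "{a - 1, b - 1} \<in> pairs {..<n}" by (simp add: pairs_def)
  qed
  show "(case edge_entry e of (i, j) \<Rightarrow> {i - 1, j - 1}) = e" if "e \<in> pairs {..<n}" for e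
    using that by (auto elim!: pairs_natE simp: edge_entry_def nat_pair_MinMax)
  show "edge_entry (case y of (i, j) \<Rightarrow> {i - 1, j - 1}) = y" if "y \<in> {(i, j). 1 \<le> i \<and> i < j \<and> j \<le> n}" for y
    using that by (auto simp: edge_entry_def nat_pair_MinMax)
qed

lemma upper_index_split:
  "upper_index n = (\<lambda>i. (i, i)) ` {1..n} \<union> {(i, j). 1 \<le> i \<and> i < j \<and> j \<le> n}"
  by (auto simp: upper_index_def)

lemma sum_upper_index:
  fixes f :: "nat \<times> nat \<Rightarrow> real"
  shows "(\<Sum>e\<in>upper_index n. f e) = (\<Sum>i=1..n. f (i, i)) + (\<Sum>e\<in>pairs {..<n}. f (edge_entry e))"
proof -
  have fin: "finite {(i, j). 1 \<le> i \<and> i < j \<and> j \<le> n}"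
    by (rule finite_subset[OF _ finite_upper_index[of n]]) (auto simp: upper_index_def)
  have "(\<Sum>e\<in>upper_index n. f e) = (\<Sum>e\<in>(\<lambda>i. (i, i)) ` {1..n}. f e) + (\<Sum>e\<in>{(i, j). 1 \<le> i \<and> i < j \<and> j \<le> n}. f e)"
    unfolding upper_index_split using fin by (intro sum.union_disjoint) auto
  also have "(\<Sum>e\<in>(\<lambda>i. (i, i)) ` {1..n}. f e) = (\<Sum>i=1..n. f (i, i))"
    by (subst sum.reindex) (auto simp: inj_on_def)
  also have "(\<Sum>e\<in>{(i, j). 1 \<le> i \<and> i < j \<and> j \<le> n}. f e) = (\<Sum>e\<in>pairs {..<n}. f (edge_entry e))"
    by (rule sum.reindex_bij_betw[OF edge_entry_bij, symmetric])
  finally show ?thesis .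
qed

lemma sum_square_symmetric:
  fixes g :: "nat \<Rightarrow> nat \<Rightarrow> real"
  assumes sym: "\<And>i j. g i j = g j i"
  shows "(\<Sum>i=1..n. \<Sum>j=1..n. g i j) = (\<Sum>(i, j)\<in>upper_index n. (if i = j then 1 else 2) * g i j)"
proof -
  let ?lt = "{(i, j). 1 \<le> i \<and> i < j \<and> j \<le> n}"
  have fin: "finite ?lt"
    by (rule finite_subset[OF _ finite_upper_index[of n]]) (auto simp: upper_index_def)
  have bij: "bij_betw prod.swap ?lt ({1..n} \<times> {1..n} - upper_index n)"
    by (rule bij_betwI[where g = prod.swap]) (auto simp: upper_index_def)
  have "(\<Sum>i=1..n. \<Sum>j=1..n. g i j) = (\<Sum>(i, j)\<in>{1..n} \<times> {1..n}. g i j)" by (rule sum.cartesian_product)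
  also have "\<dots> = (\<Sum>(i, j)\<in>{1..n} \<times> {1..n} - upper_index n. g i j) + (\<Sum>(i, j)\<in>upper_index n. g i j)"
    by (rule sum.subset_diff) (auto simp: upper_index_def)
  also have "(\<Sum>(i, j)\<in>{1..n} \<times> {1..n} - upper_index n. g i j) = (\<Sum>(i, j)\<in>?lt. g i j)"
    by (subst sum.reindex_bij_betw[OF bij, symmetric]) (auto intro!: sum.cong simp: sym)
  also have "\<dots> + (\<Sum>(i, j)\<in>upper_index n. g i j) = (\<Sum>(i, j)\<in>upper_index n. (if i = j then 1 else 2) * g i j)"
  proof -
    have 1: "(\<Sum>(i, j)\<in>?lt. g i j) = (\<Sum>e\<in>pairs {..<n}. (\<lambda>(i, j). g i j) (edge_entry e))"
      by (rule sum.reindex_bij_betw[OF edge_entry_bij, symmetric])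
    have 2: "(\<Sum>e\<in>pairs {..<n}. (\<lambda>(i, j). (if i = j then 1 else 2) * g i j) (edge_entry e)) = 2 * (\<Sum>e\<in>pairs {..<n}. (\<lambda>(i, j). g i j) (edge_entry e))"
      unfolding sum_distrib_left by (intro sum.cong) (auto elim!: pairs_natE simp: edge_entry_def nat_pair_MinMax)
    show ?thesis unfolding sum_upper_index 1 2 by simp
  qed
  finally show ?thesis .
qed

definition spin_fun :: "nat \<Rightarrow> real list \<Rightarrow> nat \<Rightarrow> real" where
  "spin_fun n l = (\<lambda>i\<in>{1..n}. l ! (i - 1))"

lemma spin_fun_bij: "bij_betw (spin_fun n) (spin_lists n) (spins n)"
proof (rule bij_betwI[where g = "\<lambda>\<sigma>. map \<sigma> [1..<n + 1]"])
  show "spin_fun n \<in> spin_lists n \<rightarrow> spins n"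
    unfolding spins_def spin_fun_def
    by (intro funcsetI restrict_PiE_iff[THEN iffD2] ballI spin_listsD(2)) auto
  show "(\<lambda>\<sigma>. map \<sigma> [1..<n + 1]) \<in> spins n \<rightarrow> spin_lists n"
  proof
    fix \<sigma> assume "\<sigma> \<in> spins n"
    then have "\<sigma> i \<in> {-1, 1}" if "i \<in> {1..n}" for i using that unfolding spins_def by (rule PiE_mem)
    then have "\<sigma> ` {1..n} \<subseteq> {-1, 1}" by blast
    moreover have "set (map \<sigma> [1..<n + 1]) = \<sigma> ` {1..n}" by (auto simp del: upt_Suc)
    ultimately show "map \<sigma> [1..<n + 1] \<in> spin_lists n" by (simp add: spin_lists_def del: upt_Suc)
  qed
  show "map (spin_fun n l) [1..<n + 1] = l" if "l \<in> spin_lists n" for l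
    using spin_listsD(1)[OF that] by (intro nth_equalityI) (auto simp: spin_fun_def simp del: upt_Suc)
  show "spin_fun n (map \<sigma> [1..<n + 1]) = \<sigma>" if "\<sigma> \<in> spins n" for \<sigma>
  proof (rule ext)
    fix i
    show "spin_fun n (map \<sigma> [1..<n + 1]) i = \<sigma> i"
      using that by (auto simp: spin_fun_def spins_def PiE_iff extensional_def simp del: upt_Suc)
  qed
qed

definition edge_spin :: "nat \<times> nat \<Rightarrow> (nat \<Rightarrow> real) \<Rightarrow> real" where
  "edge_spin e \<sigma> = \<sigma> (fst e) * \<sigma> (snd e)"

definition ferro_spin :: "real \<Rightarrow> real \<Rightarrow> nat \<Rightarrow> (nat \<Rightarrow> real) \<Rightarrow> real" where
  "ferro_spin \<xi> \<beta> n \<sigma> = \<beta> * \<xi> / n * (\<Sum>i=1..n. \<sigma> i)\<^sup>2"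

definition GOE_log_Z :: "real \<Rightarrow> real \<Rightarrow> nat \<Rightarrow> (nat \<times> nat \<Rightarrow> real) \<Rightarrow> real" where
  "GOE_log_Z \<xi> \<beta> n = log_partition (upper_index n) (spins n) (ferro_spin \<xi> \<beta> n) edge_spin"

text \<open>The factor of a matrix entry in the energy, times \<open>\<beta>\<close>: entries above the diagonal occur
  twice.\<close>

definition entry_scale :: "real \<Rightarrow> nat \<Rightarrow> nat \<times> nat \<Rightarrow> real" where
  "entry_scale \<beta> n e = (if fst e = snd e then 1 else 2) * \<beta> / sqrt n"

definition entry_var :: "real \<Rightarrow> nat \<Rightarrow> nat \<times> nat \<Rightarrow> real" where
  "entry_var \<beta> n e = (if fst e = snd e then 2 else 4) * \<beta>\<^sup>2 / n"

lemma free_energy_density_eq: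
  assumes n: "n > 0"
  shows "free_energy_density \<xi> \<beta> n (GOE_entry \<omega>) = GOE_log_Z \<xi> \<beta> n (\<lambda>e\<in>upper_index n. entry_scale \<beta> n e * \<omega> e) / n"
proof -
  have "\<beta> * hamiltonian \<xi> n (GOE_entry \<omega>) \<sigma> = ferro_spin \<xi> \<beta> n \<sigma> + (\<Sum>e\<in>upper_index n. (\<lambda>e\<in>upper_index n. entry_scale \<beta> n e * \<omega> e) e * edge_spin e \<sigma>)" for \<sigma>
  proof -
    have "(\<Sum>i=1..n. \<Sum>j=1..n. GOE_entry \<omega> i j / sqrt n * \<sigma> i * \<sigma> j)
      = (\<Sum>(i, j)\<in>upper_index n. (if i = j then 1 else 2) * (GOE_entry \<omega> i j / sqrt n * \<sigma> i * \<sigma> j))"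
      by (rule sum_square_symmetric) (simp add: GOE_entry_def min.commute max.commute)
    also have "\<dots> = (\<Sum>(i, j)\<in>upper_index n. (if i = j then 1 else 2) * (\<omega> (i, j) / sqrt n * \<sigma> i * \<sigma> j))"
      by (intro sum.cong) (auto simp: upper_index_def GOE_entry_def min_def max_def)
    finally have "\<beta> * (\<Sum>i=1..n. \<Sum>j=1..n. GOE_entry \<omega> i j / sqrt n * \<sigma> i * \<sigma> j)
      = (\<Sum>(i, j)\<in>upper_index n. \<beta> * ((if i = j then 1 else 2) * (\<omega> (i, j) / sqrt n * \<sigma> i * \<sigma> j)))"
      by (simp add: sum_distrib_left case_prod_unfold)
    also have "\<dots> = (\<Sum>e\<in>upper_index n. (\<lambda>e\<in>upper_index n. entry_scale \<beta> n e * \<omega> e) e * edge_spin e \<sigma>)"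
      by (intro sum.cong) (auto simp: entry_scale_def edge_spin_def)
    finally show ?thesis by (simp add: hamiltonian_def ferro_spin_def distrib_left)
  qed
  then show ?thesis
    by (simp add: free_energy_density_def GOE_log_Z_def log_partition_def gibbs_weight_def)
qed

lemma finite_spins: "finite (spins n)" unfolding spins_def by (intro finite_PiE) auto

lemma spins_nonempty: "spins n \<noteq> {}" unfolding spins_def by (simp add: PiE_eq_empty_iff)

lemma finite_gibbs_GOE: "finite_gibbs (upper_index n) (spins n) edge_spin"
proof
  fix e :: "nat \<times> nat" and \<sigma> assume "e \<in> upper_index n" "\<sigma> \<in> spins n"
  then have "\<sigma> (fst e) \<in> {-1, 1}" "\<sigma> (snd e) \<in> {-1, 1}"
    by (auto simp: upper_index_def spins_def PiE_iff)
  then show "\<bar>edge_spin e \<sigma>\<bar> \<le> 1" by (auto simp: edge_spin_def abs_mult)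
qed (auto simp: finite_upper_index finite_spins spins_nonempty)

lemma GOE_eq_gauss: "GOE n = PiM (upper_index n) (\<lambda>e. gauss (if fst e = snd e then 2 else 1))"
  unfolding GOE_def upper_index_def by (intro PiM_cong) (auto simp: gauss_density)

text \<open>The diagonal entries multiply squares of spins, so they only shift the log-partition
  function.\<close>

lemma GOE_log_Z_eq:
  "GOE_log_Z \<xi> \<beta> n y = (\<Sum>i=1..n. y (i, i)) + log_Z n (spin_lists n) (ferro \<xi> \<beta> n) (\<lambda>e. y (edge_entry e))"
proof -
  have w: "gibbs_weight (upper_index n) (ferro_spin \<xi> \<beta> n) edge_spin y (spin_fun n l)
     = exp (\<Sum>i=1..n. y (i, i)) * gibbs_weight (pairs {..<n}) (ferro \<xi> \<beta> n) spin_prod (\<lambda>e. y (edge_entry e)) l" if l: "l \<in> spin_lists n" for l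
  proof -
    have sq: "(l ! (i - 1)) * (l ! (i - 1)) = 1" if "i \<in> {1..n}" for i
    proof -
      have "l ! (i - 1) \<in> {-1, 1}" by (rule spin_listsD(2)[OF l]) (use that in auto)
      then show ?thesis by auto
    qed
    have "(\<Sum>i=1..n. y (i, i) * edge_spin (i, i) (spin_fun n l)) = (\<Sum>i=1..n. y (i, i))"
      using sq by (intro sum.cong) (auto simp: edge_spin_def spin_fun_def)
    moreover have "(\<Sum>e\<in>pairs {..<n}. y (edge_entry e) * edge_spin (edge_entry e) (spin_fun n l)) = (\<Sum>e\<in>pairs {..<n}. y (edge_entry e) * spin_prod e l)"
      by (intro sum.cong) (auto elim!: pairs_natE simp: edge_entry_def nat_pair_MinMax edge_spin_def spin_fun_def spin_prod_def)
    moreover have "(\<Sum>i=1..n. spin_fun n l i) = sum_list l"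
    proof -
      have "(\<Sum>i=1..n. spin_fun n l i) = (\<Sum>i=1..n. l ! (i - 1))" by (intro sum.cong) (auto simp: spin_fun_def)
      also have "\<dots> = (\<Sum>i<n. l ! i)"
        by (rule sum.reindex_bij_witness[of _ Suc "\<lambda>i. i - 1"]) auto
      finally show ?thesis using spin_listsD(1)[OF l] by (simp add: sum_list_sum_nth atLeast0LessThan)
    qed
    ultimately show ?thesis
      unfolding gibbs_weight_def sum_upper_index by (simp add: ferro_spin_def ferro_def exp_add[symmetric] algebra_simps)
  qed
  interpret finite_gibbs "pairs {..<n}" "spin_lists n" "ferro \<xi> \<beta> n" spin_prod
    by (rule finite_gibbs_spin) (use spin_lists_nonempty in auto)
  have "(\<Sum>\<sigma>\<in>spins n. gibbs_weight (upper_index n) (ferro_spin \<xi> \<beta> n) edge_spin y \<sigma>)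
    = (\<Sum>l\<in>spin_lists n. gibbs_weight (upper_index n) (ferro_spin \<xi> \<beta> n) edge_spin y (spin_fun n l))"
    by (rule sum.reindex_bij_betw[OF spin_fun_bij, symmetric])
  also have "\<dots> = exp (\<Sum>i=1..n. y (i, i)) * (\<Sum>l\<in>spin_lists n. W (\<lambda>e. y (edge_entry e)) l)"
    using w by (simp add: sum_distrib_left)
  finally show ?thesis unfolding GOE_log_Z_def log_partition_def
    using T weight_pos by (simp add: ln_mult_pos sum_pos)
qed

lemma mean_GOE_log_Z:
  "gexp (upper_index n) (entry_var \<beta> n) (GOE_log_Z \<xi> \<beta> n) = mean_log_Z \<xi> \<beta> n"
proof -
  let ?I = "upper_index n" and ?P = "pairs {..<n}"
  let ?M = "PiM ?I (\<lambda>e. gauss (entry_var \<beta> n e))"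
  have lt: "light (gauss (entry_var \<beta> n e))" for e by (intro light_gauss) (simp add: entry_var_def)
  interpret finite_gibbs ?P "spin_lists n" "ferro \<xi> \<beta> n" spin_prod
    by (rule finite_gibbs_spin) (use spin_lists_nonempty in auto)
  have h: "inj_on edge_entry ?P" "edge_entry \<in> ?P \<rightarrow> ?I"
  proof -
    show "inj_on edge_entry ?P" using edge_entry_bij[of n] by (rule bij_betw_imp_inj_on)
    show "edge_entry \<in> ?P \<rightarrow> ?I"
    proof
      fix e assume "e \<in> ?P"
      then have "edge_entry e \<in> {(i, j). 1 \<le> i \<and> i < j \<and> j \<le> n}" by (rule bij_betw_apply[OF edge_entry_bij])
      then show "edge_entry e \<in> ?I" unfolding upper_index_split by blast
    qed
  qed
  have var: "entry_var \<beta> n (edge_entry e) = 4 * \<beta>\<^sup>2 / n" if "e \<in> ?P" for e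
    using that by (auto elim!: pairs_natE simp: entry_var_def edge_entry_def nat_pair_MinMax)
  note tr = integral_PiM_transport[of ?I "\<lambda>e. gauss (entry_var \<beta> n e)" edge_entry ?P "\<lambda>_ y. y" "\<lambda>_. gauss (4 * \<beta>\<^sup>2 / n)",
      OF finite_upper_index prob_space_gauss h _ _ measurable_F]
  have c: "log_Z n (spin_lists n) (ferro \<xi> \<beta> n) (\<lambda>e\<in>?P. y (edge_entry e)) = log_Z n (spin_lists n) (ferro \<xi> \<beta> n) (\<lambda>e. y (edge_entry e))" for y
    by (rule log_partition_cong) simp
  have A: "mean_log_Z \<xi> \<beta> n = (\<integral>y. log_Z n (spin_lists n) (ferro \<xi> \<beta> n) (\<lambda>e. y (edge_entry e)) \<partial>?M)"
    unfolding mean_log_Z_def sk_def gexp_def by (subst tr(1)) (simp_all add: var distr_id2 c)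
  have B: "integrable ?M (\<lambda>y. log_Z n (spin_lists n) (ferro \<xi> \<beta> n) (\<lambda>e. y (edge_entry e)))"
  proof -
    have lt': "light (gauss (4 * \<beta>\<^sup>2 / n))" by (intro light_gauss) auto
    have "integrable (PiM ?P (\<lambda>_. gauss (4 * \<beta>\<^sup>2 / n))) F" by (rule coord_lipschitz_integrable[OF I lt' lipschitz_F])
    then show ?thesis by (subst (asm) tr(2)) (simp_all add: var distr_id2 c)
  qed
  have z: "integrable ?M (\<lambda>y. y (i, i))" "(\<integral>y. y (i, i) \<partial>?M) = 0" if "i \<in> {1..n}" for i
  proof -
    have ii: "(i, i) \<in> ?I" using that by (auto simp: upper_index_def)
    show "integrable ?M (\<lambda>y. y (i, i))"
      by (rule integrable_component(1)[OF finite_upper_index ii lt light_moments(1)[OF lt]])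
    show "(\<integral>y. y (i, i) \<partial>?M) = 0"
      using integrable_component(2)[OF finite_upper_index ii lt light_moments(1)[OF lt]]
        gauss_moments(1)[of "entry_var \<beta> n (i, i)"] by (simp add: entry_var_def)
  qed
  have "gexp ?I (entry_var \<beta> n) (GOE_log_Z \<xi> \<beta> n) = (\<integral>y. (\<Sum>i=1..n. y (i, i)) + log_Z n (spin_lists n) (ferro \<xi> \<beta> n) (\<lambda>e. y (edge_entry e)) \<partial>?M)"
    unfolding gexp_def by (intro Bochner_Integration.integral_cong refl GOE_log_Z_eq)
  also have "\<dots> = (\<integral>y. (\<Sum>i=1..n. y (i, i)) \<partial>?M) + mean_log_Z \<xi> \<beta> n"
    unfolding A using z(1) B by (intro Bochner_Integration.integral_add Bochner_Integration.integrable_sum) auto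
  also have "(\<integral>y. (\<Sum>i=1..n. y (i, i)) \<partial>?M) = 0"
    using z by (subst Bochner_Integration.integral_sum) auto
  finally show ?thesis by simp
qed

lemma Collect_eq_vimage_Int: "(\<And>x. x \<in> S \<Longrightarrow> P x = (f x \<in> A)) \<Longrightarrow> {x \<in> S. P x} = f -` A \<inter> S"
  by blast

lemma GOE_concentration:
  assumes n: "n > 0" and \<beta>: "\<beta> \<ge> 0" and \<delta>: "\<delta> > 0"
  shows "measure (GOE n) {\<omega> \<in> space (GOE n). \<bar>free_energy_density \<xi> \<beta> n (GOE_entry \<omega>) - mean_log_Z \<xi> \<beta> n / n\<bar> \<ge> \<delta>}
     \<le> 2 * exp (- (\<delta>\<^sup>2 / (16 * (\<beta>\<^sup>2 + 1))) * n)"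
proof -
  let ?I = "upper_index n"
  let ?M = "PiM ?I (\<lambda>e. gauss (entry_var \<beta> n e))"
  let ?F = "GOE_log_Z \<xi> \<beta> n" and ?m = "mean_log_Z \<xi> \<beta> n"
  let ?Y = "\<lambda>\<omega>. \<lambda>e\<in>?I. entry_scale \<beta> n e * \<omega> e"
  interpret finite_gibbs ?I "spins n" "ferro_spin \<xi> \<beta> n" edge_spin by (rule finite_gibbs_GOE)
  have s0: "entry_var \<beta> n e \<ge> 0" for e by (simp add: entry_var_def)
  interpret prob_space ?M by (intro prob_space_PiM prob_space_gauss)
  have lip: "coord_lipschitz ?I (\<lambda>_. 1) ?F" unfolding GOE_log_Z_def by (rule lipschitz_F)
  have meas: "?F \<in> borel_measurable ?M"
    by (rule measurable_PiM_light[OF light_gauss[OF s0] coord_lipschitzD(1)[OF lip]])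
  have V: "(\<Sum>e\<in>?I. entry_var \<beta> n e) \<le> 4 * (\<beta>\<^sup>2 + 1) * n"
  proof -
    have "(\<Sum>e\<in>?I. entry_var \<beta> n e) \<le> (\<Sum>e\<in>?I. 4 * \<beta>\<^sup>2 / n)"
      by (intro sum_mono divide_right_mono) (auto simp: entry_var_def divide_right_mono)
    also have "\<dots> = card ?I * (4 * \<beta>\<^sup>2 / n)" by simp
    also have "\<dots> \<le> real (n * n) * (4 * \<beta>\<^sup>2 / n)" by (intro mult_right_mono of_nat_mono card_upper_index) auto
    also have "\<dots> \<le> 4 * (\<beta>\<^sup>2 + 1) * n" using n by (simp add: field_simps)
    finally show ?thesis .
  qed
  define t where "t = \<delta> / (8 * (\<beta>\<^sup>2 + 1))"
  have b1: "\<beta>\<^sup>2 + 1 > 0" by (simp add: add_nonneg_pos)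
  have t: "t > 0" using \<delta> b1 by (simp add: t_def)
  have mgf: "(\<integral>\<^sup>+ x. ennreal (exp (r * (?F x - ?m))) \<partial>?M) \<le> ennreal (exp (t\<^sup>2 * (4 * (\<beta>\<^sup>2 + 1) * n)))" if "r = t \<or> r = - t" for r
  proof -
    have "(\<integral>\<^sup>+ x. ennreal (exp (r * (?F x - ?m))) \<partial>?M) \<le> ennreal (exp (r\<^sup>2 * (\<Sum>e\<in>?I. entry_var \<beta> n e)))"
      using exp_moment_gauss[where s = "entry_var \<beta> n" and t = r, OF finite_upper_index lip s0] by (simp add: mean_GOE_log_Z)
    also have "\<dots> \<le> ennreal (exp (t\<^sup>2 * (4 * (\<beta>\<^sup>2 + 1) * n)))"
      using V that by (intro ennreal_leI) (auto intro!: mult_left_mono)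
    finally show ?thesis .
  qed
  have "prob {y \<in> space ?M. \<bar>?F y - ?m\<bar> \<ge> \<delta> * n} \<le> 2 * exp (t\<^sup>2 * (4 * (\<beta>\<^sup>2 + 1) * n) - t * (\<delta> * n))"
    by (rule chernoff_two_sided[OF meas t]) (use mgf[of t] mgf[of "-t"] in auto)
  also have "t\<^sup>2 * (4 * (\<beta>\<^sup>2 + 1) * n) - t * (\<delta> * n) = - (\<delta>\<^sup>2 / (16 * (\<beta>\<^sup>2 + 1))) * n"
  proof -
    have "(\<delta> / (8 * B))\<^sup>2 * (4 * B * n) - \<delta> / (8 * B) * (\<delta> * n) = - (\<delta>\<^sup>2 / (16 * B)) * n" if "B > 0" for B :: real
      using that by (simp add: field_simps power2_eq_square)
    from this[OF b1] show ?thesis by (simp only: t_def)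
  qed
  finally have bound: "prob {y \<in> space ?M. \<bar>?F y - ?m\<bar> \<ge> \<delta> * n} \<le> 2 * exp (- (\<delta>\<^sup>2 / (16 * (\<beta>\<^sup>2 + 1))) * n)" .
  \<comment> \<open>Diagonal entries have variance \<open>2\<close> and factor \<open>1\<close>, the others variance \<open>1\<close> and factor \<open>2\<close>.\<close>
  have law: "distr (gauss (if fst e = snd e then 2 else 1)) borel (\<lambda>y. entry_scale \<beta> n e * y) = gauss (entry_var \<beta> n e)" for e
    using \<beta> n by (subst gauss_scale) (auto simp: entry_scale_def entry_var_def power_divide power_mult_distrib mult.commute)
  have G: "distr (GOE n) ?M ?Y = ?M"
    unfolding GOE_eq_gauss
    by (rule PiM_transport[OF finite_upper_index prob_space_gauss, where h = "\<lambda>e. e"]) (auto simp: law)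
  have Y: "?Y \<in> GOE n \<rightarrow>\<^sub>M ?M"
    unfolding GOE_eq_gauss by (rule measurable_restrict) simp
  have A: "{y \<in> space ?M. \<bar>?F y - ?m\<bar> \<ge> \<delta> * n} \<in> sets ?M" using meas by measurable
  have "measure (GOE n) {\<omega> \<in> space (GOE n). \<bar>free_energy_density \<xi> \<beta> n (GOE_entry \<omega>) - ?m / n\<bar> \<ge> \<delta>}
    = measure (GOE n) (?Y -` {y \<in> space ?M. \<bar>?F y - ?m\<bar> \<ge> \<delta> * n} \<inter> space (GOE n))"
  proof (intro arg_cong[where f = "measure (GOE n)"] Collect_eq_vimage_Int)
    fix \<omega> assume "\<omega> \<in> space (GOE n)"
    then have "?Y \<omega> \<in> space ?M" by (rule measurable_space[OF Y])
    moreover have "\<bar>?F (?Y \<omega>) / n - ?m / n\<bar> = \<bar>?F (?Y \<omega>) - ?m\<bar> / n"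
      by (simp add: diff_divide_distrib[symmetric])
    ultimately show "(\<delta> \<le> \<bar>free_energy_density \<xi> \<beta> n (GOE_entry \<omega>) - ?m / n\<bar>) = (?Y \<omega> \<in> {y \<in> space ?M. \<bar>?F y - ?m\<bar> \<ge> \<delta> * n})"
      using n by (simp add: free_energy_density_eq[OF n] pos_le_divide_eq)
  qed
  also have "\<dots> = measure (distr (GOE n) ?M ?Y) {y \<in> space ?M. \<bar>?F y - ?m\<bar> \<ge> \<delta> * n}"
    by (rule measure_distr[OF Y A, symmetric])
  also have "distr (GOE n) ?M ?Y = ?M" by (rule G)
  finally show ?thesis using bound by simp
qed

lemma measurable_free_energy_density:
  "(\<lambda>\<omega>. free_energy_density \<xi> \<beta> n (GOE_entry \<omega>)) \<in> borel_measurable (GOE n)"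
proof (cases "n = 0")
  case False
  then have n: "n > 0" by simp
  interpret finite_gibbs "upper_index n" "spins n" "ferro_spin \<xi> \<beta> n" edge_spin by (rule finite_gibbs_GOE)
  have 1: "(\<lambda>\<omega>. \<lambda>e\<in>upper_index n. entry_scale \<beta> n e * \<omega> e) \<in> GOE n \<rightarrow>\<^sub>M PiM (upper_index n) (\<lambda>_. borel)"
    unfolding GOE_eq_gauss by (rule measurable_restrict) simp
  show ?thesis unfolding free_energy_density_eq[OF n] GOE_log_Z_def
    by (intro borel_measurable_divide measurable_compose[OF 1 measurable_F]) auto
qed (simp add: free_energy_density_def)

lemma free_energy_converges:
  assumes \<beta>: "\<beta> \<ge> 0" and \<xi>: "\<xi> \<ge> 0"
  shows "converges_in_probability GOE (\<lambda>n \<omega>. free_energy_density \<xi> \<beta> n (GOE_entry \<omega>)) (free_energy_limit \<xi> \<beta>)"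
  unfolding converges_in_probability_def
proof (intro allI impI)
  fix \<epsilon> :: real assume \<epsilon>: "\<epsilon> > 0"
  let ?f = "\<lambda>n \<omega>. free_energy_density \<xi> \<beta> n (GOE_entry \<omega>)" and ?m = "\<lambda>n. mean_log_Z \<xi> \<beta> n / n" and ?L = "free_energy_limit \<xi> \<beta>"
  define c where "c = (\<epsilon> / 2)\<^sup>2 / (16 * (\<beta>\<^sup>2 + 1))"
  have b1: "\<beta>\<^sup>2 + 1 > 0" by (simp add: add_nonneg_pos)
  have c: "c > 0" using \<epsilon> b1 by (simp add: c_def)
  show "(\<lambda>n. measure (GOE n) {\<omega> \<in> space (GOE n). \<bar>?f n \<omega> - ?L\<bar> > \<epsilon>}) \<longlonglongrightarrow> 0"
  proof (rule tendsto_sandwich[of "\<lambda>_. 0" _ sequentially "\<lambda>n. 2 * exp (- c * real n)"])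
    show "(\<lambda>n. 2 * exp (- c * real n)) \<longlonglongrightarrow> 0" using c by real_asymp
    show "(\<lambda>_. 0 :: real) \<longlonglongrightarrow> 0" by simp
    have "eventually (\<lambda>n. \<bar>?m n - ?L\<bar> < \<epsilon> / 2) sequentially"
      using tendstoD[OF free_energy_limit[OF \<beta> \<xi>], of "\<epsilon> / 2"] \<epsilon> by (simp add: dist_real_def)
    then show "eventually (\<lambda>n. measure (GOE n) {\<omega> \<in> space (GOE n). \<bar>?f n \<omega> - ?L\<bar> > \<epsilon>} \<le> 2 * exp (- c * real n)) sequentially"
      using eventually_gt_at_top[of 0]
    proof eventually_elim
      case (elim n)
      interpret prob_space "GOE n" unfolding GOE_eq_gauss by (intro prob_space_PiM prob_space_gauss)
      note meas = measurable_free_energy_density[of \<xi> \<beta> n]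
      have "prob {\<omega> \<in> space (GOE n). \<bar>?f n \<omega> - ?L\<bar> > \<epsilon>} \<le> prob {\<omega> \<in> space (GOE n). \<bar>?f n \<omega> - ?m n\<bar> \<ge> \<epsilon> / 2}"
      proof (rule finite_measure_mono)
        show "{\<omega> \<in> space (GOE n). \<bar>?f n \<omega> - ?L\<bar> > \<epsilon>} \<subseteq> {\<omega> \<in> space (GOE n). \<bar>?f n \<omega> - ?m n\<bar> \<ge> \<epsilon> / 2}"
        proof clarify
          fix \<omega> assume "\<bar>?f n \<omega> - ?L\<bar> > \<epsilon>"
          then show "\<epsilon> / 2 \<le> \<bar>?f n \<omega> - ?m n\<bar>" using elim(1) by linarith
        qed
      qed (use meas in measurable)
      also have "\<dots> \<le> 2 * exp (- c * real n)"
        using GOE_concentration[OF elim(2) \<beta>, of "\<epsilon> / 2" \<xi>] \<epsilon> by (simp add: c_def)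
      finally show ?case .
    qed
  qed (auto intro!: always_eventually)
qed

lemma converges_in_probability_unique:
  assumes P: "\<And>n. prob_space (M n)" and X: "\<And>n. X n \<in> borel_measurable (M n)"
    and c: "converges_in_probability M X c" "converges_in_probability M X c'"
  shows "c = c'"
proof (rule ccontr)
  assume ne: "c \<noteq> c'"
  define \<epsilon> where "\<epsilon> = \<bar>c - c'\<bar> / 3"
  have \<epsilon>: "\<epsilon> > 0" using ne by (simp add: \<epsilon>_def)
  let ?A = "\<lambda>c n. {\<omega> \<in> space (M n). \<bar>X n \<omega> - c\<bar> > \<epsilon>}"
  have "(\<lambda>n. measure (M n) (?A c n) + measure (M n) (?A c' n)) \<longlonglongrightarrow> 0 + 0"
    using c \<epsilon> unfolding converges_in_probability_def by (intro tendsto_add) auto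
  moreover have "1 \<le> measure (M n) (?A c n) + measure (M n) (?A c' n)" for n
  proof -
    interpret prob_space "M n" by (rule P)
    note [measurable] = X[of n]
    have "space (M n) \<subseteq> ?A c n \<union> ?A c' n"
    proof
      fix \<omega> assume "\<omega> \<in> space (M n)"
      moreover have "\<bar>c - c'\<bar> = 3 * \<epsilon>" by (simp add: \<epsilon>_def)
      ultimately show "\<omega> \<in> ?A c n \<union> ?A c' n" using \<epsilon> by auto
    qed
    then have "prob (space (M n)) \<le> prob (?A c n \<union> ?A c' n)" by (intro finite_measure_mono) auto
    also have "\<dots> \<le> prob (?A c n) + prob (?A c' n)" by (intro measure_Un_le) auto
    finally show ?thesis by (simp add: prob_space)
  qed
  ultimately have "(1 :: real) \<le> 0 + 0" by (intro LIMSEQ_le_const) auto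
  then show False by simp
qed

lemma limit_free_energy_eq:
  assumes \<beta>: "\<beta> \<ge> 0" and \<xi>: "\<xi> \<ge> 0"
  shows "limit_free_energy \<xi> \<beta> = free_energy_limit \<xi> \<beta>"
  unfolding limit_free_energy_def
proof (rule the_equality)
  let ?X = "\<lambda>n \<omega>. free_energy_density \<xi> \<beta> n (GOE_entry \<omega>)"
  show conv: "converges_in_probability GOE ?X (free_energy_limit \<xi> \<beta>)"
    by (rule free_energy_converges[OF \<beta> \<xi>])
  fix c assume c: "converges_in_probability GOE ?X c"
  show "c = free_energy_limit \<xi> \<beta>"
    by (rule converges_in_probability_unique[OF _ measurable_free_energy_density c conv]) (simp add: GOE_eq_gauss prob_space_PiM prob_space_gauss)
qed

text \<open>The limits in probability that define \<open>limit_free_energy\<close> and \<open>Cstar\<close> exist, so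
  both descriptions return the limits of the means.\<close>

theorem Cstar_limit:
  assumes "\<xi> \<ge> 0"
  shows "((\<lambda>\<beta>. free_energy_limit \<xi> \<beta> / \<beta>) \<longlongrightarrow> Cstar \<xi>) at_top"
proof -
  obtain C where C: "((\<lambda>\<beta>. free_energy_limit \<xi> \<beta> / \<beta>) \<longlongrightarrow> C) at_top"
    using free_energy_ground_state[OF assms] .
  have "((\<lambda>\<beta>. limit_free_energy \<xi> \<beta> / \<beta>) \<longlongrightarrow> C) at_top"
    by (rule Lim_transform_eventually[OF C], rule eventually_mono[OF eventually_ge_at_top[of 0]])
       (simp add: limit_free_energy_eq assms)
  then have "Cstar \<xi> = C" unfolding Cstar_def by (intro tendsto_Lim) auto
  with C show ?thesis by simp
qed

section \<open>Centred Bernoulli variables and bisections\<close>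

text \<open>The law of \<open>c * (X - p)\<close> for a Bernoulli variable \<open>X\<close> of parameter \<open>p\<close>.\<close>

definition centred_bernoulli :: "real \<Rightarrow> real \<Rightarrow> real measure" where
  "centred_bernoulli c p = distr (measure_pmf (bernoulli_pmf p)) borel (\<lambda>b. c * (of_bool b - p))"

lemma centred_bernoulli_integral:
  fixes f :: "real \<Rightarrow> real"
  assumes p: "0 \<le> p" "p \<le> 1" and f: "f \<in> borel_measurable borel"
  shows "integrable (centred_bernoulli c p) f"
    "integral\<^sup>L (centred_bernoulli c p) f = p * f (c * (1 - p)) + (1 - p) * f (- (c * p))"
proof -
  have m: "(\<lambda>b. c * (of_bool b - p)) \<in> measure_pmf (bernoulli_pmf p) \<rightarrow>\<^sub>M borel" by simp
  show "integrable (centred_bernoulli c p) f"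
    unfolding centred_bernoulli_def
    by (subst integrable_distr_eq[OF m f]) (rule integrable_measure_pmf_finite, rule finite_subset[of _ UNIV], auto)
  show "integral\<^sup>L (centred_bernoulli c p) f = p * f (c * (1 - p)) + (1 - p) * f (- (c * p))"
    unfolding centred_bernoulli_def by (subst integral_distr[OF m f]) (use p in simp)
qed

lemma light_centred_bernoulli:
  assumes "0 \<le> p" "p \<le> 1"
  shows "light (centred_bernoulli c p)"
  unfolding light_def
  by (auto intro!: centred_bernoulli_integral(1)[OF assms])
     (auto simp: centred_bernoulli_def intro!: prob_space.prob_space_distr prob_space_measure_pmf)

lemma centred_bernoulli_moments:
  assumes p: "0 \<le> p" "p \<le> 1"
  shows "(\<integral>y. y \<partial>centred_bernoulli c p) = 0" "(\<integral>y. y\<^sup>2 \<partial>centred_bernoulli c p) = c\<^sup>2 * (p * (1 - p))"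
    "(\<integral>y. \<bar>y\<bar>^3 \<partial>centred_bernoulli c p) \<le> \<bar>c\<bar>^3 * p"
proof -
  show "(\<integral>y. y \<partial>centred_bernoulli c p) = 0"
    by (subst centred_bernoulli_integral[OF p]) (simp_all add: algebra_simps)
  show "(\<integral>y. y\<^sup>2 \<partial>centred_bernoulli c p) = c\<^sup>2 * (p * (1 - p))"
    by (subst centred_bernoulli_integral[OF p]) (simp_all add: power2_eq_square algebra_simps)
  have "(\<integral>y. \<bar>y\<bar>^3 \<partial>centred_bernoulli c p) = p * \<bar>c * (1 - p)\<bar>^3 + (1 - p) * \<bar>- (c * p)\<bar>^3"
    by (subst centred_bernoulli_integral[OF p]) simp_all
  also have "\<dots> = \<bar>c\<bar>^3 * (p * (1 - p) * ((1 - p)^2 + p^2))"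
  proof -
    have "p * (C * (1 - p))^3 + (1 - p) * (C * p)^3 = C^3 * (p * (1 - p) * ((1 - p)^2 + p^2))" for C :: real
      by (simp add: power2_eq_square power3_eq_cube algebra_simps)
    moreover have "\<bar>c * (1 - p)\<bar> = \<bar>c\<bar> * (1 - p)" "\<bar>- (c * p)\<bar> = \<bar>c\<bar> * p" using p by (simp_all add: abs_mult)
    ultimately show ?thesis by simp
  qed
  also have "\<dots> \<le> \<bar>c\<bar>^3 * p"
  proof (rule mult_left_mono)
    have "(1 - p) * ((1 - p)^2 + p^2) \<le> 1 * 1"
    proof (rule mult_mono)
      have "(1 - p)^2 + p^2 = 1 - 2 * (p * (1 - p))" by (simp add: power2_eq_square algebra_simps)
      then show "(1 - p)^2 + p^2 \<le> 1" using p by simp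
    qed (use p in auto)
    then show "p * (1 - p) * ((1 - p)^2 + p^2) \<le> p" using mult_left_mono[OF _ p(1)] by (simp add: mult.assoc) (metis mult.right_neutral)
  qed simp
  finally show "(\<integral>y. \<bar>y\<bar>^3 \<partial>centred_bernoulli c p) \<le> \<bar>c\<bar>^3 * p" .
qed

lemma cosh_minus_one_bound: "\<bar>x\<bar> \<le> 1 \<Longrightarrow> exp x + exp (- x) - 2 \<le> 2 * x\<^sup>2" for x :: real
proof -
  assume x: "\<bar>x\<bar> \<le> 1"
  have "exp z \<le> 1 + z + z\<^sup>2" if "\<bar>z\<bar> \<le> 1" for z :: real
  proof (cases "z \<ge> 0")
    case True
    then show ?thesis using exp_bound[of z] that by simp
  next
    case False
    define w where "w = - z"
    have w: "0 < w" "w \<le> 1" using False that by (auto simp: w_def)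
    have "1 + w + w\<^sup>2 / 2 \<le> exp w" using exp_lower_Taylor_quadratic[of w] w by simp
    moreover have "1 \<le> (1 - w + w\<^sup>2) * (1 + w + w\<^sup>2 / 2)"
    proof -
      have "(1 - w + w\<^sup>2) * (1 + w + w\<^sup>2 / 2) = 1 + w\<^sup>2 * (1 + w + w\<^sup>2) / 2"
        by (simp add: power2_eq_square field_simps)
      then show ?thesis using w by simp
    qed
    moreover have "0 \<le> 1 - w + w\<^sup>2" using w by simp
    ultimately have "1 \<le> (1 - w + w\<^sup>2) * exp w" by (meson mult_left_mono order_trans)
    then have "exp (- w) \<le> 1 - w + w\<^sup>2" by (simp add: exp_minus field_simps)
    then show ?thesis by (simp add: w_def)
  qed
  from this[of x] this[of "- x"] x show ?thesis by simp
qed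

text \<open>The centring cancels in the product, which equals \<open>1 + p (1 - p) (exp s + exp (- s) - 2)\<close> for
  \<open>s = r c\<close>. The bound is proportional to \<open>p\<close>; this is what makes concentration useful in a sparse
  graph.\<close>

lemma centred_bernoulli_mgf:
  assumes p: "0 \<le> p" "p \<le> 1" and r: "\<bar>r * c\<bar> \<le> 1"
  shows "(\<integral>y. exp (r * y) \<partial>centred_bernoulli c p) * (\<integral>y. exp (- r * y) \<partial>centred_bernoulli c p) \<le> exp (2 * p * (r * c)\<^sup>2)"
proof -
  define s where "s = r * c"
  have "(\<integral>y. exp (r * y) \<partial>centred_bernoulli c p) = p * exp (s * (1 - p)) + (1 - p) * exp (- (s * p))"
    by (subst centred_bernoulli_integral[OF p]) (simp_all add: s_def mult.assoc)
  also have "exp (s * (1 - p)) = exp (- (s * p)) * exp s" by (simp add: exp_add[symmetric] algebra_simps)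
  also have "p * (exp (- (s * p)) * exp s) + (1 - p) * exp (- (s * p)) = exp (- (s * p)) * (p * exp s + (1 - p))"
    by (simp add: algebra_simps)
  finally have A: "(\<integral>y. exp (r * y) \<partial>centred_bernoulli c p) = exp (- (s * p)) * (p * exp s + (1 - p))" .
  have "(\<integral>y. exp (- r * y) \<partial>centred_bernoulli c p) = p * exp (- (s * (1 - p))) + (1 - p) * exp (s * p)"
    by (subst centred_bernoulli_integral[OF p]) (simp_all add: s_def mult.assoc)
  also have "exp (- (s * (1 - p))) = exp (s * p) * exp (- s)" by (simp add: exp_add[symmetric] algebra_simps)
  also have "p * (exp (s * p) * exp (- s)) + (1 - p) * exp (s * p) = exp (s * p) * (p * exp (- s) + (1 - p))"
    by (simp add: algebra_simps)
  finally have B: "(\<integral>y. exp (- r * y) \<partial>centred_bernoulli c p) = exp (s * p) * (p * exp (- s) + (1 - p))" .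
  have "(\<integral>y. exp (r * y) \<partial>centred_bernoulli c p) * (\<integral>y. exp (- r * y) \<partial>centred_bernoulli c p)
     = (p * exp s + (1 - p)) * (p * exp (- s) + (1 - p))"
    unfolding A B by (simp add: exp_minus field_simps)
  also have "\<dots> = 1 + p * (1 - p) * (exp s + exp (- s) - 2)"
  proof -
    have "exp s * exp (- s) = 1" by (simp add: exp_add[symmetric])
    then show ?thesis by algebra
  qed
  also have "\<dots> \<le> 1 + p * (2 * s\<^sup>2)"
  proof -
    have "p * (1 - p) * (exp s + exp (- s) - 2) \<le> p * 1 * (2 * s\<^sup>2)"
    proof (rule mult_mono)
      show "exp s + exp (- s) - 2 \<le> 2 * s\<^sup>2" using cosh_minus_one_bound r by (simp add: s_def)
      have "0 \<le> (exp (s / 2) - exp (- (s / 2)))\<^sup>2" by simp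
      also have "\<dots> = exp (s / 2) * exp (s / 2) + exp (- (s / 2)) * exp (- (s / 2)) - 2 * (exp (s / 2) * exp (- (s / 2)))"
        by (simp only: power2_eq_square left_diff_distrib right_diff_distrib) simp
      also have "\<dots> = exp s + exp (- s) - 2" by (simp only: exp_add[symmetric]) simp
      finally show "0 \<le> exp s + exp (- s) - 2" .
    qed (use p mult_left_mono[of "1 - p" 1 p] in auto)
    then show ?thesis by simp
  qed
  also have "\<dots> \<le> exp (p * (2 * s\<^sup>2))" by (rule exp_ge_add_one_self)
  finally show ?thesis by (simp add: s_def mult_ac)
qed

lemma pairs_image: "inj_on f V \<Longrightarrow> pairs (f ` V) = image f ` pairs V"
  unfolding pairs_def by (auto simp: subset_image_iff image_iff card_image inj_on_subset)

text \<open>The vertices are listed in an order in which the planted set comes first; edges of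
  \<open>{..<n}\<close> refer to positions in the list \<open>xs\<close>.\<close>

locale planted_vertices =
  fixes N :: nat and S :: "nat set" and xs :: "nat list"
  assumes N: "N > 0" and xs: "distinct xs" "set xs = {1..N + N}"
    and S: "\<And>i. i < N + N \<Longrightarrow> xs ! i \<in> S \<longleftrightarrow> i < N"
begin

abbreviation "n \<equiv> N + N"
abbreviation "P \<equiv> pairs {..<n}"

definition side :: "nat \<Rightarrow> real" where "side i = (if i < N then 1 else - 1)"

text \<open>This sign is \<open>1\<close> for the edges within a block and \<open>-1\<close> for those across.\<close>

definition edge_side :: "nat set \<Rightarrow> real" where "edge_side e = (\<Prod>i\<in>e. side i)"

definition edge :: "nat set \<Rightarrow> nat set" where "edge e = (!) xs ` e"

text \<open>The sign of a vertex tells on which side of the cut it lies, and it is flipped outside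
  the planted set. In this gauge the planted coupling is ferromagnetic.\<close>

definition cut_spins :: "nat set \<Rightarrow> real list" where
  "cut_spins A = map (\<lambda>i. side i * (if xs ! i \<in> A then 1 else - 1)) [0..<n]"

definition cut_value :: "(nat set \<Rightarrow> real) \<Rightarrow> real list \<Rightarrow> real" where
  "cut_value x l = (\<Sum>e\<in>P. x e * ((1 - edge_side e * spin_prod e l) / 2))"

definition min_cut :: "(nat set \<Rightarrow> real) \<Rightarrow> real" where
  "min_cut x = Min (cut_value x ` balanced_spins N)"

lemma length_xs: "length xs = n" using distinct_card[OF xs(1)] xs(2) by simp

lemma nth_bij: "bij_betw ((!) xs) {..<n} {1..n}"
  using bij_betw_nth[OF xs(1), of "{..<n}" "{1..n}"] length_xs xs(2) by simp

lemma edge_bij: "bij_betw edge P (vertex_pairs n)"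
proof -
  have "vertex_pairs n = pairs ((!) xs ` {..<n})"
    using nth_bij by (simp add: bij_betw_def vertex_pairs_def pairs_def)
  also have "\<dots> = edge ` P"
    using nth_bij by (subst pairs_image) (auto simp: bij_betw_def edge_def[abs_def])
  finally have 1: "vertex_pairs n = edge ` P" .
  have "inj_on edge P" unfolding edge_def[abs_def]
    by (rule inj_on_image, rule inj_on_subset[of _ "{..<n}"]) (use nth_bij in \<open>auto simp: bij_betw_def pairs_def\<close>)
  with 1 show ?thesis by (simp add: bij_betw_def)
qed

lemma edge_side_sign: "edge_side e \<in> {-1, 1}"
  unfolding edge_side_def by (rule prod_sign) (auto simp: side_def)

lemma edge_within_iff:
  assumes "e \<in> P"
  shows "edge e \<subseteq> S \<or> edge e \<inter> S = {} \<longleftrightarrow> edge_side e = 1"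
  using assms
proof (rule pairs_natE)
  fix a b assume "a < b" "b < n" "e = {a, b}"
  then show ?thesis using S[of a] S[of b] by (auto simp: edge_def edge_side_def side_def)
qed

lemma cut_spins_spin: "cut_spins A \<in> spin_lists n"
  by (auto simp: cut_spins_def spin_lists_def side_def split: if_splits)

lemma cut_size_eq:
  assumes A: "A \<subseteq> {1..n}"
  shows "real (cut_size n {e \<in> vertex_pairs n. \<omega> e} A) = cut_value (\<lambda>e. of_bool (\<omega> (edge e))) (cut_spins A)"
proof -
  let ?cr = "\<lambda>e. e \<inter> A \<noteq> {} \<and> e \<inter> ({1..n} - A) \<noteq> {}"
  have fin: "finite (vertex_pairs n)"
    using finite_pairs[of "{1..n}"] by (simp add: vertex_pairs_def pairs_def)
  have "cut_size n {e \<in> vertex_pairs n. \<omega> e} A = card {e \<in> vertex_pairs n. \<omega> e \<and> ?cr e}"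
    unfolding cut_size_def by (rule arg_cong[where f = card]) auto
  also have "real \<dots> = (\<Sum>e\<in>vertex_pairs n. of_bool (\<omega> e \<and> ?cr e))"
    using fin by (simp add: sum.If_cases of_bool_def Int_def)
  also have "\<dots> = (\<Sum>e\<in>P. of_bool (\<omega> (edge e) \<and> ?cr (edge e)))"
    by (rule sum.reindex_bij_betw[OF edge_bij, symmetric])
  also have "\<dots> = cut_value (\<lambda>e. of_bool (\<omega> (edge e))) (cut_spins A)"
    unfolding cut_value_def
  proof (rule sum.cong[OF refl])
    fix e assume "e \<in> P"
    then show "of_bool (\<omega> (edge e) \<and> ?cr (edge e)) = of_bool (\<omega> (edge e)) * ((1 - edge_side e * spin_prod e (cut_spins A)) / 2)"
    proof (rule pairs_natE)
      fix a b assume ab: "a < b" "b < n" "e = {a, b}"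
      have in_n: "xs ! a \<in> {1..n}" "xs ! b \<in> {1..n}" using bij_betw_apply[OF nth_bij] ab by auto
      have cr: "?cr (edge e) \<longleftrightarrow> (xs ! a \<in> A) \<noteq> (xs ! b \<in> A)"
        using in_n unfolding edge_def ab(3) by auto
      have "spin_prod e (cut_spins A) = side a * (if xs ! a \<in> A then 1 else - 1) * (side b * (if xs ! b \<in> A then 1 else - 1))"
        using ab by (simp add: spin_prod_def cut_spins_def)
      moreover have "edge_side e = side a * side b" using ab by (simp add: edge_side_def)
      moreover have "side a * side a = 1" "side b * side b = 1" by (auto simp: side_def)
      ultimately have "edge_side e * spin_prod e (cut_spins A) = (if xs ! a \<in> A then 1 else - 1) * (if xs ! b \<in> A then 1 else - 1)"
        by (auto simp: side_def)
      then show ?thesis unfolding cr by auto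
    qed
  qed
  finally show ?thesis .
qed

text \<open>In the new gauge, equal sides of the cut become equal magnetizations of the two halves.\<close>

lemma cut_spins_balanced_iff:
  assumes A: "A \<subseteq> {1..n}"
  shows "cut_spins A \<in> balanced_spins N \<longleftrightarrow> 2 * card A = n"
proof -
  define \<sigma> :: "nat \<Rightarrow> real" where "\<sigma> i = (if xs ! i \<in> A then 1 else - 1)" for i
  have "sum_list (take N (cut_spins A)) = (\<Sum>i<N. \<sigma> i)"
    by (simp add: cut_spins_def take_map sum_list_sum_nth atLeast0LessThan side_def \<sigma>_def)
  moreover have "sum_list (drop N (cut_spins A)) = - (\<Sum>i\<in>{N..<n}. \<sigma> i)"
  proof -
    have "sum_list (drop N (cut_spins A)) = (\<Sum>i<N. - \<sigma> (N + i))"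
      by (simp add: cut_spins_def drop_map sum_list_sum_nth atLeast0LessThan side_def \<sigma>_def)
    also have "\<dots> = - (\<Sum>i\<in>{N..<n}. \<sigma> i)"
      using sum.shift_bounds_nat_ivl[of \<sigma> 0 N N] by (simp add: sum_negf atLeast0LessThan add.commute)
    finally show ?thesis .
  qed
  moreover have "(\<Sum>i<n. \<sigma> i) = (\<Sum>i<N. \<sigma> i) + (\<Sum>i\<in>{N..<n}. \<sigma> i)"
    using sum.atLeastLessThan_concat[of 0 N n \<sigma>] by (simp add: atLeast0LessThan)
  moreover have "(\<Sum>i<n. \<sigma> i) = 2 * real (card A) - n"
  proof -
    have "(\<Sum>i<n. \<sigma> i) = (\<Sum>v\<in>{1..n}. if v \<in> A then 1 else - 1)"
      unfolding \<sigma>_def by (rule sum.reindex_bij_betw[OF nth_bij, where g = "\<lambda>v. if v \<in> A then 1 else - 1"])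
    also have "\<dots> = (\<Sum>v\<in>{1..n}. 2 * of_bool (v \<in> A) - 1)" by (intro sum.cong) auto
    also have "\<dots> = 2 * real (card A) - n"
      using A by (simp add: sum_subtractf sum_distrib_left[symmetric] Int_absorb1 Int_absorb2)
    finally show ?thesis .
  qed
  ultimately show ?thesis using cut_spins_spin[of A] by (auto simp: balanced_spins_def)
qed

lemma cut_spins_image: "cut_spins ` {A. A \<subseteq> {1..n} \<and> 2 * card A = n} = balanced_spins N"
proof (intro equalityI subsetI)
  fix l assume "l \<in> cut_spins ` {A. A \<subseteq> {1..n} \<and> 2 * card A = n}"
  then show "l \<in> balanced_spins N" using cut_spins_balanced_iff by auto
next
  fix l assume l: "l \<in> balanced_spins N"
  then have l': "l \<in> spin_lists n" by (simp add: balanced_spins_def)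
  define A where "A = (!) xs ` {i. i < n \<and> side i * l ! i = 1}"
  have A: "A \<subseteq> {1..n}" using bij_betw_apply[OF nth_bij] by (auto simp: A_def)
  have mem: "xs ! i \<in> A \<longleftrightarrow> side i * l ! i = 1" if "i < n" for i
    using that nth_bij unfolding A_def by (auto simp: bij_betw_def inj_on_def)
  have "cut_spins A = l"
  proof (rule nth_equalityI)
    show "length (cut_spins A) = length l" using spin_listsD(1)[OF l'] by (simp add: cut_spins_def)
    fix i assume "i < length (cut_spins A)"
    then have i: "i < n" by (simp add: cut_spins_def)
    have "l ! i \<in> {-1, 1}" by (rule spin_listsD(2)[OF l' i])
    then show "cut_spins A ! i = l ! i" using i mem[OF i] by (auto simp: cut_spins_def side_def split: if_splits)
  qed
  then show "l \<in> cut_spins ` {A. A \<subseteq> {1..n} \<and> 2 * card A = n}"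
    using cut_spins_balanced_iff[OF A] l A by (intro image_eqI[of _ _ A]) auto
qed

lemma finite_balanced: "finite (balanced_spins N)" "balanced_spins N \<noteq> {}"
  using finite_subset[OF _ finite_spin_lists[of n], of "balanced_spins N"] balanced_mean_log_Z(1)[OF N]
  by (auto simp: balanced_spins_def)

lemma mcut_eq: "real (mcut n {e \<in> vertex_pairs n. \<omega> e}) = min_cut (\<lambda>e. of_bool (\<omega> (edge e)))"
proof -
  let ?As = "{A. A \<subseteq> {1..n} \<and> 2 * card A = n}"
  have As: "finite ?As" "?As \<noteq> {}"
    using finite_balanced(2) cut_spins_image by (auto intro: finite_subset[of _ "Pow {1..n}"])
  have "real (mcut n {e \<in> vertex_pairs n. \<omega> e}) = Min (real ` cut_size n {e \<in> vertex_pairs n. \<omega> e} ` ?As)"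
    unfolding mcut_def using As by (intro mono_Min_commute) (auto simp: mono_def)
  also have "real ` cut_size n {e \<in> vertex_pairs n. \<omega> e} ` ?As = cut_value (\<lambda>e. of_bool (\<omega> (edge e))) ` cut_spins ` ?As"
    unfolding image_image using cut_size_eq by (intro image_cong) auto
  finally show ?thesis unfolding min_cut_def cut_spins_image .
qed

end

section \<open>The expected minimum cut\<close>

lemma Min_diff_bound:
  fixes f g :: "'c \<Rightarrow> real"
  assumes T: "finite T" "T \<noteq> {}" and d: "\<And>c. c \<in> T \<Longrightarrow> \<bar>f c - g c\<bar> \<le> \<delta>"
  shows "\<bar>Min (f ` T) - Min (g ` T)\<bar> \<le> \<delta>"
proof -
  have one: "Min (f ` T) \<le> Min (g ` T) + \<delta>" if d: "\<And>c. c \<in> T \<Longrightarrow> \<bar>f c - g c\<bar> \<le> \<delta>" for f g :: "'c \<Rightarrow> real"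
  proof -
    have "Min (g ` T) \<in> g ` T" using T by (intro Min_in) auto
    then obtain c where c: "c \<in> T" "Min (g ` T) = g c" by auto
    have "Min (f ` T) \<le> f c" using T c by (intro Min_le) auto
    also have "\<dots> \<le> g c + \<delta>" using d[OF c(1)] by linarith
    finally show ?thesis using c by simp
  qed
  show ?thesis using one[of f g] one[of g f] d by (force simp: abs_minus_commute)
qed

text \<open>The free energy approximates the minimum up to the entropy, divided by \<open>\<beta>\<close>.\<close>

lemma soft_min:
  fixes f :: "'c \<Rightarrow> real"
  assumes T: "finite T" "T \<noteq> {}" and \<beta>: "\<beta> > 0"
  shows "- \<beta> * Min (f ` T) \<le> ln (\<Sum>c\<in>T. exp (- \<beta> * f c))"
    "ln (\<Sum>c\<in>T. exp (- \<beta> * f c)) \<le> - \<beta> * Min (f ` T) + ln (card T)"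
proof -
  define m where "m = Min (f ` T)"
  have pos: "(\<Sum>c\<in>T. exp (- \<beta> * f c)) > 0" using T by (intro sum_pos) auto
  have "m \<in> f ` T" unfolding m_def using T by (intro Min_in) auto
  then obtain c where c: "c \<in> T" "m = f c" by auto
  have "exp (- \<beta> * m) \<le> (\<Sum>c\<in>T. exp (- \<beta> * f c))"
    unfolding c(2) using T c(1) by (intro member_le_sum[of c T "\<lambda>c. exp (- \<beta> * f c)"]) auto
  then show "- \<beta> * Min (f ` T) \<le> ln (\<Sum>c\<in>T. exp (- \<beta> * f c))"
    using pos by (simp add: m_def ln_ge_iff)
  have "(\<Sum>c\<in>T. exp (- \<beta> * f c)) \<le> (\<Sum>c\<in>T. exp (- \<beta> * m))"
    using T \<beta> by (intro sum_mono) (auto simp: m_def intro!: mult_left_mono)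
  also have "\<dots> = card T * exp (- \<beta> * m)" by simp
  finally have "ln (\<Sum>c\<in>T. exp (- \<beta> * f c)) \<le> ln (card T * exp (- \<beta> * m))"
    using pos by (subst ln_le_cancel_iff) auto
  also have "\<dots> = ln (card T) + - \<beta> * m" using T by (simp add: ln_mult_pos card_gt_0_iff)
  finally show "ln (\<Sum>c\<in>T. exp (- \<beta> * f c)) \<le> - \<beta> * Min (f ` T) + ln (card T)" by (simp add: m_def)
qed

text \<open>The conditions \<open>\<xi> * sqrt d \<le> d\<close> and \<open>2 * d \<le> N + N\<close> ensure that the edge probabilities lie in the
  unit interval.\<close>

locale planted_model = planted_vertices +
  fixes d \<xi> \<beta> :: real
  assumes \<xi>: "\<xi> > 0" and d: "d \<ge> 1" "\<xi> * sqrt d \<le> d" and \<beta>: "\<beta> > 0" and n_large: "2 * d \<le> N + N"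
begin

definition edge_prob :: "nat set \<Rightarrow> real" where
  "edge_prob e = (d + \<xi> * sqrt d * edge_side e) / n"

text \<open>The noise on an edge carries its gauge sign and the factor \<open>\<beta> / 2\<close>, so that it enters the exponent
  of the Gibbs weights with coefficient \<open>\<plusminus>1\<close>.\<close>

definition noise_law :: "nat set \<Rightarrow> real measure" where
  "noise_law e = centred_bernoulli (\<beta> / 2 * edge_side e) (edge_prob e)"

text \<open>Recovers the edge indicator from the noise; as a function on all reals it extends the minimum
  cut to a Lipschitz function.\<close>

definition weight :: "(nat set \<Rightarrow> real) \<Rightarrow> nat set \<Rightarrow> real" where
  "weight y e = edge_prob e + 2 / \<beta> * edge_side e * y e"

definition noise_cut :: "(nat set \<Rightarrow> real) \<Rightarrow> real" where
  "noise_cut y = min_cut (weight y)"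

lemma n_pos: "real n > 0" using N by simp

lemma edge_prob_bounds: "0 \<le> edge_prob e" "edge_prob e \<le> 2 * d / n" "edge_prob e \<le> 1"
proof -
  have x: "0 \<le> \<xi> * sqrt d" using \<xi> d by simp
  have s: "edge_side e = 1 \<or> edge_side e = -1" using edge_side_sign[of e] by auto
  have 1: "0 \<le> d + \<xi> * sqrt d * edge_side e" "d + \<xi> * sqrt d * edge_side e \<le> 2 * d" using s x d by auto
  show "0 \<le> edge_prob e" unfolding edge_prob_def by (rule divide_nonneg_pos[OF 1(1) n_pos])
  show "edge_prob e \<le> 2 * d / n" unfolding edge_prob_def
    by (rule divide_right_mono[OF 1(2) less_imp_le[OF n_pos]])
  have "2 * d / n \<le> 1" using n_large n_pos by (simp add: divide_le_eq)
  with \<open>edge_prob e \<le> 2 * d / n\<close> show "edge_prob e \<le> 1" by simp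
qed

lemma light_noise: "light (noise_law e)"
  unfolding noise_law_def using edge_prob_bounds by (intro light_centred_bernoulli)

sublocale prob_space "PiM P noise_law"
  by (intro prob_space_PiM lightD(1)[OF light_noise])

lemma min_cut_cong: "(\<And>e. e \<in> P \<Longrightarrow> x e = x' e) \<Longrightarrow> min_cut x = min_cut x'"
  unfolding min_cut_def cut_value_def by (simp cong: sum.cong)

lemma noise_cut_lipschitz: "coord_lipschitz P (\<lambda>_. 2 / \<beta>) noise_cut"
  unfolding coord_lipschitz_def
proof (intro conjI allI ballI)
  show "noise_cut \<in> borel_measurable (PiM P (\<lambda>_. borel))"
    unfolding noise_cut_def min_cut_def
  proof (rule borel_measurable_Min)
    show "finite (balanced_spins N)" by (rule finite_balanced)
    show "(\<lambda>y. cut_value (weight y) l) \<in> borel_measurable (PiM P (\<lambda>_. borel))" for l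
      unfolding cut_value_def weight_def by measurable
  qed
  fix y i z assume i: "i \<in> P"
  show "\<bar>noise_cut (y(i := z)) - noise_cut y\<bar> \<le> 2 / \<beta> * \<bar>z - y i\<bar>"
    unfolding noise_cut_def min_cut_def
  proof (rule Min_diff_bound[OF finite_balanced])
    fix l assume l: "l \<in> balanced_spins N"
    define c where "c e = (1 - edge_side e * spin_prod e l) / 2" for e
    have "cut_value (weight (y(i := z))) l - cut_value (weight y) l
      = (\<Sum>e\<in>P. if e = i then 2 / \<beta> * edge_side i * (z - y i) * c i else 0)"
      unfolding cut_value_def sum_subtractf[symmetric]
    proof (rule sum.cong[OF refl])
      fix e
      have "weight (y(i := z)) e - weight y e = (if e = i then 2 / \<beta> * edge_side i * (z - y i) else 0)"
        by (simp add: weight_def right_diff_distrib)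
      then show "weight (y(i := z)) e * ((1 - edge_side e * spin_prod e l) / 2) - weight y e * ((1 - edge_side e * spin_prod e l) / 2)
        = (if e = i then 2 / \<beta> * edge_side i * (z - y i) * c i else 0)"
        by (simp only: left_diff_distrib[symmetric] c_def[symmetric]) simp
    qed
    also have "\<dots> = 2 / \<beta> * edge_side i * (z - y i) * c i" using i by (simp add: finite_pairs)
    finally have eq: "cut_value (weight (y(i := z))) l - cut_value (weight y) l = 2 / \<beta> * edge_side i * (z - y i) * c i" .
    have s: "\<bar>edge_side i\<bar> = 1" using edge_side_sign[of i] by auto
    have "spin_prod i l \<in> {-1, 1}" using l i by (intro spin_prod_sign) (auto simp: balanced_spins_def)
    then have "\<bar>c i\<bar> \<le> 1" using edge_side_sign[of i] by (auto simp: c_def)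
    then have "2 / \<beta> * \<bar>z - y i\<bar> * \<bar>c i\<bar> \<le> 2 / \<beta> * \<bar>z - y i\<bar> * 1"
      using \<beta> by (intro mult_left_mono) auto
    then show "\<bar>cut_value (weight (y(i := z))) l - cut_value (weight y) l\<bar> \<le> 2 / \<beta> * \<bar>z - y i\<bar>"
      unfolding eq abs_mult s using \<beta> by simp
  qed
qed

lemma noise_cut_measurable: "noise_cut \<in> borel_measurable (PiM P noise_law)"
  by (rule measurable_PiM_light[OF light_noise coord_lipschitzD(1)[OF noise_cut_lipschitz]])

lemma mcut_law:
  assumes B: "B \<in> sets borel"
  shows "measure_pmf.prob (planted_bisection n S ((d + \<xi> * sqrt d) / n) ((d - \<xi> * sqrt d) / n)) {E. real (mcut n E) \<in> B}
    = prob {y \<in> space (PiM P noise_law). noise_cut y \<in> B}"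
proof -
  let ?V = "vertex_pairs n"
  define inner where "inner v \<longleftrightarrow> v \<subseteq> S \<or> v \<inter> S = {}" for v
  define p where "p v = (if inner v then (d + \<xi> * sqrt d) / n else (d - \<xi> * sqrt d) / n)" for v
  define sg :: "nat set \<Rightarrow> real" where "sg v = (if inner v then 1 else - 1)" for v
  define T where "T v b = \<beta> / 2 * sg v * (of_bool b - p v)" for v b
  define Q where "Q v = distr (measure_pmf (bernoulli_pmf (p v))) borel (T v)" for v
  let ?Pi = "Pi_pmf ?V False (\<lambda>v. bernoulli_pmf (p v))"
  let ?f1 = "\<lambda>\<omega>. \<lambda>v\<in>?V. T v (\<omega> v)" and ?f2 = "\<lambda>y. \<lambda>e\<in>P. y (edge e)"
  have fin: "finite ?V" using finite_pairs[of "{1..n}"] by (simp add: vertex_pairs_def pairs_def)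
  have e: "edge e \<in> ?V" "sg (edge e) = edge_side e" "p (edge e) = edge_prob e" if "e \<in> P" for e
  proof -
    show "edge e \<in> ?V" using bij_betw_apply[OF edge_bij that] .
    have w: "inner (edge e) \<longleftrightarrow> edge_side e = 1" unfolding inner_def by (rule edge_within_iff[OF that])
    then show "sg (edge e) = edge_side e" using edge_side_sign[of e] by (auto simp: sg_def)
    show "p (edge e) = edge_prob e" using w edge_side_sign[of e] by (auto simp: p_def edge_prob_def)
  qed
  have PQ: "prob_space (Q v)" for v
    unfolding Q_def by (rule prob_space.prob_space_distr[OF prob_space_measure_pmf]) simp
  have d1: "distr (measure_pmf ?Pi) (PiM ?V Q) ?f1 = PiM ?V Q"
    by (rule Pi_pmf_transport[OF fin]) (simp add: Q_def)
  have Q_law: "noise_law e = distr (Q (edge e)) borel (\<lambda>y. y)" if "e \<in> P" for e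
    using e[OF that] by (auto simp: Q_def noise_law_def centred_bernoulli_def distr_id2 T_def[abs_def])
  have d2: "distr (PiM ?V Q) (PiM P noise_law) ?f2 = PiM P noise_law"
  proof (rule PiM_transport[OF fin PQ])
    show "inj_on edge P" "edge \<in> P \<rightarrow> ?V" using edge_bij e(1) by (auto simp: bij_betw_def)
  qed (auto simp: Q_law Q_def)
  have m1: "?f1 \<in> measure_pmf ?Pi \<rightarrow>\<^sub>M PiM ?V Q" by (rule measurable_restrict) (simp add: Q_def)
  have m2: "?f2 \<in> PiM ?V Q \<rightarrow>\<^sub>M PiM P noise_law"
  proof (rule measurable_restrict)
    fix e' assume e': "e' \<in> P"
    have "(\<lambda>y. y (edge e')) \<in> PiM ?V Q \<rightarrow>\<^sub>M Q (edge e')"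
      by (rule measurable_component_singleton[OF e(1)[OF e']])
    then show "(\<lambda>y. y (edge e')) \<in> PiM ?V Q \<rightarrow>\<^sub>M noise_law e'"
      using e' by (simp add: Q_law Q_def cong: measurable_cong_sets)
  qed
  have d12: "distr (measure_pmf ?Pi) (PiM P noise_law) (?f2 \<circ> ?f1) = PiM P noise_law"
    using distr_distr[OF m2 m1] d1 d2 by simp
  have m12: "(?f2 \<circ> ?f1) \<in> measure_pmf ?Pi \<rightarrow>\<^sub>M PiM P noise_law"
    by (rule measurable_comp[OF m1 m2])
  define A where "A = {y \<in> space (PiM P noise_law). noise_cut y \<in> B}"
  have A: "A \<in> sets (PiM P noise_law)"
    using measurable_sets[OF noise_cut_measurable B] by (simp add: A_def vimage_def Int_def conj_commute)
  have cut: "noise_cut ((?f2 \<circ> ?f1) \<omega>) = real (mcut n {v \<in> ?V. \<omega> v})" for \<omega>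
    unfolding noise_cut_def mcut_eq
  proof (rule min_cut_cong)
    fix e' assume e': "e' \<in> P"
    have "edge_side e' * edge_side e' = 1" using edge_side_sign[of e'] by auto
    moreover have "weight ((?f2 \<circ> ?f1) \<omega>) e' = edge_prob e' + edge_side e' * edge_side e' * (of_bool (\<omega> (edge e')) - edge_prob e')"
      using e' e[OF e'] \<beta> by (simp add: weight_def T_def)
    ultimately show "weight ((?f2 \<circ> ?f1) \<omega>) e' = of_bool (\<omega> (edge e'))" by simp
  qed
  have "prob A = measure (distr (measure_pmf ?Pi) (PiM P noise_law) (?f2 \<circ> ?f1)) A" by (simp only: d12)
  also have "\<dots> = measure_pmf.prob ?Pi ((?f2 \<circ> ?f1) -` A)" using measure_distr[OF m12 A] by simp
  also have "(?f2 \<circ> ?f1) -` A = {\<omega>. real (mcut n {v \<in> ?V. \<omega> v}) \<in> B}"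
    using measurable_space[OF m12] by (auto simp: A_def cut simp del: comp_apply)
  also have "measure_pmf.prob ?Pi \<dots> = measure_pmf.prob (planted_bisection n S ((d + \<xi> * sqrt d) / n) ((d - \<xi> * sqrt d) / n)) {E. real (mcut n E) \<in> B}"
    unfolding planted_bisection_def by (simp add: p_def[abs_def] inner_def vimage_def)
  finally show ?thesis by (simp add: A_def)
qed

lemma card_P: "real (card P) \<le> (real n)\<^sup>2 / 2"
  by (simp add: card_pairs power2_eq_square algebra_simps)

text \<open>The exponent \<open>2 t\<^sup>2 d n - t n / 2\<close> is negative at \<open>t = 1 / (8 d)\<close>.\<close>

lemma mcut_concentration:
  "prob {y \<in> space (PiM P noise_law). \<bar>noise_cut y - expectation noise_cut\<bar> \<ge> n / 2} \<le> 2 * exp (- (n / (32 * d)))"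
proof -
  define t where "t = 1 / (8 * d)"
  have t: "t > 0" "t \<le> 1" using d by (auto simp: t_def)
  have sum: "(\<Sum>e\<in>P. 2 * edge_prob e * r\<^sup>2) \<le> 2 * t\<^sup>2 * d * n" if "r\<^sup>2 = t\<^sup>2" for r
  proof -
    have "(\<Sum>e\<in>P. 2 * edge_prob e * r\<^sup>2) \<le> (\<Sum>e\<in>P. 2 * (2 * d / n) * r\<^sup>2)"
      by (intro sum_mono mult_right_mono mult_left_mono edge_prob_bounds) auto
    also have "\<dots> = card P * (2 * (2 * d / n) * t\<^sup>2)" using that by simp
    also have "\<dots> \<le> (real n)\<^sup>2 / 2 * (2 * (2 * d / n) * t\<^sup>2)" using d by (intro mult_right_mono card_P) auto
    also have "\<dots> = 2 * t\<^sup>2 * d * n" using n_pos by (simp add: power2_eq_square)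
    finally show ?thesis .
  qed
  have mgf: "(\<integral>\<^sup>+ y. ennreal (exp (r * (noise_cut y - expectation noise_cut))) \<partial>PiM P noise_law) \<le> ennreal (exp (2 * t\<^sup>2 * d * n))"
    if r: "r = t \<or> r = - t" for r
  proof -
    have "(\<integral>\<^sup>+ y. ennreal (exp (r * (noise_cut y - expectation noise_cut))) \<partial>PiM P noise_law) \<le> ennreal (exp (\<Sum>e\<in>P. 2 * edge_prob e * r\<^sup>2))"
    proof (rule exp_moment_product[OF _ light_noise noise_cut_lipschitz])
      fix e assume "e \<in> P"
      have s: "\<bar>edge_side e\<bar> = 1" using edge_side_sign[of e] by auto
      have sq: "(r * (2 / \<beta>) * (\<beta> / 2 * edge_side e))\<^sup>2 = r\<^sup>2"
        using \<beta> edge_side_sign[of e] by (auto simp: power_mult_distrib)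
      have "\<bar>r * (2 / \<beta>) * (\<beta> / 2 * edge_side e)\<bar> \<le> 1"
        using r t \<beta> s by (auto simp: abs_mult)
      from centred_bernoulli_mgf[OF edge_prob_bounds(1,3) this]
      show "(\<integral>y. exp (r * (2 / \<beta>) * y) \<partial>noise_law e) * (\<integral>y. exp (- (r * (2 / \<beta>)) * y) \<partial>noise_law e) \<le> exp (2 * edge_prob e * r\<^sup>2)"
        unfolding sq noise_law_def .
    qed (simp add: finite_pairs)
    also have "\<dots> \<le> ennreal (exp (2 * t\<^sup>2 * d * n))"
    proof -
      have "r\<^sup>2 = t\<^sup>2" using r by auto
      from sum[OF this] show ?thesis by (intro ennreal_leI) (simp only: exp_le_cancel_iff)
    qed
    finally show ?thesis .
  qed
  have "prob {y \<in> space (PiM P noise_law). \<bar>noise_cut y - expectation noise_cut\<bar> \<ge> n / 2} \<le> 2 * exp (2 * t\<^sup>2 * d * n - t * (n / 2))"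
    by (rule chernoff_two_sided[OF noise_cut_measurable t(1)]) (use mgf[of t] mgf[of "- t"] in auto)
  also have "2 * t\<^sup>2 * d * n - t * (n / 2) = - (n / (32 * d))"
    using d by (simp add: t_def power2_eq_square field_simps)
  finally show ?thesis .
qed

text \<open>The contribution of the mean edge weights to the exponent.\<close>

definition tilt :: "real list \<Rightarrow> real" where
  "tilt l = \<beta> / 2 * (\<Sum>e\<in>P. edge_prob e * edge_side e * spin_prod e l)"

lemma sum_edge_side: "(\<Sum>e\<in>P. edge_side e) = - (n / 2)"
proof -
  have "(\<Sum>i<n. side i) = 0"
  proof -
    have "(\<Sum>i<n. side i) = (\<Sum>i<N. side i) + (\<Sum>i\<in>{N..<n}. side i)"
      using sum.atLeastLessThan_concat[of 0 N n side] by (simp add: atLeast0LessThan)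
    also have "\<dots> = (\<Sum>i<N. 1) + (\<Sum>i\<in>{N..<n}. - 1)" by (intro arg_cong2[where f = "(+)"] sum.cong) (auto simp: side_def)
    finally show ?thesis by simp
  qed
  moreover have "(\<Sum>i<n. (side i)\<^sup>2) = n" by (simp add: side_def if_distrib[of "\<lambda>x. x\<^sup>2"] cong: if_cong)
  ultimately show ?thesis unfolding edge_side_def by (subst sum_pairs_prod) simp_all
qed

text \<open>The expected number of edges.\<close>

lemma sum_edge_prob: "(\<Sum>e\<in>P. edge_prob e) = d * n / 2 - (d + \<xi> * sqrt d) / 2"
proof -
  have "(\<Sum>e\<in>P. edge_prob e) = (card P * d + \<xi> * sqrt d * (\<Sum>e\<in>P. edge_side e)) / n"
    by (simp add: edge_prob_def sum_divide_distrib[symmetric] sum.distrib sum_distrib_left)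
  also have "\<dots> = d * n / 2 - (d + \<xi> * sqrt d) / 2"
    unfolding sum_edge_side using n_pos by (simp add: card_pairs field_simps)
  finally show ?thesis .
qed

text \<open>For a bisection the sum of the ungauged spins vanishes, so the mean degree
  contributes a constant; the difference of the two edge probabilities contributes the ferromagnetic energy.\<close>

lemma tilt_balanced:
  assumes l: "l \<in> balanced_spins N"
  shows "tilt l = ferro \<xi> (\<beta> * sqrt d / 4) n l - \<beta> / 4 * (d + \<xi> * sqrt d)"
proof -
  have l': "l \<in> spin_lists n" and bal: "sum_list (take N l) = sum_list (drop N l)" using l by (auto simp: balanced_spins_def)
  have len: "length l = n" by (rule spin_listsD(1)[OF l'])
  have sq: "(\<Sum>i<n. (l ! i)\<^sup>2) = n"
  proof -
    have "(l ! i)\<^sup>2 = 1" if "i < n" for i using spin_listsD(2)[OF l' that] by auto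
    then show ?thesis by simp
  qed
  have sl: "(\<Sum>i<n. l ! i) = sum_list l" using len by (simp add: sum_list_sum_nth atLeast0LessThan)
  have S1: "(\<Sum>e\<in>P. spin_prod e l) = ((sum_list l)\<^sup>2 - n) / 2"
    unfolding spin_prod_def by (subst sum_pairs_prod) (simp_all only: sq sl finite_lessThan)
  have S2: "(\<Sum>e\<in>P. edge_side e * spin_prod e l) = - (n / 2)"
  proof -
    have "(\<Sum>i<n. side i * l ! i) = (\<Sum>i<N. l ! i) - (\<Sum>i\<in>{N..<n}. l ! i)"
    proof -
      have "(\<Sum>i<n. side i * l ! i) = (\<Sum>i<N. side i * l ! i) + (\<Sum>i\<in>{N..<n}. side i * l ! i)"
        using sum.atLeastLessThan_concat[of 0 N n "\<lambda>i. side i * l ! i"] by (simp add: atLeast0LessThan)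
      also have "(\<Sum>i<N. side i * l ! i) = (\<Sum>i<N. l ! i)" by (simp add: side_def)
      also have "(\<Sum>i\<in>{N..<n}. side i * l ! i) = - (\<Sum>i\<in>{N..<n}. l ! i)" by (simp add: side_def sum_negf)
      finally show ?thesis by simp
    qed
    also have "(\<Sum>i<N. l ! i) = sum_list (take N l)" using len by (simp add: sum_list_sum_nth atLeast0LessThan)
    also have "(\<Sum>i\<in>{N..<n}. l ! i) = sum_list (drop N l)"
      using len sum.shift_bounds_nat_ivl[of "(!) l" 0 N N] by (simp add: sum_list_sum_nth atLeast0LessThan add.commute)
    finally have 0: "(\<Sum>i<n. side i * l ! i) = 0" using bal by simp
    have "(side i * l ! i)\<^sup>2 = (l ! i)\<^sup>2" for i by (simp add: side_def)
    then have sq': "(\<Sum>i<n. (side i * l ! i)\<^sup>2) = n" using sq by simp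
    have "(\<Sum>e\<in>P. edge_side e * spin_prod e l) = (\<Sum>e\<in>P. \<Prod>i\<in>e. side i * l ! i)"
      by (simp add: edge_side_def spin_prod_def prod.distrib)
    also have "\<dots> = - (n / 2)" by (subst sum_pairs_prod) (simp_all only: 0 sq' finite_lessThan, simp)
    finally show ?thesis .
  qed
  have "edge_prob e * edge_side e * spin_prod e l = d / n * (edge_side e * spin_prod e l) + \<xi> * sqrt d / n * spin_prod e l" for e
  proof -
    have "edge_side e * edge_side e = 1" using edge_side_sign[of e] by auto
    moreover have "edge_prob e * edge_side e * spin_prod e l = d / n * (edge_side e * spin_prod e l) + \<xi> * sqrt d / n * (edge_side e * edge_side e) * spin_prod e l"
      by (simp add: edge_prob_def add_divide_distrib algebra_simps)
    ultimately show ?thesis by simp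
  qed
  then have "tilt l = \<beta> / 2 * (d / n * (\<Sum>e\<in>P. edge_side e * spin_prod e l) + \<xi> * sqrt d / n * (\<Sum>e\<in>P. spin_prod e l))"
    by (simp add: tilt_def sum.distrib sum_distrib_left)
  also have "\<dots> = ferro \<xi> (\<beta> * sqrt d / 4) n l - \<beta> / 4 * (d + \<xi> * sqrt d)"
    unfolding S1 S2 ferro_def using n_pos by (simp add: field_simps)
  finally show ?thesis .
qed

lemma log_Z_cut:
  "log_Z n (balanced_spins N) tilt y = ln (\<Sum>l\<in>balanced_spins N. exp (- \<beta> * cut_value (weight y) l))
     + \<beta> / 2 * (\<Sum>e\<in>P. edge_prob e) + (\<Sum>e\<in>P. edge_side e * y e)"
proof -
  define C where "C = \<beta> / 2 * (\<Sum>e\<in>P. edge_prob e) + (\<Sum>e\<in>P. edge_side e * y e)"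
  have w: "gibbs_weight P tilt spin_prod y l = exp C * exp (- \<beta> * cut_value (weight y) l)" for l
  proof -
    have "- \<beta> * (weight y e * ((1 - edge_side e * spin_prod e l) / 2)) = \<beta> / 2 * (edge_prob e * edge_side e * spin_prod e l) + y e * spin_prod e l
        - (\<beta> / 2 * edge_prob e + edge_side e * y e)" for e
    proof -
      have s: "edge_side e * edge_side e = 1" using edge_side_sign[of e] by auto
      have "- \<beta> * (weight y e * ((1 - edge_side e * spin_prod e l) / 2))
        = \<beta> / 2 * (edge_prob e * edge_side e * spin_prod e l) + y e * (edge_side e * edge_side e) * spin_prod e l
        - (\<beta> / 2 * edge_prob e + edge_side e * y e)"
        using \<beta> by (simp add: weight_def field_simps)
      then show ?thesis by (simp add: s)
    qed
    then have "- \<beta> * cut_value (weight y) l = tilt l + (\<Sum>e\<in>P. y e * spin_prod e l) - C"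
      by (simp add: cut_value_def tilt_def C_def sum_distrib_left sum.distrib sum_subtractf)
    then show ?thesis by (simp add: gibbs_weight_def exp_add[symmetric])
  qed
  have "(\<Sum>l\<in>balanced_spins N. exp (- \<beta> * cut_value (weight y) l)) > 0"
    using finite_balanced by (intro sum_pos) auto
  then show ?thesis unfolding log_partition_def w
    by (simp add: sum_distrib_left[symmetric] ln_mult_pos C_def)
qed

lemma balanced_sub: "balanced_spins N \<subseteq> spin_lists n" by (auto simp: balanced_spins_def)

lemma expected_cut_log_Z:
  defines "L \<equiv> expectation (log_Z n (balanced_spins N) tilt)"
  shows "\<beta> / 2 * (\<Sum>e\<in>P. edge_prob e) - L \<le> \<beta> * expectation noise_cut"
    "\<beta> * expectation noise_cut \<le> \<beta> / 2 * (\<Sum>e\<in>P. edge_prob e) - L + n * ln 2"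
proof -
  interpret G: finite_gibbs P "balanced_spins N" tilt spin_prod
    by (rule finite_gibbs_spin[OF balanced_sub finite_balanced(2)])
  let ?c = "\<beta> / 2 * (\<Sum>e\<in>P. edge_prob e)"
  have int: "integrable (PiM P noise_law) noise_cut" "integrable (PiM P noise_law) (log_Z n (balanced_spins N) tilt)"
    by (rule coord_lipschitz_integrable[OF _ light_noise noise_cut_lipschitz], simp add: finite_pairs)
       (rule coord_lipschitz_integrable[OF G.I light_noise G.lipschitz_F])
  have z: "integrable (PiM P noise_law) (\<lambda>y. y e)" "expectation (\<lambda>y. y e) = 0" if "e \<in> P" for e
  proof -
    show "integrable (PiM P noise_law) (\<lambda>y. y e)"
      by (rule integrable_component(1)[OF G.I that light_noise light_moments(1)[OF light_noise]])
    show "expectation (\<lambda>y. y e) = 0"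
      using integrable_component(2)[where M = noise_law and f = "\<lambda>y. y", OF G.I that light_noise light_moments(1)[OF light_noise]]
        centred_bernoulli_moments(1)[OF edge_prob_bounds(1,3)] by (simp add: noise_law_def)
  qed
  let ?S = "\<lambda>y. \<Sum>e\<in>P. edge_side e * y e"
  have S: "integrable (PiM P noise_law) ?S" "expectation ?S = 0"
    using z by (auto simp: Bochner_Integration.integral_sum)
  have lnc: "ln (card (balanced_spins N)) \<le> n * ln 2"
  proof -
    have "card (balanced_spins N) \<le> 2 ^ n"
      using card_mono[OF finite_spin_lists balanced_sub] by (simp add: card_spin_lists)
    then have "real (card (balanced_spins N)) \<le> 2 ^ n" by (metis of_nat_le_iff of_nat_numeral of_nat_power)
    then have "ln (card (balanced_spins N)) \<le> ln (2 ^ n)"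
      using finite_balanced by (subst ln_le_cancel_iff) (auto simp: card_gt_0_iff)
    then show ?thesis by (simp add: ln_realpow)
  qed
  have "?c + ?S y - log_Z n (balanced_spins N) tilt y \<le> \<beta> * noise_cut y
    \<and> \<beta> * noise_cut y \<le> ?c + ?S y - log_Z n (balanced_spins N) tilt y + n * ln 2" for y
    using soft_min[OF finite_balanced \<beta>, of "cut_value (weight y)"] lnc
    unfolding log_Z_cut noise_cut_def min_cut_def by simp
  then have p: "?c + ?S y - log_Z n (balanced_spins N) tilt y \<le> \<beta> * noise_cut y"
    "\<beta> * noise_cut y \<le> ?c + ?S y - log_Z n (balanced_spins N) tilt y + n * ln 2" for y by blast+
  have i1: "integrable (PiM P noise_law) (\<lambda>y. ?c + ?S y - log_Z n (balanced_spins N) tilt y)"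
    using S int by (intro Bochner_Integration.integrable_diff Bochner_Integration.integrable_add integrable_const)
  have e1: "expectation (\<lambda>y. ?c + ?S y - log_Z n (balanced_spins N) tilt y) = ?c - L"
    using S int by (simp add: L_def prob_space)
  have "expectation (\<lambda>y. ?c + ?S y - log_Z n (balanced_spins N) tilt y) \<le> expectation (\<lambda>y. \<beta> * noise_cut y)"
    by (rule integral_mono[OF i1 integrable_mult_right[OF int(1)] p(1)])
  then show "?c - L \<le> \<beta> * expectation noise_cut" unfolding e1 by simp
  have "expectation (\<lambda>y. \<beta> * noise_cut y) \<le> expectation (\<lambda>y. ?c + ?S y - log_Z n (balanced_spins N) tilt y + n * ln 2)"
    by (rule integral_mono[OF integrable_mult_right[OF int(1)] Bochner_Integration.integrable_add[OF i1 integrable_const] p(2)])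
  also have "\<dots> = ?c - L + n * ln 2"
    unfolding Bochner_Integration.integral_add[OF i1 integrable_const] e1 by (simp add: prob_space)
  finally show "\<beta> * expectation noise_cut \<le> ?c - L + n * ln 2" by simp
qed

definition lindeberg_error :: real where
  "lindeberg_error = (real n)\<^sup>2 / 2 * ((\<beta> / 2)\<^sup>2 * (\<xi> * sqrt d / n + (2 * d / n)\<^sup>2) / 2 + (\<beta> / 2)^3 * (2 * d / n)
     + 2 * ((\<beta> / 2)\<^sup>2 * d / n) * sqrt ((\<beta> / 2)\<^sup>2 * d / n))"

text \<open>Lindeberg's theorem with the Gaussian variance \<open>(\<beta> / 2)\<^sup>2 d / n\<close>. The variance of an edge indicator
  differs from \<open>d / n\<close> by the order of \<open>\<xi> sqrt d / n\<close>; its third moment is at most the edge probability.\<close>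

lemma noise_to_gauss:
  "\<bar>expectation (log_Z n (balanced_spins N) tilt) - sk ((\<beta> / 2)\<^sup>2 * d) n (balanced_spins N) tilt\<bar> \<le> lindeberg_error"
proof -
  interpret G: finite_gibbs P "balanced_spins N" tilt spin_prod
    by (rule finite_gibbs_spin[OF balanced_sub finite_balanced(2)])
  let ?v = "(\<beta> / 2)\<^sup>2 * d / n"
  have v: "?v \<ge> 0" using d by simp
  have "\<bar>expectation (log_Z n (balanced_spins N) tilt) - sk ((\<beta> / 2)\<^sup>2 * d) n (balanced_spins N) tilt\<bar>
    \<le> (\<Sum>e\<in>P. \<bar>(\<integral>y. y\<^sup>2 \<partial>noise_law e) - (\<integral>y. y\<^sup>2 \<partial>gauss ?v)\<bar> / 2 + (\<integral>y. \<bar>y\<bar>^3 \<partial>noise_law e) + (\<integral>y. \<bar>y\<bar>^3 \<partial>gauss ?v))"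
    unfolding sk_def gexp_def
    by (rule G.lindeberg[OF light_noise light_gauss[OF v]])
       (use gauss_moments(1)[OF v] centred_bernoulli_moments(1)[OF edge_prob_bounds(1,3)] in \<open>auto simp: noise_law_def\<close>)
  also have "\<dots> \<le> (\<Sum>e\<in>P. (\<beta> / 2)\<^sup>2 * (\<xi> * sqrt d / n + (2 * d / n)\<^sup>2) / 2 + (\<beta> / 2)^3 * (2 * d / n) + 2 * ?v * sqrt ?v)"
  proof (intro sum_mono add_mono divide_right_mono)
    fix e assume "e \<in> P"
    have s: "\<bar>edge_side e\<bar> = 1" "(edge_side e)\<^sup>2 = 1" using edge_side_sign[of e] by auto
    note p = edge_prob_bounds[of e]
    have "edge_prob e - d / n = \<xi> * sqrt d / n * edge_side e" by (simp add: edge_prob_def add_divide_distrib)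
    then have "\<bar>edge_prob e - d / n\<bar> = \<xi> * sqrt d / n" using s \<xi> d by (simp add: abs_mult)
    moreover have "(edge_prob e)\<^sup>2 \<le> (2 * d / n)\<^sup>2" using p by (intro power_mono) auto
    ultimately have "\<bar>edge_prob e * (1 - edge_prob e) - d / n\<bar> \<le> \<xi> * sqrt d / n + (2 * d / n)\<^sup>2"
    proof -
      assume a: "\<bar>edge_prob e - d / n\<bar> = \<xi> * sqrt d / n" "(edge_prob e)\<^sup>2 \<le> (2 * d / n)\<^sup>2"
      have "edge_prob e * (1 - edge_prob e) - d / n = (edge_prob e - d / n) - (edge_prob e)\<^sup>2"
        by (simp add: right_diff_distrib power2_eq_square)
      moreover have "0 \<le> (edge_prob e)\<^sup>2" by simp
      moreover have "\<bar>u\<bar> \<le> x + z" if "u = w - q" "0 \<le> q" "\<bar>w\<bar> = x" "q \<le> z" for u w q x z :: real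
        using that by linarith
      ultimately show ?thesis using a by blast
    qed
    then have "(\<beta> / 2)\<^sup>2 * \<bar>edge_prob e * (1 - edge_prob e) - d / n\<bar> \<le> (\<beta> / 2)\<^sup>2 * (\<xi> * sqrt d / n + (2 * d / n)\<^sup>2)"
      by (intro mult_left_mono) auto
    moreover have "(\<integral>y. y\<^sup>2 \<partial>noise_law e) - (\<integral>y. y\<^sup>2 \<partial>gauss ?v) = (\<beta> / 2)\<^sup>2 * (edge_prob e * (1 - edge_prob e) - d / n)"
      unfolding noise_law_def centred_bernoulli_moments(2)[OF p(1,3)] gauss_moments(2)[OF v]
      using s by (simp add: power_mult_distrib power_divide right_diff_distrib)
    ultimately show "\<bar>(\<integral>y. y\<^sup>2 \<partial>noise_law e) - (\<integral>y. y\<^sup>2 \<partial>gauss ?v)\<bar> \<le> (\<beta> / 2)\<^sup>2 * (\<xi> * sqrt d / n + (2 * d / n)\<^sup>2)"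
      by (simp add: abs_mult)
    have "(\<integral>y. \<bar>y\<bar>^3 \<partial>noise_law e) \<le> \<bar>\<beta> / 2 * edge_side e\<bar>^3 * edge_prob e"
      unfolding noise_law_def by (rule centred_bernoulli_moments(3)[OF p(1,3)])
    also have "\<dots> \<le> (\<beta> / 2)^3 * (2 * d / n)"
      using p \<beta> s by (intro mult_mono) (auto simp: abs_mult power_mult_distrib)
    finally show "(\<integral>y. \<bar>y\<bar>^3 \<partial>noise_law e) \<le> (\<beta> / 2)^3 * (2 * d / n)" .
    show "(\<integral>y. \<bar>y\<bar>^3 \<partial>gauss ?v) \<le> 2 * ?v * sqrt ?v" by (rule gauss_moments(4)[OF v])
  qed auto
  also have "\<dots> = card P * ((\<beta> / 2)\<^sup>2 * (\<xi> * sqrt d / n + (2 * d / n)\<^sup>2) / 2 + (\<beta> / 2)^3 * (2 * d / n) + 2 * ?v * sqrt ?v)"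
    by simp
  also have "\<dots> \<le> lindeberg_error"
    unfolding lindeberg_error_def using \<xi> d \<beta> by (intro mult_right_mono card_P add_nonneg_nonneg) auto
  finally show ?thesis .
qed

lemma sk_tilt:
  "sk ((\<beta> / 2)\<^sup>2 * d) n (balanced_spins N) tilt
    = sk ((\<beta> / 2)\<^sup>2 * d) n (balanced_spins N) (ferro \<xi> (\<beta> * sqrt d / 4) n) - \<beta> / 4 * (d + \<xi> * sqrt d)"
proof -
  have k: "(\<beta> / 2)\<^sup>2 * d \<ge> 0" using d by simp
  have "sk ((\<beta> / 2)\<^sup>2 * d) n (balanced_spins N) tilt
    \<le> sk ((\<beta> / 2)\<^sup>2 * d) n (balanced_spins N) (ferro \<xi> (\<beta> * sqrt d / 4) n) + - (\<beta> / 4 * (d + \<xi> * sqrt d))"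
    by (rule sk_mono[OF k order_refl balanced_sub finite_balanced(2)]) (simp add: tilt_balanced)
  moreover have "sk ((\<beta> / 2)\<^sup>2 * d) n (balanced_spins N) (ferro \<xi> (\<beta> * sqrt d / 4) n)
    \<le> sk ((\<beta> / 2)\<^sup>2 * d) n (balanced_spins N) tilt + \<beta> / 4 * (d + \<xi> * sqrt d)"
    by (rule sk_mono[OF k order_refl balanced_sub finite_balanced(2)]) (simp add: tilt_balanced)
  ultimately show ?thesis by simp
qed

text \<open>The constants of order \<open>1\<close> in the expected number of edges and in the tilt cancel.\<close>

theorem expected_min_cut:
  "\<bar>\<beta> * expectation noise_cut - (\<beta> * d * n / 4 - sk ((\<beta> / 2)\<^sup>2 * d) n (balanced_spins N) (ferro \<xi> (\<beta> * sqrt d / 4) n))\<bar>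
     \<le> lindeberg_error + n * ln 2"
proof -
  have "\<beta> / 2 * (\<Sum>e\<in>P. edge_prob e) = \<beta> * d * n / 4 - \<beta> / 4 * (d + \<xi> * sqrt d)"
    unfolding sum_edge_prob by (simp add: algebra_simps)
  moreover have "0 \<le> n * ln (2 :: real)" by simp
  ultimately show ?thesis using expected_cut_log_Z noise_to_gauss unfolding sk_tilt by linarith
qed

end

section \<open>The minimum bisection of the planted graph\<close>

lemma planted_order:
  assumes S: "S \<subseteq> {1..N + N}" "2 * card S = N + N" and N: "N > 0"
  obtains xs where "planted_vertices N S xs"
proof -
  define S' where "S' = {1..N + N} - S"
  define xs where "xs = sorted_list_of_set S @ sorted_list_of_set S'"
  have fin: "finite S" "finite S'" using S finite_subset by (auto simp: S'_def)
  have "planted_vertices N S xs"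
  proof
    show "N > 0" by fact
    show "distinct xs" using fin by (auto simp: xs_def S'_def)
    show "set xs = {1..N + N}" using fin S by (auto simp: xs_def S'_def)
    fix i assume i: "i < N + N"
    have len: "length (sorted_list_of_set S) = N" "length (sorted_list_of_set S') = N"
      using S fin by (auto simp: S'_def card_Diff_subset)
    show "xs ! i \<in> S \<longleftrightarrow> i < N"
    proof (cases "i < N")
      case True
      then have "xs ! i = sorted_list_of_set S ! i" by (simp only: xs_def nth_append len if_True)
      then have "xs ! i \<in> set (sorted_list_of_set S)" using True len by simp
      then show ?thesis using fin True by simp
    next
      case False
      then have "xs ! i = sorted_list_of_set S' ! (i - N)" by (simp only: xs_def nth_append len if_False)
      then have "xs ! i \<in> set (sorted_list_of_set S')" using False i len by simp
      then show ?thesis using fin False by (simp add: S'_def)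
    qed
  qed
  then show ?thesis by (rule that)
qed

text \<open>The sum of the Lindeberg errors, the entropy and the distance to zero temperature, plus \<open>1\<close> to absorb
  everything that is small for large \<open>n\<close>.\<close>

definition scaling_error :: "real \<Rightarrow> real \<Rightarrow> real \<Rightarrow> real" where
  "scaling_error \<xi> d b = b * \<xi> / 16 + b\<^sup>2 / 8 + sqrt d / b * ln 2
     + sqrt d / 4 * \<bar>free_energy_limit \<xi> (b / 4) / (b / 4) - Cstar \<xi>\<bar> + 1"

lemma error_limit:
  fixes A B C D k :: real
  assumes "k > 0"
  shows "(\<lambda>n. real n / 2 * (A * (B / n + (C / n)\<^sup>2) / 2 + D * (C / n) + 2 * (k / n) * sqrt (k / n)))
    \<longlonglongrightarrow> A * B / 4 + D * C / 2"
proof -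
  have "(\<lambda>n. A * B / 4 + A * C\<^sup>2 / (4 * real n) + D * C / 2 + k * sqrt (k / n)) \<longlonglongrightarrow> A * B / 4 + D * C / 2"
  proof -
    have "(\<lambda>n. A * C\<^sup>2 / (4 * real n)) \<longlonglongrightarrow> 0" by real_asymp
    moreover have "(\<lambda>n. k * sqrt (k / real n)) \<longlonglongrightarrow> 0" using assms by real_asymp
    ultimately have "(\<lambda>n. A * B / 4 + A * C\<^sup>2 / (4 * real n) + D * C / 2 + k * sqrt (k / n)) \<longlonglongrightarrow> A * B / 4 + 0 + D * C / 2 + 0"
      by (intro tendsto_add tendsto_const)
    then show ?thesis by simp
  qed
  then show ?thesis
    by (rule Lim_transform_eventually, intro eventually_mono[OF eventually_gt_at_top[of 0]])
       (simp add: power2_eq_square field_simps)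
qed

text \<open>With \<open>\<beta> = b / sqrt d\<close> the Gaussian model has inverse temperature \<open>b / 4\<close>,
  independent of \<open>d\<close>, so its limiting free energy can be used for each \<open>d\<close> separately.\<close>

lemma mcut_fixed_temperature:
  fixes S :: "nat \<Rightarrow> nat set"
  assumes \<xi>: "\<xi> > 0" and S: "\<And>n. even n \<Longrightarrow> S n \<subseteq> {1..n} \<and> 2 * card (S n) = n"
    and d: "d \<ge> 1" "\<xi> * sqrt d \<le> d" and b: "b > 0"
  shows "\<forall>\<^sub>F n in sequentially. even n \<longrightarrow>
    1 - 2 * exp (- (real n / (32 * d))) \<le> measure_pmf.prob (planted_bisection n (S n) ((d + \<xi> * sqrt d) / n) ((d - \<xi> * sqrt d) / n))
      {E. \<bar>real (mcut n E) / real n - (d / 4 - Cstar \<xi> / 4 * sqrt d)\<bar> \<le> scaling_error \<xi> d b}"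
proof -
  define \<beta> where "\<beta> = b / sqrt d"
  define bt where "bt = b / 4"
  define \<phi> where "\<phi> N = sk (4 * bt\<^sup>2) (N + N) (balanced_spins N) (ferro \<xi> bt (N + N)) / (2 * real N)" for N
  define lim_err where "lim_err = b * \<xi> / 16 + b\<^sup>2 / 8 + sqrt d / b * ln 2"
  define err where "err n = ((real n) / 2 * ((\<beta> / 2)\<^sup>2 * (\<xi> * sqrt d / n + (2 * d / n)\<^sup>2) / 2 + (\<beta> / 2)^3 * (2 * d / n)
     + 2 * ((\<beta> / 2)\<^sup>2 * d / n) * sqrt ((\<beta> / 2)\<^sup>2 * d / n)) + ln 2) / \<beta>" for n :: nat
  have sd: "sqrt d > 0" "sqrt d * sqrt d = d" using d by auto
  have \<beta>: "\<beta> > 0" using b sd by (simp add: \<beta>_def)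
  have bd: "\<beta> * sqrt d = b" using sd by (simp add: \<beta>_def)
  have bd2: "\<beta>\<^sup>2 * d = b\<^sup>2" using sd d by (simp add: \<beta>_def power_divide)
  have \<phi>_lim: "\<phi> \<longlonglongrightarrow> free_energy_limit \<xi> bt"
    unfolding \<phi>_def using b \<xi> by (intro balanced_free_energy_limit) (auto simp: bt_def)
  have err_lim: "err \<longlonglongrightarrow> lim_err"
  proof -
    have "0 < (\<beta> / 2)\<^sup>2 * d" using \<beta> d by simp
    then have "err \<longlonglongrightarrow> ((\<beta> / 2)\<^sup>2 * (\<xi> * sqrt d) / 4 + (\<beta> / 2)^3 * (2 * d) / 2 + ln 2) / \<beta>"
      unfolding err_def using \<beta> by (intro tendsto_divide tendsto_add error_limit tendsto_const) auto
    also have "((\<beta> / 2)\<^sup>2 * (\<xi> * sqrt d) / 4 + (\<beta> / 2)^3 * (2 * d) / 2 + ln 2) / \<beta> = ((\<beta> / 2)\<^sup>2 * (\<xi> * sqrt d) / 4 + (\<beta> / 2)^3 * d + ln 2) / \<beta>"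
      by simp
    also have "((\<beta> / 2)\<^sup>2 * (\<xi> * sqrt d) / 4 + (\<beta> / 2)^3 * d + ln 2) / \<beta> = \<beta> * sqrt d * \<xi> / 16 + \<beta>\<^sup>2 * d / 8 + ln 2 / \<beta>"
      using \<beta> by (simp add: power2_eq_square power3_eq_cube field_simps)
    also have "\<dots> = lim_err" unfolding bd bd2 lim_err_def by (simp add: \<beta>_def)
    finally show ?thesis .
  qed
  have ev1: "\<forall>\<^sub>F n in sequentially. \<bar>\<phi> (n div 2) - free_energy_limit \<xi> bt\<bar> < b / (4 * sqrt d)"
  proof -
    have "filterlim (\<lambda>n :: nat. n div 2) at_top sequentially"
      unfolding filterlim_at_top eventually_sequentially by (metis div_le_mono div_mult_self1_is_m zero_less_numeral)
    note lim = filterlim_compose[OF \<phi>_lim this]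
    have "b / (4 * sqrt d) > 0" using b sd by simp
    from tendstoD[OF lim this] show ?thesis by (simp add: dist_real_def)
  qed
  have ev2: "\<forall>\<^sub>F n in sequentially. err n < lim_err + 1 / 4"
    using err_lim by (intro order_tendstoD(2)) auto
  have ev3: "\<forall>\<^sub>F n in sequentially. 2 * d \<le> real n" by real_asymp
  show ?thesis using ev1 ev2 ev3
  proof eventually_elim
    case (elim n)
    show ?case
    proof
      assume ev: "even n"
      define N where "N = n div 2"
      have n: "n = N + N" using ev by (auto simp: N_def)
      have N: "N > 0" using elim(3) d n by (cases "N = 0") auto
      obtain xs where "planted_vertices N (S n) xs"
        using planted_order[of "S n" N] S[OF ev] N n by auto
      then interpret planted_vertices N "S n" xs .
      interpret M: planted_model N "S n" xs d \<xi> \<beta>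
        by unfold_locales (use \<xi> d \<beta> elim(3) n in auto)
      have n0: "real n > 0" using N n by simp
      let ?E = "M.expectation M.noise_cut"
      have k: "(\<beta> / 2)\<^sup>2 * d = 4 * bt\<^sup>2" using bd2 by (simp add: bt_def power_divide)
      have t: "\<beta> * sqrt d / 4 = bt" using bd by (simp add: bt_def)
      have le: "(M.lindeberg_error + n * ln 2) / (\<beta> * n) = err n"
        unfolding M.lindeberg_error_def err_def n[symmetric] using n0 \<beta> by (simp add: power2_eq_square field_simps)
      define A where "A = \<beta> * ?E - (\<beta> * d * n / 4 - sk (4 * bt\<^sup>2) n (balanced_spins N) (ferro \<xi> bt n))"
      have "\<bar>A\<bar> \<le> M.lindeberg_error + n * ln 2"
        using M.expected_min_cut unfolding k t n[symmetric] A_def .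
      then have "\<bar>A\<bar> / (\<beta> * n) \<le> err n" unfolding le[symmetric] using \<beta> n0 by (intro divide_right_mono) auto
      moreover have "A / (\<beta> * n) = ?E / n - (d / 4 - \<phi> N / \<beta>)"
        using \<beta> n0 n by (simp add: A_def \<phi>_def field_simps)
      ultimately have 1: "\<bar>?E / n - (d / 4 - \<phi> N / \<beta>)\<bar> \<le> err n"
        using \<beta> n0 by (simp add: abs_divide abs_mult flip: \<open>A / (\<beta> * n) = ?E / n - (d / 4 - \<phi> N / \<beta>)\<close>)
      have 2: "\<bar>\<phi> N / \<beta> - free_energy_limit \<xi> bt / \<beta>\<bar> \<le> 1 / 4"
      proof -
        have "\<bar>\<phi> N / \<beta> - free_energy_limit \<xi> bt / \<beta>\<bar> = \<bar>\<phi> N - free_energy_limit \<xi> bt\<bar> / \<beta>"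
          using \<beta> by (simp add: diff_divide_distrib[symmetric] abs_divide)
        also have "\<dots> \<le> (b / (4 * sqrt d)) / \<beta>"
          using elim(1) \<beta> by (intro divide_right_mono) (auto simp: N_def)
        also have "\<dots> = 1 / 4" using b sd by (simp add: \<beta>_def)
        finally show ?thesis .
      qed
      have 3: "free_energy_limit \<xi> bt / \<beta> = sqrt d / 4 * (free_energy_limit \<xi> (b / 4) / (b / 4))"
        by (simp add: \<beta>_def bt_def)
      define X where "X = free_energy_limit \<xi> (b / 4) / (b / 4)"
      \<comment> \<open>The price of stopping at the finite temperature \<open>b / 4\<close>.\<close>
      have 4: "\<bar>sqrt d / 4 * X - Cstar \<xi> / 4 * sqrt d\<bar> = sqrt d / 4 * \<bar>X - Cstar \<xi>\<bar>"
      proof -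
        have "sqrt d / 4 * X - Cstar \<xi> / 4 * sqrt d = sqrt d / 4 * (X - Cstar \<xi>)" by (simp add: field_simps)
        from arg_cong[where f = abs, OF this] show ?thesis using sd unfolding abs_mult by simp
      qed
      \<comment> \<open>Half of the slack \<open>1\<close> is used for the mean, the other half for the fluctuations.\<close>
      have mean: "\<bar>?E / n - (d / 4 - Cstar \<xi> / 4 * sqrt d)\<bar> \<le> scaling_error \<xi> d b - 1 / 2"
        using 1 2 4 elim(2) unfolding 3 X_def[symmetric] scaling_error_def lim_err_def[symmetric] by linarith
      define G where "G = {r :: real. \<bar>r / n - (d / 4 - Cstar \<xi> / 4 * sqrt d)\<bar> \<le> scaling_error \<xi> d b}"
      have G: "G \<in> sets borel" unfolding G_def by measurable
      let ?bad = "{y \<in> space (PiM P M.noise_law). \<bar>M.noise_cut y - ?E\<bar> \<ge> n / 2}"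
      let ?good = "{y \<in> space (PiM P M.noise_law). M.noise_cut y \<in> G}"
      note [measurable] = M.noise_cut_measurable
      have "space (PiM P M.noise_law) - ?bad \<subseteq> ?good"
      proof
        fix y assume y: "y \<in> space (PiM P M.noise_law) - ?bad"
        then have "\<bar>M.noise_cut y - ?E\<bar> / n \<le> (n / 2) / n" using n0 by (intro divide_right_mono) auto
        then have "\<bar>M.noise_cut y / n - ?E / n\<bar> \<le> 1 / 2" using n0 by (simp add: diff_divide_distrib[symmetric] abs_divide)
        with mean have "\<bar>M.noise_cut y / n - (d / 4 - Cstar \<xi> / 4 * sqrt d)\<bar> \<le> scaling_error \<xi> d b" by linarith
        with y show "y \<in> ?good" by (simp add: G_def)
      qed
      then have "M.prob (space (PiM P M.noise_law) - ?bad) \<le> M.prob ?good"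
        using G by (intro M.finite_measure_mono) auto
      moreover have "M.prob (space (PiM P M.noise_law) - ?bad) = 1 - M.prob ?bad"
        by (rule M.prob_compl) measurable
      moreover have "M.prob ?bad \<le> 2 * exp (- (real n / (32 * d)))"
        using M.mcut_concentration unfolding n[symmetric] .
      ultimately have "1 - 2 * exp (- (real n / (32 * d))) \<le> M.prob ?good" by linarith
      also have "\<dots> = measure_pmf.prob (planted_bisection n (S n) ((d + \<xi> * sqrt d) / n) ((d - \<xi> * sqrt d) / n)) {E. real (mcut n E) \<in> G}"
        using M.mcut_law[OF G] unfolding n[symmetric] by simp
      finally show "1 - 2 * exp (- (real n / (32 * d))) \<le> measure_pmf.prob (planted_bisection n (S n) ((d + \<xi> * sqrt d) / n) ((d - \<xi> * sqrt d) / n))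
        {E. \<bar>real (mcut n E) / real n - (d / 4 - Cstar \<xi> / 4 * sqrt d)\<bar> \<le> scaling_error \<xi> d b}"
        by (simp add: G_def)
    qed
  qed
qed

text \<open>The error terms \<open>sqrt d / b\<close> and \<open>b\<^sup>2\<close> are both negligible against \<open>sqrt d\<close> if \<open>b\<close> tends to
  infinity more slowly than the fourth root of \<open>d\<close>; the proof takes the eighth root.\<close>

theorem lemma2p3:
  fixes \<xi> :: real and S :: "nat \<Rightarrow> nat set"
  assumes "\<xi> > 0"
    and "\<And>n. even n \<Longrightarrow> S n \<subseteq> {1..n} \<and> 2 * card (S n) = n"
  shows "\<exists>g :: real \<Rightarrow> real.
    ((\<lambda>d. g d / sqrt d) \<longlongrightarrow> 0) at_top \<and>
    (\<forall>\<^sub>F d in at_top.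
       let a = d + \<xi> * sqrt d; b = d - \<xi> * sqrt d in
       ((\<lambda>n. measure_pmf.prob (planted_bisection n (S n) (a / real n) (b / real n))
          {E. \<bar>real (mcut n E) / real n - (d / 4 - Cstar \<xi> / 4 * sqrt d)\<bar> \<le> g d})
        \<longlongrightarrow> 1) (inf sequentially (principal {n. even n})))"
proof (intro exI conjI)
  define b where "b d = d powr (1 / 8)" for d :: real
  define g where "g d = scaling_error \<xi> d (b d)" for d
  have b_top: "filterlim b at_top at_top" unfolding b_def by real_asymp
  show "((\<lambda>d. g d / sqrt d) \<longlongrightarrow> 0) at_top"
  proof -
    have "filterlim (\<lambda>d. b d / 4) at_top at_top" unfolding b_def by real_asymp
    from filterlim_compose[OF Cstar_limit this] assms(1)
    have "((\<lambda>d. free_energy_limit \<xi> (b d / 4) / (b d / 4)) \<longlongrightarrow> Cstar \<xi>) at_top" by simp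
    then have "((\<lambda>d. \<bar>free_energy_limit \<xi> (b d / 4) / (b d / 4) - Cstar \<xi>\<bar>) \<longlongrightarrow> \<bar>Cstar \<xi> - Cstar \<xi>\<bar>) at_top"
      by (intro tendsto_intros)
    then have c1: "((\<lambda>d. 1 / 4 * \<bar>free_energy_limit \<xi> (b d / 4) / (b d / 4) - Cstar \<xi>\<bar>) \<longlongrightarrow> 0) at_top"
      by (intro tendsto_mult_right_zero) simp
    have c2: "((\<lambda>d. (b d * \<xi> / 16 + (b d)\<^sup>2 / 8 + sqrt d / b d * ln 2 + 1) / sqrt d) \<longlongrightarrow> 0) at_top"
      unfolding b_def by real_asymp
    have sum: "((\<lambda>d. (b d * \<xi> / 16 + (b d)\<^sup>2 / 8 + sqrt d / b d * ln 2 + 1) / sqrt d + 1 / 4 * \<bar>free_energy_limit \<xi> (b d / 4) / (b d / 4) - Cstar \<xi>\<bar>) \<longlongrightarrow> 0 + 0) at_top"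
      by (intro tendsto_add c1 c2)
    have "\<forall>\<^sub>F d in at_top. (b d * \<xi> / 16 + (b d)\<^sup>2 / 8 + sqrt d / b d * ln 2 + 1) / sqrt d + 1 / 4 * \<bar>free_energy_limit \<xi> (b d / 4) / (b d / 4) - Cstar \<xi>\<bar> = g d / sqrt d"
      using eventually_gt_at_top[of 0]
      by eventually_elim (simp add: g_def scaling_error_def add_divide_distrib)
    from Lim_transform_eventually[OF sum this] show ?thesis by simp
  qed
  have "\<forall>\<^sub>F d in at_top. \<xi> * sqrt d \<le> d" by real_asymp
  then show "\<forall>\<^sub>F d in at_top.
       let a = d + \<xi> * sqrt d; b = d - \<xi> * sqrt d in
       ((\<lambda>n. measure_pmf.prob (planted_bisection n (S n) (a / real n) (b / real n))
          {E. \<bar>real (mcut n E) / real n - (d / 4 - Cstar \<xi> / 4 * sqrt d)\<bar> \<le> g d})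
        \<longlongrightarrow> 1) (inf sequentially (principal {n. even n}))"
    using eventually_ge_at_top[of 1]
  proof eventually_elim
    case (elim d)
    have "b d > 0" using elim by (simp add: b_def)
    from mcut_fixed_temperature[OF assms elim(2) elim(1) this]
    have low: "\<forall>\<^sub>F n in inf sequentially (principal {n. even n}).
      1 - 2 * exp (- (real n / (32 * d))) \<le> measure_pmf.prob (planted_bisection n (S n) ((d + \<xi> * sqrt d) / n) ((d - \<xi> * sqrt d) / n))
      {E. \<bar>real (mcut n E) / real n - (d / 4 - Cstar \<xi> / 4 * sqrt d)\<bar> \<le> g d}"
      by (simp add: eventually_inf_principal g_def)
    have "(\<lambda>n. 1 - 2 * exp (- (real n / (32 * d)))) \<longlonglongrightarrow> 1" using elim(2) by real_asymp
    then have lim: "((\<lambda>n. 1 - 2 * exp (- (real n / (32 * d)))) \<longlongrightarrow> 1) (inf sequentially (principal {n. even n}))"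
      by (rule tendsto_mono[OF inf_le1])
    show ?case unfolding Let_def
      by (rule tendsto_sandwich[OF low _ lim tendsto_const]) (simp add: measure_pmf.prob_le_1)
  qed
qed

end
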